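(* There exist $\epsilon>0$ and $0<\phi<\pi/2$ such that $S$ has a unique single-valued holomorphic continuation to $$\Delta(\sigma,\epsilon,\phi)=\{y\in\mathbb C:|y|<\sigma+\epsilon,\ y\ne\sigma,\ |\operatorname{Arg}(y-\sigma)|>\phi\}.$$ Moreover, for a polynomial $Q_4$ of degree at most four, uniformly (as $y\to\sigma$) in every fixed smaller $\Delta$-sector, $$S(y)=Q_4\left(1-\frac y\sigma\right)-\frac1{\pi A^5}\left(1-\frac y\sigma\right)^4\operatorname{Log}\left(1-\frac y\sigma\right)+O\left(\left(1-\frac y\sigma\right)^5\left[1+\left|\operatorname{Log}\left(1-\frac y\sigma\right)\right|\right]\right).$$ The point $\sigma$ is the unique singularity of $S$ on its circle of convergence.
   Context: Let ${}_2F_1$ be the Gauss hypergeometric function, and let $$F(z)=\frac1{4z^2}\left(1+6z-{}_2F_1\left(-\tfrac12,-\tfrac12;1;16z\right)-2z\,{}_2F_1\left(-\tfrac12,\tfrac32;3;16z\right)\right),$$ with removable value $F(0)=1$; its Taylor expansion begins $F(z)=1+z+3z^2+14z^3+84z^4+\cdots$ (the ordinary generating function of 3-noncrossing matchings by number of arcs). The power series $S(y)=\sum_{n\ge0}S(n)y^n$ is uniquely determined by $S\bigl(zF(z)^2\bigr)=F(z)$. Constants: $\rho=\frac1{16}$, $F_0=F(\rho)$, $\sigma=\rho F_0^2$, $A=1+\frac{2\rho F'(\rho)}{F_0}$, where $F(\rho),F'(\rho)$ are the sums at $\rho$ of the (convergent) Taylor series of $F$ and of its termwise derivative. Explicitly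 $F_0=88-\frac{4096}{15\pi}$, $A=\frac{1280-405\pi}{165\pi-512}>0$, $\sigma=\frac{4(165\pi-512)^2}{225\pi^2}$. $\operatorname{Log}$ and $\operatorname{Arg}$ are the principal logarithm and argument. A smaller $\Delta$-sector is a set $\{y:0<|y-\sigma|<\epsilon',\ |\operatorname{Arg}(y-\sigma)|>\phi'\}$ with $0<\epsilon'<\epsilon$ and $\phi<\phi'<\pi/2$. *)

theory Defs
  imports "HOL-Complex_Analysis.Complex_Analysis" "HOL-Library.Landau_Symbols"
begin

unbundle fps_syntax

(* Sum of the Gauss series.  It is only used inside and on the unit circle, and for parameters
   with c - a - b > 0, so that the series converges there; outside the unit circle
   the value is meaningless. *)
definition gauss_2F1 :: "complex \<Rightarrow> complex \<Rightarrow> complex \<Rightarrow> complex \<Rightarrow> complex" where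
  "gauss_2F1 a b c z = eval_fps (fps_hypergeo [a, b] [c] 1) z"

definition F :: "complex \<Rightarrow> complex" where
  "F z = (if z = 0 then 1
          else 1 / (4 * z\<^sup>2) *
            (1 + 6 * z - gauss_2F1 (- 1 / 2) (- 1 / 2) 1 (16 * z)
               - 2 * z * gauss_2F1 (- 1 / 2) (3 / 2) 3 (16 * z)))"

definition F_series :: "complex fps" where
  "F_series = fps_expansion F 0"

definition S_series :: "complex fps" where
  "S_series = (THE s. s oo (fps_X * F_series\<^sup>2) = F_series)"

lemma S_series_unique_existence: "\<exists>!s. s oo (fps_X * F_series\<^sup>2) = F_series"
proof -
  define a where "a = fps_X * F_series\<^sup>2"
  have "F_series $ 0 = 1"
    by (simp add: F_series_def fps_expansion_def F_def)
  then have a0: "a $ 0 = 0" and a1: "a $ 1 \<noteq> 0"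
    by (simp_all add: a_def power2_eq_square)
  have inv0: "fps_inv a $ 0 = 0"
    by (simp add: fps_inv_def)
  show ?thesis unfolding a_def[symmetric]
  proof (rule ex1I)
    show "(F_series oo fps_inv a) oo a = F_series"
      by (simp add: fps_compose_assoc[OF a0 inv0, symmetric] fps_inv[OF a0 a1])
  next
    fix s assume "s oo a = F_series"
    then have "F_series oo fps_inv a = s oo (a oo fps_inv a)"
      using fps_compose_assoc[OF inv0 a0, of s] by simp
    then show "s = F_series oo fps_inv a"
      by (simp add: fps_inv_right[OF a0 a1])
  qed
qed

(* The Taylor coefficients of F are real, so taking real parts below only
   changes the type of the constants. *)
definition \<rho> :: real where
  "\<rho> = 1 / 16"

definition F\<^sub>0 :: real where
  "F\<^sub>0 = Re (eval_fps F_series (of_real \<rho>))"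

definition F\<^sub>0' :: real where
  "F\<^sub>0' = Re (eval_fps (fps_deriv F_series) (of_real \<rho>))"

definition \<sigma> :: real where
  "\<sigma> = \<rho> * F\<^sub>0\<^sup>2"

definition A :: real where
  "A = 1 + 2 * \<rho> * F\<^sub>0' / F\<^sub>0"

definition Delta :: "real \<Rightarrow> real \<Rightarrow> real \<Rightarrow> complex set" where
  "Delta s \<epsilon> \<phi> =
     {y. norm y < s + \<epsilon> \<and> y \<noteq> of_real s \<and> \<bar>Arg (y - of_real s)\<bar> > \<phi>}"

definition Delta_sector :: "real \<Rightarrow> real \<Rightarrow> real \<Rightarrow> complex set" where
  "Delta_sector s \<epsilon>' \<phi>' =
     {y. 0 < norm (y - of_real s) \<and> norm (y - of_real s) < \<epsilon>' \<and> \<bar>Arg (y - of_real s)\<bar> > \<phi>'}"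

definition holomorphic_continuation ::
    "complex fps \<Rightarrow> complex set \<Rightarrow> (complex \<Rightarrow> complex) \<Rightarrow> bool" where
  "holomorphic_continuation f D g \<longleftrightarrow>
     0 < fps_conv_radius f \<and> eball 0 (fps_conv_radius f) \<subseteq> D \<and>
     g holomorphic_on D \<and> (\<forall>y\<in>eball 0 (fps_conv_radius f). g y = eval_fps f y)"

(* Points of the circle of convergence to which f has no local holomorphic continuation. *)
definition boundary_singularities :: "complex fps \<Rightarrow> complex set" where
  "boundary_singularities f =
     {w. ereal (norm w) = fps_conv_radius f \<and>
         \<not> (\<exists>r>0. \<exists>h. h holomorphic_on ball w r \<and>
              (\<forall>y\<in>ball w r \<inter> eball 0 (fps_conv_radius f). h y = eval_fps f y))}"

end

theory Submission
  imports Defs "HOL-Real_Asymp.Real_Asymp"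
begin

unbundle no vec_syntax

text \<open>
  Put \<open>x = 16 z\<close>. The coefficients of \<open>F\<close>, divided by \<open>16\<^sup>n\<close>, are the moments of a product of two
  independent Beta variables, so \<open>F(z) = \<Phi>(x) = \<integral> 1 / (1 - t x) d\<mu>(t)\<close> for a positive measure on
  \<open>(0, 1)\<close> whose density is \<open>(1 - t)\<^sup>4 (1/\<pi> + O(1 - t))\<close> at \<open>1\<close>. Off a closed cone with apex \<open>1\<close>
  around \<open>[1, \<infinity>)\<close> one has \<open>|1 - t x| \<ge> (4/5) (1 - t)\<close>; hence \<open>\<Phi>\<close> is so close to
  constant that \<open>\<Psi>(x) = x (\<Phi>(x) / F\<^sub>0)\<^sup>2\<close> is injective for \<open>|x| \<le> 2\<close> off the cone, and that \<open>\<Psi>\<close> maps the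
  boundary of this region outside a \<open>\<Delta>\<close>-domain at \<open>1\<close>. By connectedness the \<open>\<Delta>\<close>-domain is
  covered by the image, and \<open>S\<close> continues as \<open>\<Phi> \<circ> \<Psi>\<^sup>-\<^sup>1\<close> after scaling by \<open>\<sigma>\<close>. The expansion of \<open>\<Phi>\<close> at \<open>1\<close>
  has the singular term \<open>- (1/\<pi>) (1 - x)\<^sup>4 Log (1 - x)\<close>, and inverting \<open>\<Psi>\<close> divides its
  coefficient by \<open>A\<^sup>5\<close>. A nonzero logarithmic term excludes an analytic continuation to \<open>\<sigma>\<close>.
\<close>

section \<open>Cauchy transforms of measures on the unit interval\<close>

text \<open>The difficulty is global. At \<sigma> the map z F(z)^2 is linear up to a logarithmic
  perturbation, so it has no holomorphic inverse in a full neighbourhood, and a local inverse near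
  \<sigma> would still have to be glued to the power series along the whole circle. A single region
  on which the map is injective, with control of the image of its boundary, settles both at once.
  The integral makes such a region accessible: it continues \<Phi> beyond the unit circle, and the
  resolvent identity 1/(1 - t x) - 1/(1 - t y) = t (x - y) / ((1 - t x) (1 - t y)) bounds all
  differences of values of \<Phi> by two positive sums, one at most 1/12 and the other at most
  0.115. The two Beta laws come from splitting the scaled coefficient as (1/2)_n / (3)_n times
  (3/2)_n / (4)_n. The factor 1/pi is B(5/2, 5/2) / (B(1/2, 5/2) B(3/2, 5/2)).\<close>

definition W :: "complex set" where
  "W = {x. Re (x - 1) \<le> 3/5 * norm (x - 1)}"

text \<open>The real number 1 - t and v = t (x - 1) enclose an angle with cosine at most 3/5, so
  their distance is at least the sine 4/5 times either length. The two completed squares minimise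
  over |v| and over 1 - t respectively.\<close>

lemma W_kernel:
  assumes "x \<in> W" "0 \<le> t" "t \<le> 1"
  shows "norm (1 - of_real t * x) \<ge> 4/5 * (1 - t)"
    and "norm (1 - of_real t * x) \<ge> 4/5 * (t * norm (x - 1))"
proof -
  define v where "v = of_real t * (x - 1)"
  have nv: "norm v = t * norm (x - 1)" using assms by (simp add: v_def norm_mult)
  have "Re v = t * Re (x - 1)" by (simp add: v_def)
  also have "\<dots> \<le> t * (3/5 * norm (x - 1))"
    using assms by (intro mult_left_mono) (auto simp: W_def)
  finally have re: "Re v \<le> 3/5 * norm v" by (simp add: nv)
  have eq: "1 - of_real t * x = of_real (1 - t) - v" by (simp add: v_def algebra_simps)
  have n2: "(norm (1 - of_real t * x))\<^sup>2 = (1 - t)\<^sup>2 - 2 * (1 - t) * Re v + (norm v)\<^sup>2"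
    unfolding eq cmod_power2 by (simp add: power2_eq_square algebra_simps)
  have "(1 - t) * Re v \<le> (1 - t) * (3/5 * norm v)"
    using re assms by (intro mult_left_mono) auto
  then have ge: "(norm (1 - of_real t * x))\<^sup>2 \<ge> (1 - t)\<^sup>2 - 6/5 * (1 - t) * norm v + (norm v)\<^sup>2"
    using n2 by (simp only: mult.assoc)
  have "(1 - t)\<^sup>2 - 6/5 * (1 - t) * norm v + (norm v)\<^sup>2 = (4/5 * (1 - t))\<^sup>2 + (3/5 * (1 - t) - norm v)\<^sup>2"
    by (simp add: power2_eq_square field_simps)
  with ge have "(4/5 * (1 - t))\<^sup>2 \<le> (norm (1 - of_real t * x))\<^sup>2"
    using zero_le_power2[of "3/5 * (1 - t) - norm v"] by linarith
  then show "norm (1 - of_real t * x) \<ge> 4/5 * (1 - t)"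
    by (rule power2_le_imp_le) simp
  have "(1 - t)\<^sup>2 - 6/5 * (1 - t) * norm v + (norm v)\<^sup>2 = (4/5 * norm v)\<^sup>2 + (3/5 * norm v - (1 - t))\<^sup>2"
    by (simp add: power2_eq_square field_simps)
  with ge have "(4/5 * norm v)\<^sup>2 \<le> (norm (1 - of_real t * x))\<^sup>2"
    using zero_le_power2[of "3/5 * norm v - (1 - t)"] by linarith
  then have "4/5 * norm v \<le> norm (1 - of_real t * x)"
    by (rule power2_le_imp_le) simp
  then show "norm (1 - of_real t * x) \<ge> 4/5 * (t * norm (x - 1))" by (simp add: nv)
qed

lemma W_kernel_nonzero:
  assumes "x \<in> W" "0 < t" "t < 1"
  shows "1 - of_real t * x \<noteq> 0"
  using W_kernel(1)[of x t] assms by auto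

lemma one_in_W: "1 \<in> W" and zero_in_W: "0 \<in> W" by (simp_all add: W_def)

lemma closed_W: "closed W"
  unfolding W_def by (intro closed_Collect_le continuous_intros)

lemma cball_subset_W: assumes "norm x \<le> 1" shows "x \<in> W"
proof -
  have "Re x \<le> 1" using complex_Re_le_cmod[of x] assms by linarith
  then have "Re (x - 1) \<le> 0" by simp
  also have "0 \<le> 3/5 * norm (x - 1)" by simp
  finally show ?thesis by (simp add: W_def)
qed

lemma W_kernel_inverse_le:
  assumes "x \<in> W" "0 < t" "t < 1"
  shows "norm (1 / (1 - of_real t * x)) \<le> 5/4 * (1 / (1 - t))"
proof -
  have "norm (1 / (1 - of_real t * x)) = 1 / norm (1 - of_real t * x)" by (simp add: norm_divide)
  also have "\<dots> \<le> 1 / (4/5 * (1 - t))"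
    using W_kernel(1)[of x t] assms by (intro divide_left_mono mult_pos_pos) auto
  finally show ?thesis by simp
qed

text \<open>Integrability of \<open>1 / (1 - t) ^ 4\<close> pays for four Taylor terms of the
  transform at the boundary point 1. For a density of order (1 - t)^4 the next power fails to be
  integrable, and there the logarithm arises.\<close>

locale moment_measure =
  fixes M :: "real measure"
  assumes sets_M [measurable_cong]: "sets M = sets borel"
    and AE_01: "AE t in M. 0 < t \<and> t < 1"
    and integrable_4: "integrable M (\<lambda>t. 1 / (1 - t) ^ 4)"
begin

lemma integrable_bounded:
  fixes f :: "real \<Rightarrow> 'a :: {banach, second_countable_topology}"
  assumes [measurable]: "f \<in> borel_measurable borel"
    and bnd: "\<And>t. 0 < t \<Longrightarrow> t < 1 \<Longrightarrow> norm (f t) \<le> C / (1 - t) ^ k" and "k \<le> 4" "0 \<le> C"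
  shows "integrable M f"
proof (rule Bochner_Integration.integrable_bound)
  show "integrable M (\<lambda>t. C * (1 / (1 - t) ^ 4))" by (intro integrable_mult_right integrable_4)
  show "AE t in M. norm (f t) \<le> norm (C * (1 / (1 - t) ^ 4))"
    using AE_01
  proof eventually_elim
    case (elim t)
    have "norm (f t) \<le> C / (1 - t) ^ k" using elim bnd by auto
    also have "\<dots> \<le> C / (1 - t) ^ 4"
      using elim assms by (intro divide_left_mono power_decreasing) auto
    finally show ?case using elim assms by simp
  qed
qed simp

lemma integrable_pow [simp]: "integrable M (\<lambda>t. t ^ n)"
proof (rule integrable_bounded[where C = 1 and k = 0])
  fix t :: real assume "0 < t" "t < 1"
  then show "norm (t ^ n) \<le> 1 / (1 - t) ^ 0" by (simp add: power_le_one)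
qed auto

lemma integrable_pow_div:
  assumes "k \<le> 4" shows "integrable M (\<lambda>t. t ^ n / (1 - t) ^ k)"
proof (rule integrable_bounded[where C = 1 and k = k])
  fix t :: real assume "0 < t" "t < 1"
  then show "norm (t ^ n / (1 - t) ^ k) \<le> 1 / (1 - t) ^ k"
    by (simp add: power_le_one divide_right_mono)
qed (use assms in auto)

definition \<Phi> :: "complex \<Rightarrow> complex" where
  "\<Phi> x = (\<integral>t. 1 / (1 - of_real t * x) \<partial>M)"

text \<open>\<open>J1\<close> is \<Phi>(1) - \<Phi>(0), the sum of the moments of positive index;
  \<open>J2\<close> is the formal derivative of \<Phi> at 1, the sum of n times the n-th
  moment.\<close>

definition J1 :: real where "J1 = (\<integral>t. t / (1 - t) \<partial>M)"
definition J2 :: real where "J2 = (\<integral>t. t / (1 - t)\<^sup>2 \<partial>M)"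

lemma integrable_kernel:
  assumes "x \<in> W" shows "integrable M (\<lambda>t. 1 / (1 - of_real t * x))"
proof (rule integrable_bounded[where C = "5/4" and k = 1])
  fix t :: real assume "0 < t" "t < 1"
  then show "norm (1 / (1 - of_real t * x)) \<le> 5/4 / (1 - t) ^ 1"
    using W_kernel_inverse_le[OF assms] by simp
qed auto

lemma kernel2_le:
  assumes "x \<in> W" "y \<in> W" "0 < t" "t < 1"
  shows "norm (of_real t / ((1 - of_real t * x) * (1 - of_real t * y))) \<le> 25/16 * (t / (1 - t)\<^sup>2)"
proof -
  have "norm (of_real t / ((1 - of_real t * x) * (1 - of_real t * y)))
     = t * (norm (1 / (1 - of_real t * x)) * norm (1 / (1 - of_real t * y)))"
    using assms by (simp add: norm_divide norm_mult)
  also have "\<dots> \<le> t * (5/4 * (1 / (1 - t)) * (5/4 * (1 / (1 - t))))"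
    using assms by (intro mult_left_mono mult_mono W_kernel_inverse_le) auto
  also have "\<dots> = 25/16 * (t * (1 / (1 - t))\<^sup>2)" unfolding power2_eq_square by algebra
  finally show ?thesis by (simp only: power_one_over times_divide_eq_right mult_1_right)
qed

lemma integrable_kernel2:
  assumes "x \<in> W" "y \<in> W"
  shows "integrable M (\<lambda>t. of_real t / ((1 - of_real t * x) * (1 - of_real t * y)))"
proof (rule integrable_bounded[where C = "25/16" and k = 2])
  fix t :: real assume t: "0 < t" "t < 1"
  have "norm (of_real t / ((1 - of_real t * x) * (1 - of_real t * y))) \<le> 25/16 * (t / (1 - t)\<^sup>2)"
    using kernel2_le assms t by blast
  also have "\<dots> \<le> 25/16 * (1 / (1 - t)\<^sup>2)"
    using t by (intro mult_left_mono divide_right_mono) auto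
  finally show "norm (of_real t / ((1 - of_real t * x) * (1 - of_real t * y))) \<le> 25/16 / (1 - t) ^ 2"
    by simp
qed auto

text \<open>The resolvent identity under the integral. It yields Lipschitz bounds on all of
  \<open>W\<close>, which is not convex, so that integrating a derivative along segments is no
  option.\<close>

lemma Phi_diff:
  assumes "x \<in> W" "y \<in> W"
  shows "\<Phi> x - \<Phi> y = (x - y) * (\<integral>t. of_real t / ((1 - of_real t * x) * (1 - of_real t * y)) \<partial>M)"
proof -
  have "\<Phi> x - \<Phi> y = (\<integral>t. 1 / (1 - of_real t * x) - 1 / (1 - of_real t * y) \<partial>M)"
    unfolding \<Phi>_def using assms
    by (intro Bochner_Integration.integral_diff[symmetric] integrable_kernel)
  also have "\<dots> = (\<integral>t. (x - y) * (of_real t / ((1 - of_real t * x) * (1 - of_real t * y))) \<partial>M)"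
  proof (rule integral_cong_AE)
    show "AE t in M. 1 / (1 - of_real t * x) - 1 / (1 - of_real t * y)
        = (x - y) * (of_real t / ((1 - of_real t * x) * (1 - of_real t * y)))"
      using AE_01
    proof eventually_elim
      case (elim t)
      then have "1 - of_real t * x \<noteq> 0" "1 - of_real t * y \<noteq> 0"
        using assms W_kernel_nonzero by auto
      then show ?case by (simp add: field_simps)
    qed
  qed auto
  also have "\<dots> = (x - y) * (\<integral>t. of_real t / ((1 - of_real t * x) * (1 - of_real t * y)) \<partial>M)"
    by (rule integral_mult_right_zero)
  finally show ?thesis .
qed

lemma integral_norm_bound_AE:
  fixes f :: "real \<Rightarrow> complex"
  assumes "integrable M f" "integrable M g" "\<And>t. 0 < t \<Longrightarrow> t < 1 \<Longrightarrow> norm (f t) \<le> g t"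
  shows "norm (\<integral>t. f t \<partial>M) \<le> (\<integral>t. g t \<partial>M)"
proof -
  have "norm (\<integral>t. f t \<partial>M) \<le> (\<integral>t. norm (f t) \<partial>M)" by (rule integral_norm_bound)
  also have "\<dots> \<le> (\<integral>t. g t \<partial>M)"
    using assms AE_01 by (intro integral_mono_AE) auto
  finally show ?thesis .
qed

lemma integrable_J1: "integrable M (\<lambda>t. t / (1 - t))"
  using integrable_pow_div[of 1 1] by simp

lemma integrable_J2: "integrable M (\<lambda>t. t / (1 - t)\<^sup>2)"
  using integrable_pow_div[of 2 1] by simp

lemma Phi_lipschitz:
  assumes "x \<in> W" "y \<in> W"
  shows "norm (\<Phi> x - \<Phi> y) \<le> 25/16 * J2 * norm (x - y)"
proof -
  have "norm (\<integral>t. of_real t / ((1 - of_real t * x) * (1 - of_real t * y)) \<partial>M)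
     \<le> (\<integral>t. 25/16 * (t / (1 - t)\<^sup>2) \<partial>M)"
    using integrable_J2
    by (intro integral_norm_bound_AE integrable_kernel2 assms integrable_mult_right kernel2_le) auto
  also have "\<dots> = 25/16 * J2" by (simp only: J2_def integral_mult_right_zero)
  finally show ?thesis
    unfolding Phi_diff[OF assms] norm_mult by (subst mult.commute) (rule mult_right_mono, simp_all)
qed

text \<open>With 1 as second point one kernel is exactly 1 / (1 - t), which saves a factor 5/4
  against the general bound. With 0 as second point one kernel is 1, and \<open>J1\<close> takes the
  place of \<open>J2\<close>.\<close>

lemma Phi_lipschitz_one:
  assumes "x \<in> W"
  shows "norm (\<Phi> x - \<Phi> 1) \<le> 5/4 * J2 * norm (x - 1)"
proof -
  have "norm (\<integral>t. of_real t / ((1 - of_real t * x) * (1 - of_real t * 1)) \<partial>M)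
     \<le> (\<integral>t. 5/4 * (t / (1 - t)\<^sup>2) \<partial>M)"
  proof (intro integral_norm_bound_AE integrable_kernel2 assms one_in_W)
    show "integrable M (\<lambda>t. 5/4 * (t / (1 - t)\<^sup>2))" by (intro integrable_mult_right integrable_J2)
    fix t :: real assume t: "0 < t" "t < 1"
    have "norm (1 - complex_of_real t) = 1 - t"
      using t norm_of_real[of "1 - t", where 'a = complex] by simp
    then have "norm (of_real t / ((1 - of_real t * x) * (1 - of_real t * 1)))
       = t / (1 - t) * norm (1 / (1 - of_real t * x))"
      using t by (simp add: norm_divide norm_mult)
    also have "\<dots> \<le> t / (1 - t) * (5/4 * (1 / (1 - t)))"
      using t assms by (intro mult_left_mono W_kernel_inverse_le) auto
    also have "\<dots> = 5/4 * (t / (1 - t)\<^sup>2)"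
      by (simp only: power2_eq_square times_divide_eq_left times_divide_eq_right divide_divide_eq_left mult_1_right mult_ac)
    finally show "norm (of_real t / ((1 - of_real t * x) * (1 - of_real t * 1))) \<le> 5/4 * (t / (1 - t)\<^sup>2)" .
  qed
  also have "\<dots> = 5/4 * J2" by (simp only: J2_def integral_mult_right_zero)
  finally show ?thesis
    unfolding Phi_diff[OF assms one_in_W] norm_mult by (subst mult.commute) (rule mult_right_mono, simp_all)
qed

lemma Phi_lipschitz_zero:
  assumes "x \<in> W"
  shows "norm (\<Phi> x - \<Phi> 0) \<le> 5/4 * J1 * norm x"
proof -
  have "norm (\<integral>t. of_real t / ((1 - of_real t * x) * (1 - of_real t * 0)) \<partial>M)
     \<le> (\<integral>t. 5/4 * (t / (1 - t)) \<partial>M)"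
  proof (intro integral_norm_bound_AE integrable_kernel2 assms zero_in_W)
    show "integrable M (\<lambda>t. 5/4 * (t / (1 - t)))" by (intro integrable_mult_right integrable_J1)
    fix t :: real assume t: "0 < t" "t < 1"
    have "norm (of_real t / ((1 - of_real t * x) * (1 - of_real t * 0)))
       = t * norm (1 / (1 - of_real t * x))"
      using t by (simp add: norm_divide norm_mult)
    also have "\<dots> \<le> t * (5/4 * (1 / (1 - t)))"
      using t assms by (intro mult_left_mono W_kernel_inverse_le) auto
    also have "\<dots> = 5/4 * (t / (1 - t))" by (simp only: times_divide_eq_left times_divide_eq_right mult_1_right mult_ac)
    finally show "norm (of_real t / ((1 - of_real t * x) * (1 - of_real t * 0))) \<le> 5/4 * (t / (1 - t))" .
  qed
  also have "\<dots> = 5/4 * J1" by (simp only: J1_def integral_mult_right_zero)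
  finally have "norm (\<integral>t. of_real t / ((1 - of_real t * x) * (1 - of_real t * 0)) \<partial>M) \<le> 5/4 * J1" .
  then have "norm (x - 0) * norm (\<integral>t. of_real t / ((1 - of_real t * x) * (1 - of_real t * 0)) \<partial>M) \<le> norm (x - 0) * (5/4 * J1)"
    by (intro mult_left_mono) auto
  then show ?thesis
    unfolding Phi_diff[OF assms zero_in_W] norm_mult by (simp add: mult_ac)
qed

lemma Phi_continuous_on: "continuous_on W \<Phi>"
proof (rule continuous_onI)
  fix x e :: complex and d :: real
  assume x: "x \<in> W" and d: "0 < d"
  have c: "0 < 1 + 25/16 * \<bar>J2\<bar>" by (simp add: add_pos_nonneg)
  have "dist (\<Phi> y) (\<Phi> x) \<le> d" if "y \<in> W" "dist y x < d / (1 + 25/16 * \<bar>J2\<bar>)" for y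
  proof -
    have "dist (\<Phi> y) (\<Phi> x) \<le> 25/16 * J2 * dist y x"
      using Phi_lipschitz[OF that(1) x] by (simp add: dist_norm)
    also have "\<dots> \<le> (1 + 25/16 * \<bar>J2\<bar>) * dist y x" by (intro mult_right_mono) auto
    also have "\<dots> \<le> (1 + 25/16 * \<bar>J2\<bar>) * (d / (1 + 25/16 * \<bar>J2\<bar>))"
      using that by (intro mult_left_mono) auto
    also have "\<dots> = d" using c by (metis less_irrefl nonzero_mult_div_cancel_left times_divide_eq_right)
    finally show ?thesis .
  qed
  then show "\<exists>e>0. \<forall>y\<in>W. dist y x < e \<longrightarrow> dist (\<Phi> y) (\<Phi> x) \<le> d"
    using d c by (intro exI[of _ "d / (1 + 25/16 * \<bar>J2\<bar>)"] conjI divide_pos_pos) blast+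
qed

end

text \<open>A second use of the resolvent identity bounds the error of the difference quotient by
  \<open>C * norm (y - x)\<close> with three kernels, each at most 5/4 / (1 - t). This replaces
  differentiation under the integral.\<close>

lemma (in moment_measure) Phi_has_field_derivative:
  assumes "x \<in> interior W"
  shows "(\<Phi> has_field_derivative (\<integral>t. of_real t / ((1 - of_real t * x) * (1 - of_real t * x)) \<partial>M)) (at x)"
    (is "(_ has_field_derivative ?D) _")
proof -
  have x: "x \<in> W" using assms interior_subset by blast
  define C where "C = (\<integral>t. 125/64 * (t\<^sup>2 / (1 - t) ^ 3) \<partial>M)"
  have int: "integrable M (\<lambda>t. 125/64 * (t\<^sup>2 / (1 - t) ^ 3))"
    by (intro integrable_mult_right integrable_pow_div) auto
  have bd: "norm ((\<Phi> y - \<Phi> x) / (y - x) - ?D) \<le> C * norm (y - x)" if y: "y \<in> W" "y \<noteq> x" for y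
  proof -
    let ?f = "\<lambda>t. of_real t ^ 2 / ((1 - of_real t * y) * (1 - of_real t * x) * (1 - of_real t * x))"
    have nf: "norm (?f t) \<le> 125/64 * (t\<^sup>2 / (1 - t) ^ 3)" if t: "0 < t" "t < 1" for t
    proof -
      have "norm (?f t) = t\<^sup>2 * (norm (1 / (1 - of_real t * y)) * norm (1 / (1 - of_real t * x)) * norm (1 / (1 - of_real t * x)))"
        using t by (simp add: norm_divide norm_mult norm_power)
      also have "\<dots> \<le> t\<^sup>2 * (5/4 * (1 / (1 - t)) * (5/4 * (1 / (1 - t))) * (5/4 * (1 / (1 - t))))"
        using x y t by (intro mult_left_mono mult_mono W_kernel_inverse_le mult_nonneg_nonneg) auto
      also have "\<dots> = 125/64 * (t\<^sup>2 * (1 / (1 - t)) ^ 3)" unfolding power3_eq_cube by algebra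
      finally show ?thesis by (simp only: power_one_over times_divide_eq_right mult_1_right)
    qed
    have "(\<Phi> y - \<Phi> x) / (y - x) - ?D
        = (\<integral>t. of_real t / ((1 - of_real t * y) * (1 - of_real t * x)) \<partial>M) - ?D"
      using Phi_diff[OF y(1) x] y by simp
    also have "\<dots> = (\<integral>t. of_real t / ((1 - of_real t * y) * (1 - of_real t * x))
                        - of_real t / ((1 - of_real t * x) * (1 - of_real t * x)) \<partial>M)"
      using x y by (intro Bochner_Integration.integral_diff[symmetric] integrable_kernel2)
    also have "\<dots> = (\<integral>t. (y - x) * ?f t \<partial>M)"
    proof (rule integral_cong_AE)
      show "AE t in M. of_real t / ((1 - of_real t * y) * (1 - of_real t * x))
                        - of_real t / ((1 - of_real t * x) * (1 - of_real t * x)) = (y - x) * ?f t"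
        using AE_01
      proof eventually_elim
        case (elim t)
        then have "1 - of_real t * x \<noteq> 0" "1 - of_real t * y \<noteq> 0"
          using x y W_kernel_nonzero by auto
        then show ?case by (simp add: divide_simps) (simp add: power2_eq_square algebra_simps)
      qed
    qed auto
    also have "\<dots> = (y - x) * (\<integral>t. ?f t \<partial>M)" by (rule integral_mult_right_zero)
    finally have eq: "(\<Phi> y - \<Phi> x) / (y - x) - ?D = (y - x) * (\<integral>t. ?f t \<partial>M)" .
    have "integrable M ?f"
    proof (rule Bochner_Integration.integrable_bound[OF int])
      show "AE t in M. norm (?f t) \<le> norm (125/64 * (t\<^sup>2 / (1 - t) ^ 3))"
        using AE_01
      proof eventually_elim
        case (elim t)
        show ?case unfolding real_norm_def
          by (rule order_trans[OF nf abs_ge_self]) (use elim in auto)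
      qed
    qed measurable
    then have "norm (\<integral>t. ?f t \<partial>M) \<le> C"
      unfolding C_def using int nf by (intro integral_norm_bound_AE) auto
    then show ?thesis unfolding eq norm_mult
      by (subst mult.commute) (rule mult_right_mono, simp_all)
  qed
  have "((\<lambda>y. (\<Phi> y - \<Phi> x) / (y - x) - ?D) \<longlongrightarrow> 0) (at x)"
  proof (rule Lim_null_comparison)
    show "eventually (\<lambda>y. norm ((\<Phi> y - \<Phi> x) / (y - x) - ?D) \<le> C * norm (y - x)) (at x)"
      using eventually_at_in_open[OF open_interior assms]
    proof eventually_elim
      case (elim y)
      then show ?case using bd[of y] interior_subset[of W] by blast
    qed
    show "((\<lambda>y. C * norm (y - x)) \<longlongrightarrow> 0) (at x)"
      by (auto intro!: tendsto_eq_intros)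
  qed
  then show ?thesis unfolding has_field_derivative_iff by (simp add: LIM_zero_iff)
qed

lemma (in moment_measure) Phi_holomorphic: "S \<subseteq> interior W \<Longrightarrow> \<Phi> holomorphic_on S"
  using Phi_has_field_derivative field_differentiable_at_within field_differentiable_def
  unfolding holomorphic_on_def by blast

text \<open>Nonnegative coefficients make the partial sums increase to \<open>g\<close>, so
  summation and integration commute even for series at the boundary point x = 1. This evaluates
  \<open>J1\<close>, \<open>J2\<close> and \<Phi>(1).\<close>

lemma (in moment_measure) sums_moments:
  fixes a :: "nat \<Rightarrow> real"
  assumes a: "\<And>n. 0 \<le> a n" and g: "integrable M g"
    and s: "\<And>t. 0 < t \<Longrightarrow> t < 1 \<Longrightarrow> (\<lambda>n. a n * t ^ n) sums g t"
  shows "(\<lambda>n. a n * (\<integral>t. t ^ n \<partial>M)) sums (\<integral>t. g t \<partial>M)"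
proof -
  have AEs: "AE t in M. (\<lambda>n. a n * t ^ n) sums g t" using AE_01 by (rule eventually_mono) (use s in auto)
  have pos: "AE t in M. 0 < t \<and> t < 1" by (rule AE_01)
  have int: "integrable M (\<lambda>t. a n * t ^ n)" for n by (intro integrable_mult_right integrable_pow)
  have nn: "0 \<le> (\<integral>t. t ^ n \<partial>M)" for n
    using pos by (intro integral_nonneg_AE) (auto elim!: eventually_mono)
  have absint: "(\<integral>t. norm (a n * t ^ n) \<partial>M) = a n * (\<integral>t. t ^ n \<partial>M)" for n
  proof -
    have "(\<integral>t. norm (a n * t ^ n) \<partial>M) = (\<integral>t. a n * t ^ n \<partial>M)"
      using pos a by (intro integral_cong_AE) (auto elim!: eventually_mono)
    then show ?thesis by (simp only: integral_mult_right_zero)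
  qed
  have summ: "summable (\<lambda>n. a n * (\<integral>t. t ^ n \<partial>M))"
  proof (rule summableI_nonneg_bounded)
    fix n show "0 \<le> a n * (\<integral>t. t ^ n \<partial>M)" using a nn by simp
    have "(\<Sum>i<n. a i * (\<integral>t. t ^ i \<partial>M)) = (\<Sum>i<n. (\<integral>t. a i * t ^ i \<partial>M))"
      by (simp only: integral_mult_right_zero)
    also have "\<dots> = (\<integral>t. (\<Sum>i<n. a i * t ^ i) \<partial>M)"
      by (subst Bochner_Integration.integral_sum) (use int in auto)
    also have "\<dots> \<le> (\<integral>t. g t \<partial>M)"
    proof (rule integral_mono_AE)
      show "AE t in M. (\<Sum>i<n. a i * t ^ i) \<le> g t"
        using pos AEs
      proof eventually_elim
        case (elim t)
        then show ?case using a sum_le_suminf[of "\<lambda>n. a n * t ^ n" "{..<n}"]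
          by (auto simp: sums_iff)
      qed
    qed (use int g in auto)
    finally show "(\<Sum>i<n. a i * (\<integral>t. t ^ i \<partial>M)) \<le> (\<integral>t. g t \<partial>M)" .
  qed
  have "(\<lambda>n. \<integral>t. a n * t ^ n \<partial>M) sums (\<integral>t. (\<Sum>n. a n * t ^ n) \<partial>M)"
  proof (rule sums_integral)
    show "AE t in M. summable (\<lambda>n. norm (a n * t ^ n))"
      using pos AEs by eventually_elim (use a in \<open>auto simp: sums_iff abs_mult\<close>)
  qed (use int absint summ in auto)
  moreover have "(\<integral>t. (\<Sum>n. a n * t ^ n) \<partial>M) = (\<integral>t. g t \<partial>M)"
    using AEs by (intro integral_cong_AE) (use g in \<open>auto simp: sums_iff\<close>)
  ultimately show ?thesis by (simp only: integral_mult_right_zero)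
qed

lemma (in moment_measure) sums_Phi:
  assumes "norm x < 1"
  shows "(\<lambda>n. of_real (\<integral>t. t ^ n \<partial>M) * x ^ n) sums \<Phi> x"
proof -
  have int: "integrable M (\<lambda>t. of_real (t ^ n) * x ^ n)" for n
    by (intro integrable_mult_left integrable_of_real integrable_pow)
  have bd: "(\<integral>t. norm (of_real (t ^ n) * x ^ n) \<partial>M) \<le> (\<integral>t. 1 \<partial>M) * norm x ^ n" for n
  proof -
    have "(\<integral>t. norm (of_real (t ^ n) * x ^ n) \<partial>M) \<le> (\<integral>t. 1 * norm x ^ n \<partial>M)"
    proof (rule integral_mono_AE)
      show "AE t in M. norm (of_real (t ^ n) * x ^ n) \<le> 1 * norm x ^ n"
        using AE_01 by eventually_elim
          (auto simp: norm_mult norm_power power_le_one intro!: mult_right_mono mult_left_le_one_le)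
      show "integrable M (\<lambda>t. 1 * norm x ^ n)"
        using integrable_pow[of 0] by (intro integrable_mult_left) simp
    qed (use int in auto)
    then show ?thesis by simp
  qed
  have "(\<lambda>n. \<integral>t. of_real (t ^ n) * x ^ n \<partial>M) sums (\<integral>t. (\<Sum>n. of_real (t ^ n) * x ^ n) \<partial>M)"
  proof (rule sums_integral)
    show "AE t in M. summable (\<lambda>n. norm (complex_of_real (t ^ n) * x ^ n))"
      using AE_01
    proof eventually_elim
      case (elim t)
      show ?case
      proof (rule summable_comparison_test)
        show "\<exists>N. \<forall>n\<ge>N. norm (norm (complex_of_real (t ^ n) * x ^ n)) \<le> norm x ^ n"
          using elim by (auto simp: norm_mult norm_power power_le_one intro!: mult_left_le_one_le)
        show "summable (\<lambda>n. norm x ^ n)" using assms by (intro summable_geometric) simp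
      qed
    qed
    show "summable (\<lambda>n. \<integral>t. norm (complex_of_real (t ^ n) * x ^ n) \<partial>M)"
    proof (rule summable_comparison_test)
      show "\<exists>N. \<forall>n\<ge>N. norm (\<integral>t. norm (complex_of_real (t ^ n) * x ^ n) \<partial>M) \<le> (\<integral>t. 1 \<partial>M) * norm x ^ n"
        using bd by (auto simp: integral_nonneg_AE abs_of_nonneg)
      show "summable (\<lambda>n. (\<integral>t. 1 \<partial>M) * norm x ^ n)"
        using assms by (intro summable_mult summable_geometric) simp
    qed
  qed (use int in auto)
  moreover have "(\<integral>t. (\<Sum>n. of_real (t ^ n) * x ^ n) \<partial>M) = \<Phi> x"
    unfolding \<Phi>_def
  proof (rule integral_cong_AE)
    show "AE t in M. (\<Sum>n. of_real (t ^ n) * x ^ n) = 1 / (1 - of_real t * x)"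
      using AE_01
    proof eventually_elim
      case (elim t)
      then have "norm (of_real t * x) < 1" using assms
        by (simp add: norm_mult) (smt (verit) mult_left_le_one_le norm_ge_zero)
      then show ?case using suminf_geometric[of "of_real t * x"] by (simp add: power_mult_distrib)
    qed
  qed measurable
  moreover have "(\<integral>t. of_real (t ^ n) * x ^ n \<partial>M) = of_real (\<integral>t. t ^ n \<partial>M) * x ^ n" for n
  proof -
    have "(\<integral>t. of_real (t ^ n) * x ^ n \<partial>M) = (\<integral>t. of_real (t ^ n) \<partial>M) * x ^ n"
      by (rule integral_mult_left_zero)
    also have "(\<integral>t. of_real (t ^ n) \<partial>M) = complex_of_real (\<integral>t. t ^ n \<partial>M)"
      by (rule integral_of_real) (rule integrable_pow)
    finally show ?thesis .
  qed
  ultimately show ?thesis by (simp only:)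
qed

text \<open>With u = 1 - t and v = t (x - 1) the kernel is 1 / (u - v), and the finite geometric
  expansion in v / u, stopped after four terms, is integrated. No differentiability at the boundary
  point 1 enters.\<close>

lemma (in moment_measure) Phi_taylor:
  assumes x: "x \<in> W" "x \<noteq> 1"
  shows "\<Phi> x = (\<Sum>k<4. of_real (\<integral>t. t ^ k / (1 - t) ^ Suc k \<partial>M) * (x - 1) ^ k)
     + (x - 1) ^ 4 * (\<integral>t. of_real (t ^ 4 / (1 - t) ^ 4) / (1 - of_real t * x) \<partial>M)"
    and "integrable M (\<lambda>t. of_real (t ^ 4 / (1 - t) ^ 4) / (1 - of_real t * x))"
proof -
  define r where "r = norm (x - 1)"
  have r: "0 < r" using x by (simp add: r_def)
  \<comment> \<open>The remainder already contains (1 - t)^-4, so here the kernel is bounded by a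
    constant that depends on r but not on t. The two cone estimates are added with weights r and
    1.\<close>
  have low: "norm (1 / (1 - of_real t * x)) \<le> 5/4 * ((1 + r) / r)" if t: "0 < t" "t < 1" for t
  proof -
    have 1: "norm (1 - of_real t * x) \<ge> 4/5 * (1 - t)" and 2: "norm (1 - of_real t * x) \<ge> 4/5 * (t * r)"
      using W_kernel[OF x(1), of t] t by (auto simp: r_def)
    have "4/5 * r = r * (4/5 * (1 - t)) + 4/5 * (t * r)" by algebra
    also have "\<dots> \<le> r * norm (1 - of_real t * x) + norm (1 - of_real t * x)"
      using 1 2 r by (intro add_mono mult_left_mono) auto
    finally have "4/5 * r \<le> (1 + r) * norm (1 - of_real t * x)" by (simp add: algebra_simps)
    then show ?thesis
      using r W_kernel_nonzero[OF x(1) t] by (simp add: norm_divide field_simps)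
  qed
  show int: "integrable M (\<lambda>t. of_real (t ^ 4 / (1 - t) ^ 4) / (1 - of_real t * x))"
  proof (rule integrable_bounded[where C = "5/4 * ((1 + r) / r)" and k = 4])
    fix t :: real assume t: "0 < t" "t < 1"
    have "norm (of_real (t ^ 4 / (1 - t) ^ 4) / (1 - of_real t * x))
      = t ^ 4 / (1 - t) ^ 4 * norm (1 / (1 - of_real t * x))"
      using t by (simp only: norm_divide norm_of_real) simp
    also have "\<dots> \<le> 1 / (1 - t) ^ 4 * (5/4 * ((1 + r) / r))"
      using t low by (intro mult_mono divide_right_mono) (auto simp: power_le_one)
    also have "\<dots> = 5/4 * ((1 + r) / r) / (1 - t) ^ 4" by (simp only: times_divide_eq_left mult_1_left)
    finally show "norm (of_real (t ^ 4 / (1 - t) ^ 4) / (1 - of_real t * x)) \<le> 5/4 * ((1 + r) / r) / (1 - t) ^ 4" .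
  qed (use r in auto)
  let ?I = "\<lambda>k t. complex_of_real (t ^ k / (1 - t) ^ Suc k)"
  have intk: "integrable M (?I k)" if "k < 4" for k
    using integrable_pow_div[of "Suc k" k] that by (intro integrable_of_real) auto
  have "\<Phi> x = (\<integral>t. (\<Sum>k<4. ?I k t * (x - 1) ^ k)
       + (x - 1) ^ 4 * (of_real (t ^ 4 / (1 - t) ^ 4) / (1 - of_real t * x)) \<partial>M)"
    unfolding \<Phi>_def
  proof (rule integral_cong_AE)
    show "AE t in M. 1 / (1 - of_real t * x) = (\<Sum>k<4. ?I k t * (x - 1) ^ k)
       + (x - 1) ^ 4 * (of_real (t ^ 4 / (1 - t) ^ 4) / (1 - of_real t * x))"
      using AE_01
    proof eventually_elim
      case (elim t)
      define T where "T = complex_of_real t"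
      have nz: "1 - T * x \<noteq> 0" "1 - T \<noteq> 0"
        using elim W_kernel_nonzero[OF x(1)] by (auto simp: T_def)
      have "(\<Sum>k<4. ?I k t * (x - 1) ^ k) + (x - 1) ^ 4 * (of_real (t ^ 4 / (1 - t) ^ 4) / (1 - of_real t * x))
         = (1 / (1 - T) + T / (1 - T)^2 * (x - 1) + T^2 / (1 - T)^3 * (x - 1)^2 + T^3 / (1 - T)^4 * (x - 1)^3)
           + (x - 1) ^ 4 * (T ^ 4 / (1 - T) ^ 4 / (1 - T * x))"
        by (simp add: eval_nat_numeral T_def)
      also have "\<dots> = 1 / (1 - T * x)"
      proof -
        define u where "u = 1 - T"
        define v where "v = T * (x - 1)"
        have uv: "u - v \<noteq> 0" "u \<noteq> 0" using nz by (auto simp: u_def v_def algebra_simps)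
        have e: "1 - T * x = u - v" by (simp add: u_def v_def algebra_simps)
        have "1 / u + v / u^2 + v^2 / u^3 + v^3 / u^4 + v^4 / u^4 / (u - v) = 1 / (u - v)"
          using uv by (simp add: divide_simps) (simp add: eval_nat_numeral algebra_simps)
        then show ?thesis unfolding e by (simp add: u_def v_def power_mult_distrib mult_ac)
      qed
      finally show ?case by (simp add: T_def)
    qed
  qed measurable
  also have "\<dots> = (\<integral>t. (\<Sum>k<4. ?I k t * (x - 1) ^ k) \<partial>M)
       + (\<integral>t. (x - 1) ^ 4 * (of_real (t ^ 4 / (1 - t) ^ 4) / (1 - of_real t * x)) \<partial>M)"
    using intk int by (intro Bochner_Integration.integral_add Bochner_Integration.integrable_sum integrable_mult_right integrable_mult_left) auto
  also have "(\<integral>t. (\<Sum>k<4. ?I k t * (x - 1) ^ k) \<partial>M) = (\<Sum>k<4. (\<integral>t. ?I k t * (x - 1) ^ k \<partial>M))"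
    using intk by (intro Bochner_Integration.integral_sum integrable_mult_left) auto
  also have "\<dots> = (\<Sum>k<4. of_real (\<integral>t. t ^ k / (1 - t) ^ Suc k \<partial>M) * (x - 1) ^ k)"
    by (intro sum.cong refl, subst integral_mult_left_zero, subst integral_of_real)
       (use integrable_pow_div in \<open>auto simp del: power_Suc\<close>)
  also have "(\<integral>t. (x - 1) ^ 4 * (of_real (t ^ 4 / (1 - t) ^ 4) / (1 - of_real t * x)) \<partial>M)
     = (x - 1) ^ 4 * (\<integral>t. of_real (t ^ 4 / (1 - t) ^ 4) / (1 - of_real t * x) \<partial>M)"
    by (rule integral_mult_right_zero)
  finally show "\<Phi> x = (\<Sum>k<4. of_real (\<integral>t. t ^ k / (1 - t) ^ Suc k \<partial>M) * (x - 1) ^ k)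
     + (x - 1) ^ 4 * (\<integral>t. of_real (t ^ 4 / (1 - t) ^ 4) / (1 - of_real t * x) \<partial>M)" .
qed

section \<open>The product of two Beta variables\<close>

lemma nn_integral_Beta_scaled:
  fixes a b p :: real
  assumes "0 < a" "0 < b" "0 < p"
  shows "(\<integral>\<^sup>+u. ennreal (if 0 < u \<and> u < p then u powr (a - 1) * (p - u) powr (b - 1) else 0) \<partial>lborel)
     = ennreal (p powr (a + b - 1) * Beta a b)" (is "?L = _")
proof -
  have pos: "0 \<le> Beta a b"
    by (rule has_integral_nonneg[OF has_integral_Beta_real]) (use assms in auto)
  have "((\<lambda>t. t powr (a - 1) * (1 - t) powr (b - 1)) has_integral Beta a b) {0<..<1}"
    using has_integral_Beta_real[of a b] assms by (simp add: has_integral_Icc_iff_Ioo)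
  then have B: "(\<integral>\<^sup>+s. ennreal (indicator {0<..<1} s * (s powr (a - 1) * (1 - s) powr (b - 1))) \<partial>lborel)
     = ennreal (Beta a b)"
    by (rule nn_integral_has_integral_lebesgue[rotated]) auto
  have "?L = ennreal \<bar>p\<bar> * (\<integral>\<^sup>+s. ennreal (if 0 < 0 + p * s \<and> 0 + p * s < p then (0 + p * s) powr (a - 1) * (p - (0 + p * s)) powr (b - 1) else 0) \<partial>lborel)"
    by (rule nn_integral_real_affine) (use assms in auto)
  also have "(\<integral>\<^sup>+s. ennreal (if 0 < 0 + p * s \<and> 0 + p * s < p then (0 + p * s) powr (a - 1) * (p - (0 + p * s)) powr (b - 1) else 0) \<partial>lborel)
     = (\<integral>\<^sup>+s. ennreal (p powr (a + b - 2)) * ennreal (indicator {0<..<1} s * (s powr (a - 1) * (1 - s) powr (b - 1))) \<partial>lborel)"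
  proof (rule nn_integral_cong)
    fix s :: real
    have eq: "(p * s) powr (a - 1) * (p - p * s) powr (b - 1) = p powr (a + b - 2) * (s powr (a - 1) * (1 - s) powr (b - 1))"
      if "0 < s" "s < 1"
    proof -
      have "p - p * s = p * (1 - s)" by (simp add: algebra_simps)
      then have "(p * s) powr (a - 1) * (p - p * s) powr (b - 1) = (p powr (a - 1) * p powr (b - 1)) * (s powr (a - 1) * (1 - s) powr (b - 1))"
        using assms that by (simp add: powr_mult)
      also have "p powr (a - 1) * p powr (b - 1) = p powr (a + b - 2)"
        by (simp add: powr_add[symmetric])
      finally show ?thesis .
    qed
    show "ennreal (if 0 < 0 + p * s \<and> 0 + p * s < p then (0 + p * s) powr (a - 1) * (p - (0 + p * s)) powr (b - 1) else 0)
      = ennreal (p powr (a + b - 2)) * ennreal (indicator {0<..<1} s * (s powr (a - 1) * (1 - s) powr (b - 1)))"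
      using assms eq by (auto simp: indicator_def ennreal_mult'[symmetric] zero_less_mult_iff mult_less_cancel_left1)
  qed
  also have "\<dots> = ennreal (p powr (a + b - 2)) * ennreal (Beta a b)"
    by (subst nn_integral_cmult) (use B in auto)
  also have "ennreal \<bar>p\<bar> * \<dots> = ennreal (p * (p powr (a + b - 2) * Beta a b))"
    using assms pos by (simp add: ennreal_mult)
  also have "p * (p powr (a + b - 2) * Beta a b) = p powr (a + b - 1) * Beta a b"
  proof -
    have "p powr (a + b - 1) = p powr 1 * p powr (a + b - 2)" by (simp only: powr_add[symmetric]) simp
    then show ?thesis using assms by simp
  qed
  finally show ?thesis .
qed

lemma Gamma_real_halves:
  "Gamma (3/2 :: real) = sqrt pi / 2" "Gamma (5/2 :: real) = 3/4 * sqrt pi"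
proof -
  show 1: "Gamma (3/2 :: real) = sqrt pi / 2"
    using Gamma_plus1[of "1/2 :: real"] nonpos_Ints_nonpos[of "1/2 :: real"]
    by (fastforce simp: Gamma_one_half_real)
  show "Gamma (5/2 :: real) = 3/4 * sqrt pi"
    using Gamma_plus1[of "3/2 :: real"] nonpos_Ints_nonpos[of "3/2 :: real"] by (fastforce simp: 1)
qed

lemma Beta_real_halves:
  "Beta (1/2) (5/2 :: real) = 3 * pi / 8" "Beta (3/2) (5/2 :: real) = pi / 16" "Beta (5/2) (5/2 :: real) = 3 * pi / 128"
proof -
  have "Gamma (3 :: real) = 2" "Gamma (4 :: real) = 6" "Gamma (5 :: real) = 24"
    using Gamma_fact[of 2, where 'a = real] Gamma_fact[of 3, where 'a = real] Gamma_fact[of 4, where 'a = real]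
    by (simp_all add: fact_numeral)
  then show "Beta (1/2) (5/2 :: real) = 3 * pi / 8" "Beta (3/2) (5/2 :: real) = pi / 16" "Beta (5/2) (5/2 :: real) = 3 * pi / 128"
    by (simp_all add: Beta_def Gamma_real_halves Gamma_one_half_real field_simps)
qed

text \<open>Divided by \<open>Beta a b\<close>, this is the n-th moment of the Beta law with
  parameters a and b, a quotient of Pochhammer symbols.\<close>

lemma Beta_add_nat:
  fixes a b :: real assumes "0 < a" "0 < b"
  shows "Beta (a + of_nat n) b = Beta a b * pochhammer a n / pochhammer (a + b) n"
proof -
  have "a \<notin> \<int>\<^sub>\<le>\<^sub>0" "a + b \<notin> \<int>\<^sub>\<le>\<^sub>0" using assms by (auto elim!: nonpos_Ints_cases)
  moreover have "Gamma a \<noteq> 0" "Gamma (a + b) \<noteq> 0" using assms by (metis Gamma_real_pos add_pos_pos less_irrefl)+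
  ultimately have "Gamma (a + of_nat n) = pochhammer a n * Gamma a"
    "Gamma (a + of_nat n + b) = pochhammer (a + b) n * Gamma (a + b)"
    using assms by (simp_all add: pochhammer_Gamma add_ac)
  then show ?thesis by (simp add: Beta_def mult_ac)
qed

text \<open>In terms of Catalan numbers, \<open>16 ^ n * cseq n\<close> is C_n C_(n+2) - C_(n+1)^2,
  the number of 3-noncrossing matchings with n arcs.\<close>

definition cseq :: "nat \<Rightarrow> real" where
  "cseq n = pochhammer (1/2) n * pochhammer (3/2) n / (pochhammer 3 n * pochhammer 4 n)"

text \<open>
  The joint density of \<open>(XY, X)\<close> for independent Beta variables \<open>X\<close> and \<open>Y\<close> with parameters
  \<open>(1/2, 5/2)\<close> and \<open>(3/2, 5/2)\<close>; the moments of the product \<open>XY\<close> are \<^term>\<open>cseq\<close>.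
\<close>
definition joint :: "real \<Rightarrow> real \<Rightarrow> real" where
  "joint t p = (if 0 < t \<and> t < p \<and> p < 1
     then 128 / (3 * pi\<^sup>2) * t powr (1/2) * p powr (- 7/2) * (1 - p) powr (3/2) * (p - t) powr (3/2) else 0)"

text \<open>The marginal density of the product. It is never evaluated: its moments and its
  two-sided bounds at 1 carry all the information. Finiteness of the integral, without which
  \<open>enn2real\<close> would return 0, follows from the upper bound.\<close>

definition dens :: "real \<Rightarrow> real" where
  "dens t = (if 0 < t \<and> t < 1 then enn2real (\<integral>\<^sup>+p. ennreal (joint t p) \<partial>lborel) else 0)"

definition \<mu> :: "real measure" where
  "\<mu> = density lborel (\<lambda>t. ennreal (dens t))"

lemma joint_measurable [measurable]: "(\<lambda>(t, p). joint t p) \<in> borel_measurable (lborel \<Otimes>\<^sub>M lborel)"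
  unfolding joint_def by measurable

text \<open>Substituting p = t + (1 - t) s extracts (1 - t)^4: one factor from the Jacobian, three
  from the two powers 3/2. What is left is the Beta integral B(5/2, 5/2) = 3 pi / 128 weighted with
  p^(-7/2), which lies between 1 and t^(-7/2). The constant becomes 128 / (3 pi^2) * 3 pi / 128 = 1
  / pi.\<close>

lemma nn_integral_joint_bounds:
  assumes t: "0 < t" "t < 1"
  shows "(\<integral>\<^sup>+p. ennreal (joint t p) \<partial>lborel) \<le> ennreal (1 / pi * (1 - t) ^ 4 / t ^ 4)"
    and "ennreal (1 / pi * (1 - 5 * (1 - t)) * (1 - t) ^ 4 / t ^ 4) \<le> (\<integral>\<^sup>+p. ennreal (joint t p) \<partial>lborel)"
proof -
  define w :: "real \<Rightarrow> real" where "w s = (if 0 < s \<and> s < 1 then s powr (3/2) * (1 - s) powr (3/2) else 0)" for s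
  have w0: "0 \<le> w s" for s by (simp add: w_def)
  have [measurable]: "w \<in> borel_measurable borel" unfolding w_def by measurable
  have w: "(\<integral>\<^sup>+s. ennreal (w s) \<partial>lborel) = ennreal (3 * pi / 128)"
    using nn_integral_Beta_scaled[of "5/2" "5/2" 1] by (simp add: w_def Beta_real_halves cong: if_cong)
  have eq: "joint t (t + (1 - t) * s) = 128 / (3 * pi\<^sup>2) * t powr (1/2) * (1 - t) ^ 3 * ((t + (1 - t) * s) powr (- 7/2) * w s)" for s
  proof (cases "0 < s \<and> s < 1")
    case True
    have "t + (1 - t) * s < t + (1 - t) * 1" using True t by (intro add_strict_left_mono mult_strict_left_mono) auto
    then have r: "t < t + (1 - t) * s" "t + (1 - t) * s < 1" using True t by auto
    have e: "1 - (t + (1 - t) * s) = (1 - t) * (1 - s)" "t + (1 - t) * s - t = (1 - t) * s" by algebra+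
    have "(1 - t) powr (3/2) * (1 - t) powr (3/2) = (1 - t) powr (real 3)" by (simp add: powr_add[symmetric])
    also have "\<dots> = (1 - t) ^ 3" using t by (subst powr_realpow) auto
    finally have p3: "(1 - t) powr (3/2) * (1 - t) powr (3/2) = (1 - t) ^ 3" .
    have "joint t (t + (1 - t) * s) = 128 / (3 * pi\<^sup>2) * t powr (1/2) * (t + (1 - t) * s) powr (- 7/2)
        * ((1 - t) powr (3/2) * (1 - s) powr (3/2)) * ((1 - t) powr (3/2) * s powr (3/2))"
      using r t True by (simp add: joint_def e powr_mult)
    also have "\<dots> = 128 / (3 * pi\<^sup>2) * t powr (1/2) * ((1 - t) powr (3/2) * (1 - t) powr (3/2)) * ((t + (1 - t) * s) powr (- 7/2) * (s powr (3/2) * (1 - s) powr (3/2)))"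
      by algebra
    finally show ?thesis using True by (simp only: p3 w_def if_True simp_thms)
  next
    case False
    have "\<not> (t < t + (1 - t) * s \<and> t + (1 - t) * s < 1)"
    proof
      assume *: "t < t + (1 - t) * s \<and> t + (1 - t) * s < 1"
      have "0 < (1 - t) * s" "(1 - t) * (1 - s) > 0" using * by (simp_all add: algebra_simps)
      then show False using t False by (simp add: zero_less_mult_iff)
    qed
    then show ?thesis using False by (auto simp: joint_def w_def)
  qed
  define c where "c = 128 / (3 * pi\<^sup>2) * t powr (1/2) * (1 - t) ^ 3"
  have c0: "0 \<le> c" using t by (simp add: c_def)
  have t0: "0 \<le> 1 - t" using t by simp
  define I where "I = (\<integral>\<^sup>+s. ennreal ((t + (1 - t) * s) powr (- 7/2) * w s) \<partial>lborel)"
  have J: "(\<integral>\<^sup>+p. ennreal (joint t p) \<partial>lborel) = ennreal (1 - t) * (ennreal c * I)"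
  proof -
    have [measurable]: "joint t \<in> borel_measurable borel" unfolding joint_def by measurable
    have "(\<integral>\<^sup>+p. ennreal (joint t p) \<partial>lborel) = ennreal \<bar>1 - t\<bar> * (\<integral>\<^sup>+s. ennreal (joint t (t + (1 - t) * s)) \<partial>lborel)"
      by (rule nn_integral_real_affine) (use t in auto)
    also have "(\<integral>\<^sup>+s. ennreal (joint t (t + (1 - t) * s)) \<partial>lborel) = (\<integral>\<^sup>+s. ennreal c * ennreal ((t + (1 - t) * s) powr (- 7/2) * w s) \<partial>lborel)"
      by (intro nn_integral_cong, subst eq) (simp only: c_def[symmetric] ennreal_mult'[OF c0])
    also have "\<dots> = ennreal c * I" unfolding I_def by (rule nn_integral_cmult) measurable
    finally show ?thesis using t by simp
  qed
  have "I \<le> (\<integral>\<^sup>+s. ennreal (t powr (- 7/2)) * ennreal (w s) \<partial>lborel)"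
    unfolding I_def
  proof (rule nn_integral_mono)
    fix s show "ennreal ((t + (1 - t) * s) powr (- 7/2) * w s) \<le> ennreal (t powr (- 7/2)) * ennreal (w s)"
    proof (cases "0 < s \<and> s < 1")
      case True
      then have "(t + (1 - t) * s) powr (- 7/2) \<le> t powr (- 7/2)" using t by (intro powr_mono2') auto
      then show ?thesis using w0 by (auto simp: ennreal_mult'[symmetric] intro!: ennreal_leI mult_right_mono)
    qed (auto simp: w_def)
  qed
  also have "\<dots> = ennreal (t powr (- 7/2) * (3 * pi / 128))"
    by (subst nn_integral_cmult, simp, subst w, rule ennreal_mult'[symmetric], simp)
  finally have Iu: "I \<le> ennreal (t powr (- 7/2) * (3 * pi / 128))" .
  have "ennreal (3 * pi / 128) \<le> I"
    unfolding I_def w[symmetric]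
  proof (rule nn_integral_mono)
    fix s show "ennreal (w s) \<le> ennreal ((t + (1 - t) * s) powr (- 7/2) * w s)"
    proof (cases "0 < s \<and> s < 1")
      case True
      have "t + (1 - t) * s \<le> t + (1 - t) * 1" using True t by (intro add_left_mono mult_left_mono) auto
      then have "1 powr (- 7/2) \<le> (t + (1 - t) * s) powr (- 7/2)" using t True by (intro powr_mono2') (auto intro: add_pos_nonneg)
      then have "1 * w s \<le> (t + (1 - t) * s) powr (- 7/2) * w s" using w0 by (intro mult_right_mono) auto
      then show ?thesis by (intro ennreal_leI) simp
    qed (auto simp: w_def)
  qed
  then have Il: "ennreal (3 * pi / 128) \<le> I" .
  have "(\<integral>\<^sup>+p. ennreal (joint t p) \<partial>lborel) \<le> ennreal (1 - t) * (ennreal c * ennreal (t powr (- 7/2) * (3 * pi / 128)))"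
    unfolding J by (intro mult_left_mono Iu) auto
  also have "\<dots> = ennreal ((1 - t) * (c * (t powr (- 7/2) * (3 * pi / 128))))"
    by (simp only: ennreal_mult'[OF t0] ennreal_mult'[OF c0])
  also have "(1 - t) * (c * (t powr (- 7/2) * (3 * pi / 128))) = 1 / pi * (1 - t) ^ 4 * (t powr (1/2) * t powr (-7/2))"
    by (simp add: c_def power2_eq_square eval_nat_numeral field_simps)
  also have "t powr (1/2) * t powr (-7/2) = t powr (- real 3)" by (simp add: powr_add[symmetric])
  also have "\<dots> = 1 / t ^ 3" using t by (subst powr_minus, subst powr_realpow) (auto simp: divide_inverse)
  \<comment> \<open>Weakened to t^-4 so that it cancels against the factor t^4 in the Taylor
    remainder.\<close>
  also have "1 / pi * (1 - t) ^ 4 * (1 / t ^ 3) \<le> 1 / pi * (1 - t) ^ 4 * (1 / t ^ 4)"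
    using t by (intro mult_left_mono divide_left_mono power_decreasing) auto
  finally show "(\<integral>\<^sup>+p. ennreal (joint t p) \<partial>lborel) \<le> ennreal (1 / pi * (1 - t) ^ 4 / t ^ 4)"
    by (simp add: ennreal_leI)
  \<comment> \<open>Bernoulli's inequality makes the lower bound explicit: after multiplication by
    t^4 / (1 - t)^4 it deviates from 1/pi by at most 5/pi * (1 - t).\<close>
  have "1 - 5 * (1 - t) \<le> t ^ 5" using Bernoulli_inequality[of "- (1 - t)" 5] t by simp
  then have "(1 - 5 * (1 - t)) / t ^ 4 \<le> t ^ 5 / t ^ 4" using t by (intro divide_right_mono) auto
  also have "\<dots> = t powr 1" using t by (simp add: eval_nat_numeral)
  also have "\<dots> \<le> t powr (1/2)" using t by (intro powr_mono') auto
  finally have "1 / pi * (1 - t) ^ 4 * ((1 - 5 * (1 - t)) / t ^ 4) \<le> 1 / pi * (1 - t) ^ 4 * t powr (1/2)"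
    using t by (intro mult_left_mono) auto
  also have "\<dots> = (1 - t) * (c * (3 * pi / 128))" by (simp add: c_def power2_eq_square eval_nat_numeral field_simps)
  finally have "ennreal (1 / pi * (1 - 5 * (1 - t)) * (1 - t) ^ 4 / t ^ 4) \<le> ennreal ((1 - t) * (c * (3 * pi / 128)))"
    by (intro ennreal_leI) (simp add: mult_ac)
  also have "\<dots> = ennreal (1 - t) * (ennreal c * ennreal (3 * pi / 128))"
    by (simp only: ennreal_mult'[OF t0] ennreal_mult'[OF c0])
  also have "\<dots> \<le> (\<integral>\<^sup>+p. ennreal (joint t p) \<partial>lborel)"
    unfolding J by (intro mult_left_mono Il) auto
  finally show "ennreal (1 / pi * (1 - 5 * (1 - t)) * (1 - t) ^ 4 / t ^ 4) \<le> (\<integral>\<^sup>+p. ennreal (joint t p) \<partial>lborel)" .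
qed

lemma ennreal_dens:
  "ennreal (dens t) = (\<integral>\<^sup>+p. ennreal (joint t p) \<partial>lborel)"
proof (cases "0 < t \<and> t < 1")
  case True
  then show ?thesis using nn_integral_joint_bounds(1)[of t]
    by (auto simp: dens_def intro!: ennreal_enn2real dest: le_less_trans[OF _ ennreal_less_top])
next
  case False
  then have "joint t p = 0" for p by (auto simp: joint_def)
  then show ?thesis using False by (simp add: dens_def)
qed

lemma dens_nonneg: "0 \<le> dens t" by (simp add: dens_def)

lemma dens_measurable [measurable]: "dens \<in> borel_measurable borel"
  unfolding dens_def joint_def by measurable

lemma dens_bounds:
  assumes t: "0 < t" "t < 1"
  shows "dens t \<le> 1 / pi * (1 - t) ^ 4 / t ^ 4"
    and "1 / pi * (1 - 5 * (1 - t)) * (1 - t) ^ 4 / t ^ 4 \<le> dens t"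
  using nn_integral_joint_bounds[OF t] t unfolding ennreal_dens[symmetric]
  by (simp_all add: ennreal_le_iff dens_nonneg)

text \<open>By Tonelli the t-integral comes first. It gives \<open>Beta (3/2 + n) (5/2)\<close>
  times p^(n + 3), which together with p^(-7/2) leaves the Beta integrand with parameters 1/2 + n
  and 5/2.\<close>

lemma nn_integral_moments: "(\<integral>\<^sup>+t. ennreal (t ^ n * dens t) \<partial>lborel) = ennreal (cseq n)"
proof -
  have "(\<integral>\<^sup>+t. ennreal (t ^ n * dens t) \<partial>lborel) = (\<integral>\<^sup>+t. (\<integral>\<^sup>+p. ennreal (t ^ n * joint t p) \<partial>lborel) \<partial>lborel)"
  proof (rule nn_integral_cong)
    fix t :: real
    show "ennreal (t ^ n * dens t) = (\<integral>\<^sup>+p. ennreal (t ^ n * joint t p) \<partial>lborel)"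
    proof (cases "0 < t")
      case True
      have [measurable]: "joint t \<in> borel_measurable borel" unfolding joint_def by measurable
      have "ennreal (t ^ n * dens t) = ennreal (t ^ n) * (\<integral>\<^sup>+p. ennreal (joint t p) \<partial>lborel)"
        using True by (simp add: ennreal_mult' ennreal_dens)
      also have "\<dots> = (\<integral>\<^sup>+p. ennreal (t ^ n) * ennreal (joint t p) \<partial>lborel)"
        by (rule nn_integral_cmult[symmetric]) measurable
      finally show ?thesis using True by (simp add: ennreal_mult')
    qed (simp add: dens_def joint_def)
  qed
  also have "\<dots> = (\<integral>\<^sup>+p. (\<integral>\<^sup>+t. ennreal (t ^ n * joint t p) \<partial>lborel) \<partial>lborel)"
    by (rule lborel_pair.Fubini'[symmetric]) (unfold joint_def, measurable)
  also have "\<dots> = (\<integral>\<^sup>+p. ennreal (128 / (3 * pi\<^sup>2) * Beta (3/2 + real n) (5/2)) *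
      ennreal (if 0 < p \<and> p < 1 then p powr (1/2 + real n - 1) * (1 - p) powr (5/2 - 1) else 0) \<partial>lborel)"
  proof (rule nn_integral_cong)
    fix p :: real
    have Bp: "0 \<le> Beta (3/2 + real n) (5/2 :: real)"
      by (rule has_integral_nonneg[OF has_integral_Beta_real]) auto
    show "(\<integral>\<^sup>+t. ennreal (t ^ n * joint t p) \<partial>lborel) = ennreal (128 / (3 * pi\<^sup>2) * Beta (3/2 + real n) (5/2)) *
      ennreal (if 0 < p \<and> p < 1 then p powr (1/2 + real n - 1) * (1 - p) powr (5/2 - 1) else 0)"
    proof (cases "0 < p \<and> p < 1")
      case True
      define c where "c = 128 / (3 * pi\<^sup>2) * p powr (- 7/2) * (1 - p) powr (3/2)"
      have c: "0 \<le> c" by (simp add: c_def)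
      have "(\<integral>\<^sup>+t. ennreal (t ^ n * joint t p) \<partial>lborel) = (\<integral>\<^sup>+t. ennreal c *
          ennreal (if 0 < t \<and> t < p then t powr (3/2 + real n - 1) * (p - t) powr (5/2 - 1) else 0) \<partial>lborel)"
      proof (rule nn_integral_cong)
        fix t :: real
        have "t ^ n * t powr (1/2) = t powr (3/2 + real n - 1)" if "0 < t"
        proof -
          have "t ^ n * t powr (1/2) = t powr (real n) * t powr (1/2)" using that by (simp add: powr_realpow)
          also have "\<dots> = t powr (3/2 + real n - 1)" by (simp add: powr_add[symmetric] add_ac)
          finally show ?thesis .
        qed
        then have "t ^ n * joint t p = c * (if 0 < t \<and> t < p then t powr (3/2 + real n - 1) * (p - t) powr (5/2 - 1) else 0)"
          using True by (auto simp: joint_def c_def)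
        then show "ennreal (t ^ n * joint t p) = ennreal c * ennreal (if 0 < t \<and> t < p then t powr (3/2 + real n - 1) * (p - t) powr (5/2 - 1) else 0)"
          using c by (simp only: ennreal_mult')
      qed
      also have "\<dots> = ennreal c * (\<integral>\<^sup>+t. ennreal (if 0 < t \<and> t < p then t powr (3/2 + real n - 1) * (p - t) powr (5/2 - 1) else 0) \<partial>lborel)"
        by (rule nn_integral_cmult) measurable
      also have "\<dots> = ennreal c * ennreal (p powr (3/2 + real n + 5/2 - 1) * Beta (3/2 + real n) (5/2))"
        using True by (subst nn_integral_Beta_scaled) auto
      also have "\<dots> = ennreal (c * (p powr (3/2 + real n + 5/2 - 1) * Beta (3/2 + real n) (5/2)))"
        using c by (simp only: ennreal_mult')
      also have "c * (p powr (3/2 + real n + 5/2 - 1) * Beta (3/2 + real n) (5/2)) =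
         (128 / (3 * pi\<^sup>2) * Beta (3/2 + real n) (5/2)) * ((p powr (- 7/2) * p powr (3/2 + real n + 5/2 - 1)) * (1 - p) powr (5/2 - 1))"
        by (simp add: c_def)
      also have "p powr (- 7/2) * p powr (3/2 + real n + 5/2 - 1) = p powr (1/2 + real n - 1)"
        by (simp add: powr_add[symmetric])
      finally show ?thesis using True Bp by (simp only: ennreal_mult' simp_thms if_True)
          (subst ennreal_mult', auto)
    next
      case False
      then have "joint t p = 0" for t by (auto simp: joint_def)
      then show ?thesis by (simp only: if_not_P[OF False]) simp
    qed
  qed
  also have "\<dots> = ennreal (128 / (3 * pi\<^sup>2) * Beta (3/2 + real n) (5/2)) *
     (\<integral>\<^sup>+p. ennreal (if 0 < p \<and> p < 1 then p powr (1/2 + real n - 1) * (1 - p) powr (5/2 - 1) else 0) \<partial>lborel)"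
    by (rule nn_integral_cmult) measurable
  also have "\<dots> = ennreal (128 / (3 * pi\<^sup>2) * Beta (3/2 + real n) (5/2)) * ennreal (Beta (1/2 + real n) (5/2))"
    by (subst nn_integral_Beta_scaled) auto
  also have "\<dots> = ennreal (128 / (3 * pi\<^sup>2) * Beta (3/2 + real n) (5/2) * Beta (1/2 + real n) (5/2))"
    by (rule ennreal_mult''[symmetric]) (rule has_integral_nonneg[OF has_integral_Beta_real], auto)
  \<comment> \<open>The constant cancels the normalising values B(1/2, 5/2) = 3 pi / 8 and B(3/2,
    5/2) = pi / 16.\<close>
  also have "128 / (3 * pi\<^sup>2) * Beta (3/2 + real n) (5/2) * Beta (1/2 + real n) (5/2) = cseq n"
    using Beta_add_nat[of "3/2" "5/2" n] Beta_add_nat[of "1/2" "5/2" n]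
    by (simp add: Beta_real_halves cseq_def power2_eq_square)
  finally show ?thesis .
qed

lemma cseq_nonneg: "0 \<le> cseq n"
  by (simp add: cseq_def pochhammer_nonneg)

lemma \<mu>_moment: "(\<integral>t. t ^ n \<partial>\<mu>) = cseq n"
proof -
  have "(\<integral>t. t ^ n \<partial>\<mu>) = (\<integral>t. dens t *\<^sub>R t ^ n \<partial>lborel)"
    unfolding \<mu>_def by (rule integral_density) (auto simp: dens_nonneg)
  also have "\<dots> = enn2real (\<integral>\<^sup>+t. ennreal (dens t *\<^sub>R t ^ n) \<partial>lborel)"
    by (rule integral_eq_nn_integral) (auto simp: dens_def)
  also have "\<dots> = cseq n" using nn_integral_moments[of n] by (simp add: mult.commute cseq_nonneg)
  finally show ?thesis .
qed

interpretation \<mu>: moment_measure \<mu>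
proof
  show "sets \<mu> = sets borel" by (simp add: \<mu>_def)
  show "AE t in \<mu>. 0 < t \<and> t < 1"
    unfolding \<mu>_def by (subst AE_density) (auto simp: dens_def split: if_splits)
  \<comment> \<open>Majorant: for t < 1/2 the weight is at most 16; for t \<ge> 1/2 the upper bound
    on \<open>dens\<close> cancels the weight and t^-4 is at most 16.\<close>
  have "integrable lborel (\<lambda>t. 16 * dens t + indicator {1/2..1} t * (16 / pi))"
  proof (intro Bochner_Integration.integrable_add integrable_mult_right integrable_mult_left)
    show "integrable lborel dens"
      using nn_integral_moments[of 0] by (intro integrableI_nonneg) (auto simp: dens_nonneg)
    show "integrable lborel (indicat_real {1/2..1 :: real})" 
      by (rule integrable_real_indicator) (simp, rule emeasure_bounded_finite, simp)
  qed
  then have "integrable lborel (\<lambda>t. dens t *\<^sub>R (1 / (1 - t) ^ 4))"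
  proof (rule Bochner_Integration.integrable_bound)
    show "AE t in lborel. norm (dens t *\<^sub>R (1 / (1 - t) ^ 4)) \<le> norm (16 * dens t + indicator {1/2..1} t * (16 / pi))"
    proof (rule AE_I2)
      fix t :: real
      have n: "norm (16 * dens t + indicator {1/2..1} t * (16 / pi)) = 16 * dens t + indicator {1/2..1} t * (16 / pi)"
        by (simp add: dens_nonneg)
      show "norm (dens t *\<^sub>R (1 / (1 - t) ^ 4)) \<le> norm (16 * dens t + indicator {1/2..1} t * (16 / pi))"
      proof (cases "0 < t \<and> t < 1")
        case t: True
        show ?thesis
        proof (cases "t < 1/2")
          case True
          have "1 / (1 - t) ^ 4 \<le> 1 / (1/2) ^ 4" using True by (intro divide_left_mono power_mono mult_pos_pos) auto
          then have "dens t * (1 / (1 - t) ^ 4) \<le> dens t * 16" by (intro mult_left_mono dens_nonneg) (simp add: eval_nat_numeral)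
          then show ?thesis unfolding n using t True by (simp add: dens_nonneg mult.commute)
        next
          case False
          have "dens t * (1 / (1 - t) ^ 4) \<le> 1 / pi * (1 - t) ^ 4 / t ^ 4 * (1 / (1 - t) ^ 4)"
            using t by (intro mult_right_mono dens_bounds) auto
          also have "\<dots> = 1 / pi * (1 / t ^ 4)" using t by simp
          also have "\<dots> \<le> 1 / pi * (1 / (1/2) ^ 4)"
            using False by (intro mult_left_mono divide_left_mono power_mono mult_pos_pos) auto
          also have "\<dots> = 16 / pi" by (simp add: eval_nat_numeral)
          finally show ?thesis unfolding n using t False by (simp add: dens_nonneg add_increasing)
        qed
      qed (auto simp: dens_def)
    qed
  qed measurable
  then show "integrable \<mu> (\<lambda>t. 1 / (1 - t) ^ 4)"
    unfolding \<mu>_def by (subst integrable_density) (auto simp: dens_nonneg)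
qed

section \<open>The Taylor coefficients of F\<close>

lemma cseq_0: "cseq 0 = 1" and cseq_1: "cseq 1 = 1 / 16"
  by (simp_all add: cseq_def)

lemma cseq_Suc: "cseq (Suc n) = cseq n * ((real n + 1/2) * (real n + 3/2) / ((real n + 3) * (real n + 4)))"
  by (simp add: cseq_def pochhammer_Suc field_simps)

text \<open>Telescoping certificate: \<open>r n * cseq n\<close> dominates the tail \<open>\<Sum>k\<ge>n. w k * cseq k\<close>.\<close>
lemma sums_cseq_le:
  fixes r w :: "nat \<Rightarrow> real"
  assumes r: "\<And>n. 0 \<le> r n"
    and step: "\<And>n. 1 \<le> n \<Longrightarrow> w n * ((real n + 3) * (real n + 4)) + r (Suc n) * ((real n + 1/2) * (real n + 3/2))
                  \<le> r n * ((real n + 3) * (real n + 4))"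
    and s: "(\<lambda>n. w n * cseq n) sums s" and w0: "w 0 = 0"
  shows "s \<le> r 1 / 16"
proof -
  have step': "w n * cseq n + r (Suc n) * cseq (Suc n) \<le> r n * cseq n" if "1 \<le> n" for n
  proof -
    define d e where "d = (real n + 3) * (real n + 4)" and "e = (real n + 1/2) * (real n + 3/2)"
    have d: "0 < d" by (simp add: d_def)
    have "(w n * d + r (Suc n) * e) * (cseq n / d) \<le> (r n * d) * (cseq n / d)"
      using step[OF that] d by (intro mult_right_mono) (auto simp: d_def e_def cseq_nonneg)
    moreover have "cseq (Suc n) = cseq n * (e / d)" unfolding d_def e_def by (rule cseq_Suc)
    moreover have "(w n * d + r (Suc n) * e) * (cseq n / d) = w n * cseq n + r (Suc n) * (cseq n * (e / d))"
      "(r n * d) * (cseq n / d) = r n * cseq n"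
      using d by (simp_all add: field_simps)
    ultimately show ?thesis by simp
  qed
  have part: "(\<Sum>k<N. w (Suc k) * cseq (Suc k)) + r (Suc N) * cseq (Suc N) \<le> r 1 / 16" for N
  proof (induction N)
    case 0 then show ?case using arg_cong[OF cseq_1, of "\<lambda>x. r 1 * x"] by (simp only: One_nat_def) simp
  next
    case (Suc N)
    then show ?case using step'[of "Suc N"] by simp
  qed
  have "(\<lambda>k. w (Suc k) * cseq (Suc k)) sums s"
    using s w0 by (subst sums_Suc_iff) simp
  then have "s = (\<Sum>k. w (Suc k) * cseq (Suc k))" "summable (\<lambda>k. w (Suc k) * cseq (Suc k))"
    by (auto simp: sums_iff)
  moreover have "(\<Sum>k<N. w (Suc k) * cseq (Suc k)) \<le> r 1 / 16" for N
    using part[of N] mult_nonneg_nonneg[OF r cseq_nonneg, of "Suc N" "Suc N"] by linarith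
  ultimately show ?thesis using suminf_le_const by blast
qed

abbreviation "\<Phi> \<equiv> \<mu>.\<Phi>"
abbreviation "J1 \<equiv> \<mu>.J1"
abbreviation "J2 \<equiv> \<mu>.J2"

lemma sums_J1: "(\<lambda>n. (if n = 0 then 0 else 1) * cseq n) sums J1"
  unfolding \<mu>.J1_def \<mu>_moment[symmetric]
proof (rule \<mu>.sums_moments)
  show "(\<lambda>n. (if n = 0 then 0 else 1) * t ^ n) sums (t / (1 - t))" if "0 < t" "t < 1" for t :: real
  proof -
    have "(\<lambda>n. (t ^ n)) sums (1 / (1 - t))" using that by (intro geometric_sums) auto
    then have "(\<lambda>n. t * (t ^ n)) sums (t * (1 / (1 - t)))" by (rule sums_mult)
    then have "(\<lambda>n. (if Suc n = 0 then 0 else 1) * t ^ Suc n) sums (t / (1 - t))" by simp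
    then show ?thesis by (subst (asm) sums_Suc_iff) simp
  qed
qed (auto simp: \<mu>.integrable_J1)

lemma sums_J2: "(\<lambda>n. real n * cseq n) sums J2"
  unfolding \<mu>.J2_def \<mu>_moment[symmetric]
proof (rule \<mu>.sums_moments)
  show "(\<lambda>n. real n * t ^ n) sums (t / (1 - t)\<^sup>2)" if "0 < t" "t < 1" for t :: real
  proof -
    have "(\<lambda>n. of_nat (Suc n) * t ^ n) sums (1 / (1 - t)\<^sup>2)" using that by (intro geometric_deriv_sums) auto
    then have "(\<lambda>n. t * (of_nat (Suc n) * t ^ n)) sums (t * (1 / (1 - t)\<^sup>2))" by (rule sums_mult)
    then have "(\<lambda>n. real (Suc n) * t ^ Suc n) sums (t / (1 - t)\<^sup>2)" by (simp add: mult_ac)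
    then show ?thesis by (subst (asm) sums_Suc_iff) simp
  qed
qed (auto simp: \<mu>.integrable_J2)

text \<open>Since \<open>cseq n\<close> decays like n^-5, the tail is asymptotic to n/4 times
  \<open>cseq n\<close>; the certificate n/3 + 1 leaves a margin and gives (4/3)/16.\<close>

lemma J1_le: "J1 \<le> 1/12"
proof -
  have "J1 \<le> (1 / 3 * real 1 + 1) / 16"
  proof (rule sums_cseq_le[OF _ _ sums_J1, of "\<lambda>n. 1 / 3 * real n + 1"])
    fix n :: nat assume "1 \<le> n"
    \<comment> \<open>In the variable m the difference of the two sides has only nonnegative
      coefficients.\<close>
    then obtain m where m: "n = Suc m" using Suc_le_D by auto
    show "(if n = 0 then 0 else 1) * ((real n + 3) * (real n + 4)) + (1/3 * real (Suc n) + 1) * ((real n + 1/2) * (real n + 3/2))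
         \<le> (1/3 * real n + 1) * ((real n + 3) * (real n + 4))"
      unfolding m by (simp add: field_simps)
  qed auto
  then show ?thesis by simp
qed

text \<open>Here the tail is asymptotic to n^2/3 times \<open>cseq n\<close>, so the leading
  coefficient is the true one; the linear term 3/2 n absorbs the lower order error for all n \<ge>
  1.\<close>

lemma J2_le: "J2 \<le> 0.115"
proof -
  have "J2 \<le> (1 / 3 * (real 1)\<^sup>2 + 3/2 * real 1) / 16"
  proof (rule sums_cseq_le[OF _ _ sums_J2, of "\<lambda>n. 1 / 3 * (real n)\<^sup>2 + 3/2 * real n"])
    fix n :: nat assume "1 \<le> n"
    then obtain m where m: "n = Suc m" using Suc_le_D by auto
    show "real n * ((real n + 3) * (real n + 4)) + (1/3 * (real (Suc n))\<^sup>2 + 3/2 * real (Suc n)) * ((real n + 1/2) * (real n + 3/2))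
         \<le> (1/3 * (real n)\<^sup>2 + 3/2 * real n) * ((real n + 3) * (real n + 4))"
      unfolding m by (simp add: power2_eq_square field_simps)
  qed auto
  then show ?thesis by simp
qed

lemma J1_nonneg: "0 \<le> J1" and J2_nonneg: "0 \<le> J2"
  by (rule sums_le[OF _ sums_zero sums_J1], simp add: cseq_nonneg)
     (rule sums_le[OF _ sums_zero sums_J2], simp add: cseq_nonneg)

definition F_coeffs :: "complex fps" where
  "F_coeffs = Abs_fps (\<lambda>n. of_real (16 ^ n * cseq n))"

text \<open>The coefficient of (16 z)^n in 4 z^2 F(z), after division by 4 z^2 and up to sign: 64 =
  16^2 / 4 and 8 = 2 * 16 / 4.\<close>

lemma hypergeo_coeff_identity:
  "64 * (fps_hypergeo [-1/2, -1/2] [1] 1 $ (n + 2)) + 8 * (fps_hypergeo [-1/2, 3/2] [3] 1 $ (n + 1))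
     = - complex_of_real (cseq n)"
proof -
  define p where "p = pochhammer (1/2 :: complex) n"
  define N where "N = (of_nat n :: complex)"
  have c32: "pochhammer (3/2 :: complex) n = (2 * N + 1) * p"
  proof -
    have "(1/2) * pochhammer (3/2 :: complex) n = pochhammer (1/2) (Suc n)" by (simp add: pochhammer_rec)
    also have "\<dots> = p * (1/2 + N)" by (simp add: pochhammer_Suc p_def N_def)
    finally show ?thesis by (simp add: field_simps)
  qed
  have cm: "pochhammer (- (1/2) :: complex) (Suc (Suc n)) = - (1/2) * (p * (1/2 + N))"
    "pochhammer (- (1/2) :: complex) (Suc n) = - (1/2) * p"
    by (subst pochhammer_rec, simp add: pochhammer_Suc p_def N_def)+
  have "pochhammer (3 :: complex) k * 2 = (of_nat k + 2) * (of_nat k + 1) * fact k" for k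
  proof (induction k)
    case (Suc k)
    have "pochhammer (3 :: complex) (Suc k) * 2 = (pochhammer 3 k * 2) * (3 + of_nat k)" by (simp add: pochhammer_Suc)
    also have "\<dots> = (of_nat (Suc k) + 2) * (of_nat (Suc k) + 1) * fact (Suc k)" unfolding Suc by (simp add: algebra_simps)
    finally show ?case .
  qed simp
  then have c3: "pochhammer (3 :: complex) n = (N + 2) * (N + 1) * fact n / 2"
    by (subst nonzero_eq_divide_eq) (simp, simp only: N_def)
  have "pochhammer (4 :: complex) k * 6 = (of_nat k + 3) * (of_nat k + 2) * (of_nat k + 1) * fact k" for k
  proof (induction k)
    case (Suc k)
    have "pochhammer (4 :: complex) (Suc k) * 6 = (pochhammer 4 k * 6) * (4 + of_nat k)" by (simp add: pochhammer_Suc)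
    also have "\<dots> = (of_nat (Suc k) + 3) * (of_nat (Suc k) + 2) * (of_nat (Suc k) + 1) * fact (Suc k)" unfolding Suc by (simp add: algebra_simps)
    finally show ?case .
  qed simp
  then have c4: "pochhammer (4 :: complex) n = (N + 3) * (N + 2) * (N + 1) * fact n / 6"
    by (subst nonzero_eq_divide_eq) (simp, simp only: N_def)
  have c1: "pochhammer (1 :: complex) k = fact k" for k by (simp add: pochhammer_fact)
  have fct: "fact (Suc n) = (N + 1) * (fact n :: complex)" "fact (Suc (Suc n)) = (N + 2) * ((N + 1) * (fact n :: complex))"
    by (simp_all add: N_def algebra_simps)
  have "N + of_nat (Suc k) \<noteq> 0" for k
    unfolding N_def of_nat_add[symmetric] of_nat_eq_0_iff by simp
  from this[of 0] this[of 1] this[of 2] have nz: "N + 1 \<noteq> 0" "N + 2 \<noteq> 0" "N + 3 \<noteq> 0" by simp_all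
  define f where "f = (fact n :: complex)"
  have f: "f \<noteq> 0" by (simp add: f_def)
  define D where "D = (N + 2)\<^sup>2 * (N + 1)\<^sup>2 * (N + 3) * f\<^sup>2"
  have D: "D \<noteq> 0" using nz f by (simp add: D_def)
  have "complex_of_real (cseq n) = p * ((2 * N + 1) * p) / (((N + 2) * (N + 1) * f / 2) * ((N + 3) * (N + 2) * (N + 1) * f / 6))"
    unfolding cseq_def of_real_divide of_real_mult pochhammer_of_real[symmetric]
    by (simp add: c32 c3 c4 f_def flip: p_def)
  also have "\<dots> = 12 * p\<^sup>2 * (2 * N + 1) / D"
    using nz f D by (subst frac_eq_eq) (simp, simp, simp add: D_def power2_eq_square)
  finally have cs: "complex_of_real (cseq n) = 12 * p\<^sup>2 * (2 * N + 1) / D" .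
  have "fps_hypergeo [-1/2, -1/2] [1] 1 $ (n + 2) = (- (1/2) * (p * (1/2 + N)))\<^sup>2 / ((N + 2) * ((N + 1) * f))\<^sup>2"
    by (simp add: cm c1 fct f_def power2_eq_square del: fact_Suc)
  also have "\<dots> = p\<^sup>2 * (2 * N + 1)\<^sup>2 * (N + 3) / (16 * D)"
    using nz f D by (subst frac_eq_eq) (simp, simp, unfold D_def, algebra)
  finally have a: "fps_hypergeo [-1/2, -1/2] [1] 1 $ (n + 2) = p\<^sup>2 * (2 * N + 1)\<^sup>2 * (N + 3) / (16 * D)" .
  have "fps_hypergeo [-1/2, 3/2] [3] 1 $ (n + 1)
      = (- (1/2) * p) * ((2 * N + 1) * p * (3/2 + N)) / ((1/2 * ((N + 2) * (N + 1) * f)) * (3 + N) * ((N + 1) * f))"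
    by (simp add: cm c3 c32 fct f_def pochhammer_Suc[of 3] pochhammer_Suc[of "3/2"] del: fact_Suc flip: N_def)
  also have "\<dots> = - (p\<^sup>2 * (2 * N + 1) * (2 * N + 3) * (N + 2)) / (2 * D)"
    using nz f D by (subst frac_eq_eq) (simp add: add.commute[of 3], simp, unfold D_def, algebra)
  finally have b: "fps_hypergeo [-1/2, 3/2] [3] 1 $ (n + 1) = - (p\<^sup>2 * (2 * N + 1) * (2 * N + 3) * (N + 2)) / (2 * D)" .
  have "64 * (p\<^sup>2 * (2 * N + 1)\<^sup>2 * (N + 3) / (16 * D)) + 8 * (- (p\<^sup>2 * (2 * N + 1) * (2 * N + 3) * (N + 2)) / (2 * D))
     = (4 * (p\<^sup>2 * (2 * N + 1)\<^sup>2 * (N + 3)) - 4 * (p\<^sup>2 * (2 * N + 1) * (2 * N + 3) * (N + 2))) / D"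
    by (simp add: diff_divide_distrib mult_ac)
  \<comment> \<open>The products (2 N + 1) (N + 3) and (2 N + 3) (N + 2) differ by the constant 3;
    this is why the combination collapses to a single hypergeometric term.\<close>
  also have "4 * (p\<^sup>2 * (2 * N + 1)\<^sup>2 * (N + 3)) - 4 * (p\<^sup>2 * (2 * N + 1) * (2 * N + 3) * (N + 2)) = - (12 * p\<^sup>2 * (2 * N + 1))"
    by algebra
  finally show ?thesis unfolding a b cs by simp
qed

text \<open>The ratio test gives radius 1. Excluding nonpositive integer parameters keeps every
  coefficient nonzero, so that the ratios are defined.\<close>

lemma gauss_2F1_sums:
  assumes x: "norm x < 1"
    and c: "\<And>n. c \<noteq> - of_nat n"
    and ab: "\<And>n. a \<noteq> - of_nat n" "\<And>n. b \<noteq> - of_nat n"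
  shows "(\<lambda>n. (fps_hypergeo [a, b] [c] 1 $ n) * x ^ n) sums gauss_2F1 a b c x"
proof -
  let ?f = "fps_hypergeo [a, b] [c] (1 :: complex)"
  have nz: "pochhammer d n \<noteq> 0" if "\<And>n. d \<noteq> - of_nat n" for d :: complex and n
    using that by (auto simp: pochhammer_eq_0_iff)
  have f: "?f $ n \<noteq> 0" for n using nz[OF c] nz[OF ab(1)] nz[OF ab(2)] by simp
  have add_nz: "d + of_nat n \<noteq> 0" if "\<And>n. d \<noteq> - of_nat n" for d :: complex and n
    using that[of n] by (metis add_eq_0_iff2)
  have "(\<lambda>n. norm (?f $ n) / norm (?f $ Suc n)) \<longlonglongrightarrow> 1"
  proof -
    have "norm (?f $ n) / norm (?f $ Suc n)
       = norm ((1 + 1 / of_nat n) * (1 + c / of_nat n) / ((1 + a / of_nat n) * (1 + b / of_nat n)))" if n: "0 < n" for n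
    proof -
      have "?f $ n / ?f $ Suc n = of_nat (Suc n) * (c + of_nat n) / ((a + of_nat n) * (b + of_nat n))"
        using f[of n] add_nz[OF c, of n] add_nz[OF ab(1), of n] add_nz[OF ab(2), of n]
        unfolding fps_hypergeo_rec by (simp del: fps_hypergeo_nth of_nat_Suc add: divide_simps)
      also have "\<dots> = (1 + 1 / of_nat n) * (1 + c / of_nat n) / ((1 + a / of_nat n) * (1 + b / of_nat n))"
        using n add_nz[OF ab(1), of n] add_nz[OF ab(2), of n] by (simp add: divide_simps) (simp add: algebra_simps)
      finally show ?thesis by (simp add: norm_divide[symmetric])
    qed
    then have ev: "eventually (\<lambda>n. norm ((1 + 1 / of_nat n) * (1 + c / of_nat n) / ((1 + a / of_nat n) * (1 + b / of_nat n)))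
        = norm (?f $ n) / norm (?f $ Suc n)) sequentially"
      by (intro eventually_mono[OF eventually_gt_at_top[of 0]]) simp
    have lim: "(\<lambda>n. norm ((1 + 1 / of_nat n) * (1 + c / of_nat n) / ((1 + a / of_nat n) * (1 + b / of_nat n)))) \<longlonglongrightarrow> norm ((1 + 0) * (1 + 0) / ((1 + 0) * (1 + 0 :: complex)))"
      by (intro tendsto_intros tendsto_divide_0[OF tendsto_const] filterlim_compose[OF tendsto_of_nat] ) 
         (auto intro: tendsto_of_nat)
    have "norm ((1 + 0) * (1 + 0) / ((1 + 0) * (1 + 0 :: complex))) = 1" by simp
    with Lim_transform_eventually[OF lim ev] show ?thesis by (simp only:)
  qed
  then have "conv_radius (fps_nth ?f) = 1"
    by (intro conv_radius_ratio_limit_nonzero[of _ 1]) auto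
  then have "norm x < fps_conv_radius ?f" using x by (simp add: fps_conv_radius_def one_ereal_def)
  then have "summable (\<lambda>n. ?f $ n * x ^ n)" by (rule summable_fps)
  then show ?thesis unfolding gauss_2F1_def eval_fps_def by (rule summable_sums)
qed

lemma F_sums:
  assumes z: "norm z < 1/16"
  shows "(\<lambda>n. of_real (16 ^ n * cseq n) * z ^ n) sums F z"
proof (cases "z = 0")
  case True
  then show ?thesis using sums_single[of 0 "\<lambda>n. of_real (16 ^ n * cseq n) * z ^ n"]
    by (auto simp: F_def cseq_0 fun_eq_iff elim!: back_subst[of "\<lambda>f. f sums 1"])
next
  case False
  let ?a = "\<lambda>n. fps_hypergeo [-1/2, -1/2] [1] (1::complex) $ n"
  let ?b = "\<lambda>n. fps_hypergeo [-1/2, 3/2] [3] (1::complex) $ n"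
  have x: "norm (16 * z) < 1" using z by (simp add: norm_mult)
  have half: "- (1/2 :: complex) \<noteq> - of_nat n" "3/2 \<noteq> - complex_of_nat n" "1 \<noteq> - complex_of_nat n" "3 \<noteq> - complex_of_nat n" for n
  proof -
    have "real n \<noteq> 1/2"
    proof
      assume "real n = 1/2"
      then have "real (2 * n) = real 1" by simp
      then show False by (metis of_nat_eq_iff odd_one dvd_triv_left)
    qed
    then show "- (1/2 :: complex) \<noteq> - of_nat n" "3/2 \<noteq> - complex_of_nat n" "1 \<noteq> - complex_of_nat n" "3 \<noteq> - complex_of_nat n"
      by (auto simp: complex_eq_iff)
  qed
  have 1: "(\<lambda>n. ?a n * (16 * z) ^ n) sums gauss_2F1 (-1/2) (-1/2) 1 (16 * z)"
    using half by (intro gauss_2F1_sums x) auto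
  have 2: "(\<lambda>n. ?b n * (16 * z) ^ n) sums gauss_2F1 (-1/2) (3/2) 3 (16 * z)"
    using half by (intro gauss_2F1_sums x) auto
  \<comment> \<open>The split-off terms 1 + 4 z here, and 2 z times the 1 of the second series, add
    up to 1 + 6 z. This makes the singularity of \<open>F\<close> at 0 removable.\<close>
  have s1: "(\<lambda>n. ?a (n + 2) * (16 * z) ^ (n + 2)) sums (gauss_2F1 (-1/2) (-1/2) 1 (16 * z) - (1 + 4 * z))"
    using 1 by (subst sums_iff_shift) (simp add: eval_nat_numeral)
  have s2: "(\<lambda>n. ?b (n + 1) * (16 * z) ^ (n + 1)) sums (gauss_2F1 (-1/2) (3/2) 3 (16 * z) - 1)"
    using 2 by (subst sums_iff_shift) simp
  have "(\<lambda>n. - (?a (n + 2) * (16 * z) ^ (n + 2) + 2 * z * (?b (n + 1) * (16 * z) ^ (n + 1))) / (4 * z\<^sup>2)) sums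
     (- (gauss_2F1 (-1/2) (-1/2) 1 (16 * z) - (1 + 4 * z) + 2 * z * (gauss_2F1 (-1/2) (3/2) 3 (16 * z) - 1)) / (4 * z\<^sup>2))"
    by (intro sums_divide sums_minus sums_add sums_mult s1 s2)
  also have "(\<lambda>n. - (?a (n + 2) * (16 * z) ^ (n + 2) + 2 * z * (?b (n + 1) * (16 * z) ^ (n + 1))) / (4 * z\<^sup>2))
     = (\<lambda>n. of_real (16 ^ n * cseq n) * z ^ n)"
  proof
    fix n
    have "- (?a (n + 2) * (16 * z) ^ (n + 2) + 2 * z * (?b (n + 1) * (16 * z) ^ (n + 1))) / (4 * z\<^sup>2)
       = - (64 * ?a (n + 2) + 8 * ?b (n + 1)) * (16 * z) ^ n"
      using False by (simp del: fps_hypergeo_nth add: power_add power2_eq_square field_simps)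
    also have "\<dots> = of_real (cseq n) * (16 * z) ^ n" unfolding hypergeo_coeff_identity by simp
    finally show "- (?a (n + 2) * (16 * z) ^ (n + 2) + 2 * z * (?b (n + 1) * (16 * z) ^ (n + 1))) / (4 * z\<^sup>2)
       = of_real (16 ^ n * cseq n) * z ^ n" by (simp add: power_mult_distrib)
  qed
  also have "- (gauss_2F1 (-1/2) (-1/2) 1 (16 * z) - (1 + 4 * z) + 2 * z * (gauss_2F1 (-1/2) (3/2) 3 (16 * z) - 1)) / (4 * z\<^sup>2) = F z"
    using False by (simp add: F_def divide_simps) (simp add: algebra_simps)
  finally show ?thesis .
qed

lemma F_eq_Phi:
  assumes "norm z < 1/16" shows "F z = \<Phi> (16 * z)"
proof -
  have "(\<lambda>n. of_real (cseq n) * (16 * z) ^ n) sums \<Phi> (16 * z)"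
    using \<mu>.sums_Phi[of "16 * z"] assms by (simp add: norm_mult \<mu>_moment)
  then show ?thesis using F_sums[OF assms] by (simp add: power_mult_distrib mult_ac sums_iff)
qed

lemma F_has_fps_expansion: "F has_fps_expansion F_coeffs"
proof (rule has_fps_expansionI)
  have "eventually (\<lambda>u. u \<in> ball (0::complex) (1/16)) (nhds 0)" by (intro eventually_nhds_in_open) auto
  then show "\<forall>\<^sub>F u in nhds 0. (\<lambda>n. F_coeffs $ n * u ^ n) sums F u"
    by eventually_elim (use F_sums in \<open>auto simp: F_coeffs_def\<close>)
qed

lemma F_series_eq: "F_series = F_coeffs"
  unfolding F_series_def using F_has_fps_expansion by (rule fps_expansion_eqI)

text \<open>The point \<rho> lies on the circle of convergence. The series there is identified with
  the integral \<Phi>(1) by positivity, through \<open>sums_moments\<close>, rather than by a limit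
  along the radius.\<close>

lemma F0_eq: "F\<^sub>0 = 1 + J1" and Phi_1: "\<Phi> 1 = of_real F\<^sub>0"
proof -
  have "(\<lambda>n. (if n = 0 then 0 else 1) * cseq n + (if n = 0 then 1 else 0)) sums (J1 + 1)"
    by (intro sums_add sums_J1 sums_single)
  moreover have "(\<lambda>n. (if n = 0 then 0 else 1) * cseq n + (if n = 0 then 1 else 0)) = cseq"
    by (auto simp: cseq_0 fun_eq_iff)
  ultimately have s: "cseq sums (1 + J1)" by (simp add: add.commute)
  have "eval_fps F_series (of_real \<rho>) = (\<Sum>n. complex_of_real (cseq n))"
    unfolding eval_fps_def F_series_eq F_coeffs_def \<rho>_def
    by (intro suminf_cong) (simp add: power_one_over)
  also have "\<dots> = of_real (1 + J1)"
    using s by (intro sums_unique[symmetric] sums_of_real)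
  finally show F0: "F\<^sub>0 = 1 + J1" by (simp add: F\<^sub>0_def)
  have "cseq sums (\<integral>t. 1 / (1 - t) \<partial>\<mu>)"
    using \<mu>.sums_moments[of "\<lambda>_. 1" "\<lambda>t. 1 / (1 - t)"] \<mu>.integrable_pow_div[of 1 0]
    by (simp add: \<mu>_moment geometric_sums)
  then have "(\<integral>t. 1 / (1 - t) \<partial>\<mu>) = F\<^sub>0" using s F0 sums_unique2 by metis
  moreover have "\<Phi> 1 = of_real (\<integral>t. 1 / (1 - t) \<partial>\<mu>)"
    unfolding \<mu>.\<Phi>_def
    by (subst integral_of_real[symmetric]) (use \<mu>.integrable_pow_div[of 1 0] in auto)
  ultimately show "\<Phi> 1 = of_real F\<^sub>0" by simp
qed

lemma A_eq: "A = 1 + 2 * J2 / F\<^sub>0"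
proof -
  have "(\<lambda>n. real (Suc n) * cseq (Suc n)) sums J2"
    using sums_J2 by (subst sums_Suc_iff) simp
  then have "(\<lambda>n. 16 * (real (Suc n) * cseq (Suc n))) sums (16 * J2)" by (rule sums_mult)
  then have "(\<lambda>n. complex_of_real (16 * (real (Suc n) * cseq (Suc n)))) sums of_real (16 * J2)" by (rule sums_of_real)
  moreover have "eval_fps (fps_deriv F_series) (of_real \<rho>) = (\<Sum>n. complex_of_real (16 * (real (Suc n) * cseq (Suc n))))"
    unfolding eval_fps_def F_series_eq F_coeffs_def \<rho>_def
    by (intro suminf_cong) (simp add: power_one_over field_simps)
  ultimately have "eval_fps (fps_deriv F_series) (of_real \<rho>) = of_real (16 * J2)" by (simp add: sums_iff)
  then have e: "F\<^sub>0' = 16 * J2" by (simp add: F\<^sub>0'_def)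
  show ?thesis unfolding A_def \<rho>_def e by simp
qed

lemma Phi_0: "\<Phi> 0 = 1"
  using \<mu>_moment[of 0] by (simp add: \<mu>.\<Phi>_def cseq_0)

section \<open>The inverse function\<close>

lemma F0_bounds: "1 \<le> F\<^sub>0" "F\<^sub>0 \<le> 13/12"
  using J1_nonneg J1_le by (simp_all add: F0_eq)

definition \<Psi> :: "complex \<Rightarrow> complex" where
  "\<Psi> x = x * (\<Phi> x / of_real F\<^sub>0)\<^sup>2"

text \<open>\<open>Om\<close> omits the apex 1, while \<open>cOm\<close> contains it and is compact.
  The target \<open>D\<close> omits a wider cone (cosine 1/10 instead of 3/5) and has the smaller
  radius 51/50; these gaps absorb the distortion by \<Psi>.\<close>

definition Om :: "complex set" where
  "Om = {x. norm x < 2 \<and> Re (x - 1) < 3/5 * norm (x - 1)}"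

definition cOm :: "complex set" where
  "cOm = cball 0 2 \<inter> W"

definition D :: "complex set" where
  "D = {y. norm y < 51/50 \<and> Re (y - 1) < 1/10 * norm (y - 1)}"

lemma open_Om: "open Om"
proof -
  have e: "Om = {x. norm x < 2} \<inter> {x. Re (x - 1) < 3/5 * norm (x - 1)}" by (auto simp: Om_def)
  show ?thesis unfolding e by (intro open_Int open_Collect_less continuous_intros)
qed

lemma open_D: "open D"
proof -
  have e: "D = {x. norm x < 51/50} \<inter> {x. Re (x - 1) < 1/10 * norm (x - 1)}" by (auto simp: D_def)
  show ?thesis unfolding e by (intro open_Int open_Collect_less continuous_intros)
qed

lemma compact_cOm: "compact cOm"
  unfolding cOm_def using closed_W by (intro compact_Int_closed) auto

lemma Om_subset: "Om \<subseteq> cOm" "Om \<subseteq> interior W"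
proof -
  show "Om \<subseteq> cOm" by (auto simp: Om_def cOm_def W_def)
  moreover have "cOm \<subseteq> W" by (auto simp: cOm_def)
  ultimately show "Om \<subseteq> interior W" using open_Om by (meson interior_maximal order_trans)
qed

lemma holomorphic_\<Psi>: "\<Psi> holomorphic_on Om"
  unfolding \<Psi>_def using F0_bounds
  by (intro holomorphic_intros \<mu>.Phi_holomorphic Om_subset) auto

lemma continuous_on_\<Psi>: "continuous_on cOm \<Psi>"
  unfolding \<Psi>_def using F0_bounds
  by (intro continuous_intros continuous_on_subset[OF \<mu>.Phi_continuous_on]) (auto simp: cOm_def)

lemma Phi_ratio_near_one:
  assumes "x \<in> W"
  shows "norm (\<Phi> x / of_real F\<^sub>0 - 1) \<le> 0.144 * norm (x - 1)"
proof -
  have "\<Phi> x / of_real F\<^sub>0 - 1 = (\<Phi> x - \<Phi> 1) / of_real F\<^sub>0"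
    using F0_bounds by (simp add: Phi_1 field_simps)
  then have "norm (\<Phi> x / of_real F\<^sub>0 - 1) = norm (\<Phi> x - \<Phi> 1) / F\<^sub>0"
    using F0_bounds by (simp add: norm_divide)
  also have "\<dots> \<le> norm (\<Phi> x - \<Phi> 1)"
    using F0_bounds by (simp add: divide_le_eq mult_le_cancel_left1)
  also have "\<dots> \<le> 5/4 * J2 * norm (x - 1)" by (rule \<mu>.Phi_lipschitz_one[OF assms])
  also have "\<dots> \<le> 0.144 * norm (x - 1)"
    using J2_le by (intro mult_right_mono) auto
  finally show ?thesis .
qed

text \<open>On |x| \<le> 2 the deviation from \<Phi>(0) = 1 is at most 5/4 * 1/12 * 2 =
  5/24.\<close>

lemma norm_Phi_ge:
  assumes "x \<in> cOm" shows "norm (\<Phi> x) \<ge> 19/24"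
proof -
  have "norm (\<Phi> x - 1) \<le> 5/4 * J1 * norm x"
    using \<mu>.Phi_lipschitz_zero[of x] assms by (simp add: cOm_def Phi_0)
  also have "\<dots> \<le> 5/4 * (1/12) * 2"
    using assms J1_le J1_nonneg by (intro mult_mono) (auto simp: cOm_def)
  finally show ?thesis using norm_triangle_ineq3[of "\<Phi> x" 1] by simp
qed

lemma norm_square_minus_one_le:
  fixes u :: complex
  assumes "norm (u - 1) \<le> d"
  shows "norm (u\<^sup>2 - 1) \<le> d * (2 + d)"
proof -
  have "u\<^sup>2 - 1 = (u - 1) * (2 + (u - 1))" by (simp add: power2_eq_square algebra_simps)
  then have "norm (u\<^sup>2 - 1) = norm (u - 1) * norm (2 + (u - 1))" by (simp only: norm_mult)
  also have "\<dots> \<le> d * (2 + d)"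
    using assms norm_triangle_ineq[of 2 "u - 1"] order_trans[OF norm_ge_zero assms]
    by (intro mult_mono) auto
  finally show ?thesis .
qed

text \<open>On the outer circle |\<Psi>(x)| is at least 2 (19/26)^2 > 51/50. On the sides of the
  cone the image leaves \<open>D\<close> through its outer radius when x is far from 1, and through
  its angle when x is near 1.\<close>

lemma \<Psi>_boundary:
  assumes x: "x \<in> cOm" and b: "x \<notin> Om"
  shows "\<Psi> x \<notin> D"
proof -
  define u where "u = \<Phi> x / of_real F\<^sub>0"
  define r where "r = norm (x - 1)"
  have r0: "0 \<le> r" by (simp add: r_def)
  have xW: "x \<in> W" and x2: "norm x \<le> 2" using x by (auto simp: cOm_def)
  have u1: "norm (u - 1) \<le> 0.144 * r" using Phi_ratio_near_one[OF xW] by (simp add: u_def r_def)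
  have \<Psi>: "\<Psi> x = x * u\<^sup>2" by (simp add: \<Psi>_def u_def)
  consider "norm x = 2" | "Re (x - 1) = 3/5 * r" using x b by (auto simp: Om_def cOm_def W_def r_def)
  then show ?thesis
  proof cases
    case 1
    have "norm u = norm (\<Phi> x) / F\<^sub>0" using F0_bounds by (simp add: u_def norm_divide)
    also have "\<dots> \<ge> (19/24) / (13/12)" using norm_Phi_ge[OF x] F0_bounds by (intro frac_le) auto
    finally have "(19/26)\<^sup>2 \<le> (norm u)\<^sup>2" by (intro power_mono) auto
    then have "51/50 \<le> norm (\<Psi> x)" by (simp add: \<Psi> norm_mult norm_power 1 power2_eq_square)
    then show ?thesis by (auto simp: D_def)
  next
    case 2
    have "(norm x)\<^sup>2 = 1 + 2 * Re (x - 1) + r\<^sup>2"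
      unfolding r_def cmod_power2 by (simp add: power2_eq_square algebra_simps)
    also have "\<dots> = (1 + 3/5 * r)\<^sup>2 + 16/25 * r\<^sup>2" unfolding 2 by (simp add: power2_eq_square field_simps)
    finally have "(1 + 3/5 * r)\<^sup>2 \<le> (norm x)\<^sup>2" by simp
    then have nx: "1 + 3/5 * r \<le> norm x" by (rule power2_le_imp_le) simp
    then have r53: "r \<le> 5/3" using x2 by simp
    show ?thesis
    \<comment> \<open>The lower bound (1 + 3/5 r) (1 - 0.288 r) for the modulus tends to 1 as r
      tends to 0, so near 1 the angular condition of \<open>D\<close> has to fail instead.\<close>
    proof (cases "1/4 \<le> r")
      case True
      have "1 - 0.144 * r \<le> norm u" using u1 norm_triangle_ineq2[of 1 "1 - u"] by (simp add: norm_minus_commute)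
      then have "(1 - 0.144 * r)\<^sup>2 \<le> (norm u)\<^sup>2" using r53 by (intro power_mono) auto
      moreover have "(1 - 0.144 * r)\<^sup>2 = 1 - 0.288 * r + (0.144 * r)\<^sup>2" by (simp add: power2_eq_square field_simps)
      ultimately have u2: "1 - 0.288 * r \<le> (norm u)\<^sup>2" using zero_le_power2[of "0.144 * r"] by linarith
      \<comment> \<open>The modulus bound is concave in r; bounding r^2 by its chord over [1/4, 5/3]
        leaves a linear inequality.\<close>
      have "0 \<le> (r - 1/4) * (5/3 - r)" using True r53 by simp
      then have q: "r * r \<le> 23/12 * r - 5/12" by (simp add: field_simps)
      have "51/50 \<le> 1 + 0.312 * r - 0.1728 * (r * r)" using q True r53 by simp
      also have "\<dots> = (1 + 3/5 * r) * (1 - 0.288 * r)" by (simp add: field_simps)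
      also have "\<dots> \<le> norm x * (norm u)\<^sup>2" using nx u2 r0 r53 by (intro mult_mono) auto
      also have "\<dots> = norm (\<Psi> x)" by (simp add: \<Psi> norm_mult norm_power)
      finally show ?thesis by (auto simp: D_def)
    next
      case False
      have "norm (u\<^sup>2 - 1) \<le> 0.144 * r * (2 + 0.144 * r)" by (rule norm_square_minus_one_le[OF u1])
      also have "\<dots> \<le> 0.144 * r * 2.036" using False r0 by (intro mult_left_mono) auto
      finally have "norm (u\<^sup>2 - 1) \<le> 0.2932 * r" using r0 by simp
      moreover have "norm x \<le> 1.25" using False norm_triangle_ineq[of 1 "x - 1"] by (simp add: r_def)
      ultimately have "norm x * norm (u\<^sup>2 - 1) \<le> 1.25 * (0.2932 * r)" by (intro mult_mono) auto
      then have e: "norm (x * (u\<^sup>2 - 1)) \<le> 0.3665 * r" by (simp add: norm_mult)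
      have eq: "\<Psi> x - 1 = (x - 1) + x * (u\<^sup>2 - 1)" by (simp add: \<Psi> algebra_simps)
      have "Re (\<Psi> x - 1) \<ge> 3/5 * r - 0.3665 * r"
        unfolding eq using e 2 abs_Re_le_cmod[of "x * (u\<^sup>2 - 1)"] by simp
      moreover have "norm (\<Psi> x - 1) \<le> r + 0.3665 * r"
        unfolding eq using e norm_triangle_ineq[of "x - 1" "x * (u\<^sup>2 - 1)"] by (simp add: r_def)
      ultimately have "Re (\<Psi> x - 1) \<ge> 1/10 * norm (\<Psi> x - 1)" using r0 by simp
      then show ?thesis by (auto simp: D_def)
    qed
  qed
qed

text \<open>If \<Psi> x = \<Psi> y and |\<Phi> x| is the larger modulus, then (x - y) \<Phi>(x)^2 =
  y (\<Phi> y - \<Phi> x) (\<Phi> y + \<Phi> x). The Lipschitz constant 0.18 bounds the right side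
  by 0.72 |x - y| |\<Phi> x|, hence |\<Phi> x| \<le> 0.72, below the minimum 19/24.\<close>

lemma inj_on_\<Psi>: "inj_on \<Psi> cOm"
proof -
  have *: "x = y" if xy: "x \<in> cOm" "y \<in> cOm" "\<Psi> x = \<Psi> y" and le: "norm (\<Phi> y) \<le> norm (\<Phi> x)" for x y
  proof (rule ccontr)
    assume ne: "x \<noteq> y"
    have F0: "of_real F\<^sub>0 \<noteq> (0 :: complex)" using F0_bounds by simp
    have "x * (\<Phi> x)\<^sup>2 = y * (\<Phi> y)\<^sup>2"
      using xy(3) F0 by (simp add: \<Psi>_def power_divide)
    then have "(x - y) * (\<Phi> x)\<^sup>2 = y * (\<Phi> y - \<Phi> x) * (\<Phi> y + \<Phi> x)"
      by (simp add: power2_eq_square algebra_simps)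
    then have "norm (x - y) * (norm (\<Phi> x))\<^sup>2 = norm y * norm (\<Phi> y - \<Phi> x) * norm (\<Phi> y + \<Phi> x)"
      by (metis norm_mult norm_power)
    also have "\<dots> \<le> 2 * (0.18 * norm (x - y)) * (2 * norm (\<Phi> x))"
    proof (intro mult_mono)
      have "norm (\<Phi> y - \<Phi> x) \<le> 25/16 * J2 * norm (y - x)"
        using xy by (intro \<mu>.Phi_lipschitz) (auto simp: cOm_def)
      also have "\<dots> \<le> 0.18 * norm (y - x)" using J2_le by (intro mult_right_mono) auto
      finally show "norm (\<Phi> y - \<Phi> x) \<le> 0.18 * norm (x - y)" by (simp add: norm_minus_commute)
      show "norm (\<Phi> y + \<Phi> x) \<le> 2 * norm (\<Phi> x)"
        using norm_triangle_ineq[of "\<Phi> y" "\<Phi> x"] le by simp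
    qed (use xy in \<open>auto simp: cOm_def\<close>)
    finally have "norm (x - y) * norm (\<Phi> x) * norm (\<Phi> x) \<le> norm (x - y) * norm (\<Phi> x) * 0.72"
      by (simp add: power2_eq_square mult_ac)
    moreover have "0 < norm (x - y) * norm (\<Phi> x)"
      using ne norm_Phi_ge[OF xy(1)] by (intro mult_pos_pos) auto
    ultimately have "norm (\<Phi> x) \<le> 0.72" by (metis mult_le_cancel_left_pos)
    then show False using norm_Phi_ge[OF xy(1)] by simp
  qed
  show ?thesis by (rule inj_onI) (metis * linear)
qed

text \<open>From \<Psi> x - 1 = (x - 1) u^2 + (u^2 - 1): the first term is at least (19/26)^2 |x -
  1|, the second at most 0.36 |x - 1|. It forces the preimage of y to tend to 1 as y tends to
  1.\<close>

lemma \<Psi>_minus_one_ge: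
  assumes x: "x \<in> cOm"
  shows "norm (\<Psi> x - 1) \<ge> 1/10 * norm (x - 1)"
proof -
  define u where "u = \<Phi> x / of_real F\<^sub>0"
  define r where "r = norm (x - 1)"
  have r: "0 \<le> r" "r \<le> 3"
    using x norm_triangle_ineq4[of x 1] by (auto simp: r_def cOm_def)
  have u1: "norm (u - 1) \<le> 0.144 * r" using Phi_ratio_near_one[of x] x by (simp add: u_def r_def cOm_def)
  have "norm (u\<^sup>2 - 1) \<le> 0.144 * r * (2 + 0.144 * r)" by (rule norm_square_minus_one_le[OF u1])
  also have "\<dots> \<le> 0.144 * r * 2.432" using r by (intro mult_left_mono) auto
  finally have "norm (u\<^sup>2 - 1) \<le> 0.36 * r" using r by simp
  moreover have "(19/24) / (13/12) \<le> norm (\<Phi> x) / F\<^sub>0" using norm_Phi_ge[OF x] F0_bounds by (intro frac_le) auto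
  then have "19/26 \<le> norm u" using F0_bounds by (simp add: u_def norm_divide)
  then have "(19/26)\<^sup>2 \<le> (norm u)\<^sup>2" by (intro power_mono) auto
  then have "r * (19/26)\<^sup>2 \<le> norm ((x - 1) * u\<^sup>2)"
    using r(1) unfolding norm_mult norm_power r_def[symmetric] by (intro mult_left_mono)
  moreover have "\<Psi> x - 1 = (x - 1) * u\<^sup>2 + (u\<^sup>2 - 1)" by (simp add: \<Psi>_def u_def algebra_simps)
  then have "norm (\<Psi> x - 1) \<ge> norm ((x - 1) * u\<^sup>2) - norm (u\<^sup>2 - 1)" by (metis norm_diff_ineq)
  ultimately show ?thesis using r unfolding r_def[symmetric] by (simp add: power2_eq_square)
qed

text \<open>For z = s y one has z - 1 = s (y - 1) - (1 - s): the shift lowers the real part by 1 - s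
  and changes the modulus by at most 1 - s, so the cone condition survives.\<close>

lemma starlike_D: "y \<in> D \<Longrightarrow> closed_segment 0 y \<subseteq> D" and zero_in_D: "0 \<in> D"
proof -
  show "0 \<in> D" by (simp add: D_def)
  assume y: "y \<in> D"
  show "closed_segment 0 y \<subseteq> D"
  proof
    fix z assume "z \<in> closed_segment 0 y"
    then obtain s where s: "0 \<le> s" "s \<le> 1" "z = s *\<^sub>R y" by (auto simp: in_segment)
    have "norm z \<le> norm y" using s by (simp add: mult_left_le_one_le)
    moreover have "Re (z - 1) < 1/10 * norm (z - 1)"
    proof (cases "s = 0")
      case True then show ?thesis using s by simp
    next
      case False
      then have "s * Re (y - 1) < s * (1/10 * norm (y - 1))"
        using s y by (intro mult_strict_left_mono) (auto simp: D_def)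
      also have "s * norm (y - 1) = norm ((z - 1) + of_real (1 - s))"
        using s by (subst norm_scaleR[symmetric, of s "y - 1", unfolded abs_of_nonneg[OF s(1)]])
          (simp add: scaleR_conv_of_real algebra_simps)
      then have "s * (1/10 * norm (y - 1)) \<le> 1/10 * (norm (z - 1) + (1 - s))"
        using norm_triangle_ineq[of "z - 1" "of_real (1 - s)"] s by (simp only: norm_of_real) simp
      finally show ?thesis using s by (simp add: algebra_simps)
    qed
    ultimately show "z \<in> D" using y by (auto simp: D_def)
  qed
qed

lemma connected_D: "connected D"
  using starlike_D zero_in_D by (intro starlike_imp_connected) (auto simp: starlike_def)

text \<open>A frontier point of the image inside \<open>D\<close> is, by compactness, \<Psi> x with
  x in \<open>cOm\<close>. The open mapping theorem excludes x in \<open>Om\<close>, and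
  \<open>\<Psi>_boundary\<close> excludes the rest.\<close>

lemma D_subset_image: "D \<subseteq> \<Psi> ` Om"
proof (rule ccontr)
  assume "\<not> ?thesis"
  moreover have "0 \<in> Om" "\<Psi> 0 = 0" by (auto simp: Om_def \<Psi>_def)
  ultimately have "D \<inter> frontier (\<Psi> ` Om) \<noteq> {}"
    using connected_D zero_in_D by (intro connected_Int_frontier) force+
  then obtain y where y: "y \<in> D" "y \<in> frontier (\<Psi> ` Om)" by auto
  have "closed (\<Psi> ` cOm)"
    using compact_continuous_image[OF continuous_on_\<Psi> compact_cOm] by (rule compact_imp_closed)
  then have "closure (\<Psi> ` Om) \<subseteq> \<Psi> ` cOm" using Om_subset by (intro closure_minimal) auto
  then obtain x where x: "x \<in> cOm" "y = \<Psi> x" using y by (auto simp: frontier_def)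
  have "open (\<Psi> ` Om)"
    using holomorphic_\<Psi> open_Om inj_on_subset[OF inj_on_\<Psi> Om_subset(1)] by (rule open_mapping_thm3)
  then have "y \<notin> \<Psi> ` Om" using y by (simp add: frontier_def interior_open)
  then show False using x y \<Psi>_boundary by blast
qed

section \<open>The inverse branch and the continuation of S\<close>

definition Z :: "complex \<Rightarrow> complex" where "Z = inv_into Om \<Psi>"

lemma Z_in: "y \<in> D \<Longrightarrow> Z y \<in> Om" and \<Psi>_Z: "y \<in> D \<Longrightarrow> \<Psi> (Z y) = y"
  unfolding Z_def using D_subset_image by (auto intro: inv_into_into f_inv_into_f)

lemma Z_\<Psi>: "x \<in> Om \<Longrightarrow> Z (\<Psi> x) = x"
  unfolding Z_def using inj_on_subset[OF inj_on_\<Psi> Om_subset(1)] by (rule inv_into_f_f)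

lemma holomorphic_Z: "Z holomorphic_on D"
proof -
  obtain g where g: "g holomorphic_on (\<Psi> ` Om)" "\<And>z. z \<in> Om \<Longrightarrow> g (\<Psi> z) = z"
    using holomorphic_has_inverse[OF holomorphic_\<Psi> open_Om inj_on_subset[OF inj_on_\<Psi> Om_subset(1)]] by metis
  have "Z y = g y" if "y \<in> D" for y using that g(2)[OF Z_in] \<Psi>_Z by metis
  then show ?thesis using holomorphic_on_subset[OF g(1) D_subset_image] by (simp cong: holomorphic_cong)
qed

lemma \<sigma>_eq: "\<sigma> = F\<^sub>0\<^sup>2 / 16" and \<sigma>_pos: "0 < \<sigma>"
  using F0_bounds by (simp_all add: \<sigma>_def \<rho>_def)

text \<open>Cosine decreases on [0, pi], which turns the bound on the argument into the inequality
  between real part and modulus that defines \<open>D\<close>; dividing by \<sigma> > 0 keeps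
  arguments.\<close>

lemma Delta_iff: "y \<in> Delta \<sigma> (\<sigma> / 50) (arccos (1/10)) \<longleftrightarrow> y / of_real \<sigma> \<in> D"
proof -
  define w where "w = y / of_real \<sigma> - 1"
  have yw: "y - of_real \<sigma> = of_real \<sigma> * w" using \<sigma>_pos by (simp add: w_def field_simps)
  have "norm y < \<sigma> + \<sigma> / 50 \<longleftrightarrow> norm (y / of_real \<sigma>) < 51/50"
    using \<sigma>_pos by (simp add: norm_divide field_simps)
  moreover have "\<bar>Arg (y - of_real \<sigma>)\<bar> > arccos (1/10) \<longleftrightarrow> Re w < 1/10 * norm w" if "w \<noteq> 0"
  proof -
    have "\<bar>Arg w\<bar> > arccos (1/10) \<longleftrightarrow> cos \<bar>Arg w\<bar> < cos (arccos (1/10))"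
      using Arg_bounded[of w] arccos_bounded[of "1/10"] by (intro cos_mono_less_eq[symmetric]) auto
    also have "\<dots> \<longleftrightarrow> Re w / norm w < 1/10" using that by (simp add: cos_Arg)
    also have "\<dots> \<longleftrightarrow> Re w < 1/10 * norm w" using that by (simp add: field_simps)
    finally show ?thesis unfolding yw using \<sigma>_pos by (simp add: Arg_times_of_real)
  qed
  moreover have "y = of_real \<sigma> \<longleftrightarrow> w = 0" using \<sigma>_pos by (simp add: w_def)
  ultimately show ?thesis
    unfolding Delta_def D_def mem_Collect_eq w_def[symmetric] by auto
qed

definition S_cont :: "complex \<Rightarrow> complex" where "S_cont y = \<Phi> (Z (y / of_real \<sigma>))"

abbreviation (input) "\<Delta> \<equiv> Delta \<sigma> (\<sigma> / 50) (arccos (1/10))"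

lemma holomorphic_S_cont: "S_cont holomorphic_on \<Delta>"
proof -
  have "(\<lambda>y. y / of_real \<sigma>) holomorphic_on \<Delta>" using \<sigma>_pos by (intro holomorphic_intros) auto
  then have "(Z \<circ> (\<lambda>y. y / of_real \<sigma>)) holomorphic_on \<Delta>"
    using Delta_iff by (intro holomorphic_on_compose_gen[OF _ holomorphic_Z]) auto
  then have "(\<Phi> \<circ> (Z \<circ> (\<lambda>y. y / of_real \<sigma>))) holomorphic_on \<Delta>"
    by (rule holomorphic_on_compose_gen[OF _ \<mu>.Phi_holomorphic[OF Om_subset(2)]]) (use Delta_iff Z_in in auto)
  then show ?thesis by (simp add: S_cont_def[abs_def] comp_def)
qed

lemma open_\<Delta>: "open \<Delta>"
proof -
  have "\<Delta> = (\<lambda>y. y / of_real \<sigma>) -` D" using Delta_iff by auto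
  moreover have "continuous_on UNIV (\<lambda>y. y / complex_of_real \<sigma>)" using \<sigma>_pos by (intro continuous_intros) auto
  ultimately show ?thesis using open_D by (simp add: open_vimage)
qed

text \<open>The closed disk touches the omitted cone only at its apex. This also shows that every
  other point of the circle is regular.\<close>

lemma ball_subset_\<Delta>: "norm y \<le> \<sigma> \<Longrightarrow> y \<noteq> of_real \<sigma> \<Longrightarrow> y \<in> \<Delta>"
proof -
  assume y: "norm y \<le> \<sigma>" "y \<noteq> of_real \<sigma>"
  define w where "w = y / of_real \<sigma>"
  have w: "norm w \<le> 1" "w \<noteq> 1" using y \<sigma>_pos by (auto simp: w_def norm_divide)
  then have "Re (w - 1) \<le> 0" using complex_Re_le_cmod[of w] by simp
  also have "0 < 1/10 * norm (w - 1)" using w by simp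
  finally show ?thesis using w Delta_iff[of y] by (simp add: D_def w_def)
qed

lemma norm_less_imp_\<Delta>: "norm y < \<sigma> \<Longrightarrow> y \<in> \<Delta>"
  using ball_subset_\<Delta>[of y] by (cases "y = of_real \<sigma>") auto

lemma connected_\<Delta>: "connected \<Delta>"
proof -
  have "\<Delta> = (\<lambda>y. of_real \<sigma> * y) ` D"
  proof (intro equalityI subsetI)
    fix y assume "y \<in> \<Delta>"
    then have "y / of_real \<sigma> \<in> D" by (simp add: Delta_iff)
    moreover have "y = of_real \<sigma> * (y / of_real \<sigma>)" using \<sigma>_pos by simp
    ultimately show "y \<in> (\<lambda>y. of_real \<sigma> * y) ` D" by blast
  qed (use \<sigma>_pos in \<open>auto simp: Delta_iff\<close>)
  then show ?thesis using connected_D by (auto intro!: connected_continuous_image continuous_intros)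
qed

text \<open>For |16 z| < 1 the point 16 z lies in \<open>Om\<close>, so \<open>S_cont\<close> undoes
  z F(z)^2 there. Its Taylor series \<open>G\<close> then solves the functional equation, whose
  formal solution is unique.\<close>

lemma S_cont_has_fps_expansion: "S_cont has_fps_expansion S_series"
proof -
  define G where "G = fps_expansion S_cont 0"
  have "0 \<in> \<Delta>" using Delta_iff[of 0] zero_in_D by simp
  then have G: "S_cont has_fps_expansion G"
    unfolding G_def using open_\<Delta> holomorphic_S_cont by (intro has_fps_expansion_fps_expansion)
  have "(\<lambda>z. z * F z ^ 2) has_fps_expansion fps_X * F_series ^ 2"
    unfolding F_series_eq by (intro fps_expansion_intros F_has_fps_expansion)
  then have "(S_cont \<circ> (\<lambda>z. z * F z ^ 2)) has_fps_expansion (G oo (fps_X * F_series ^ 2))"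
    using G by (intro has_fps_expansion_compose) auto
  moreover have "eventually (\<lambda>z. (S_cont \<circ> (\<lambda>z. z * F z ^ 2)) z = F z) (nhds 0)"
  proof -
    have "eventually (\<lambda>z. z \<in> ball (0::complex) (1/16)) (nhds 0)" by (intro eventually_nhds_in_open) auto
    then show ?thesis
    proof eventually_elim
      case (elim z)
      then have z: "norm z < 1/16" by simp
      have "norm (16 * z) < 1" using z by (simp add: norm_mult)
      moreover from this have "Re (16 * z - 1) < 0" using complex_Re_le_cmod[of "16 * z"] by simp
      then have "Re (16 * z - 1) < 3/5 * norm (16 * z - 1)" by (rule less_le_trans) simp
      ultimately have "16 * z \<in> Om" by (simp add: Om_def)
      moreover have "z * F z ^ 2 / of_real \<sigma> = \<Psi> (16 * z)"
        using F0_bounds by (simp add: F_eq_Phi[OF z] \<Psi>_def \<sigma>_eq power_divide)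
      ultimately show ?case by (simp add: S_cont_def Z_\<Psi> F_eq_Phi[OF z])
    qed
  qed
  ultimately have "F has_fps_expansion (G oo (fps_X * F_series ^ 2))"
    using has_fps_expansion_cong[OF _ refl] by blast
  then have "G oo (fps_X * F_series ^ 2) = F_series"
    unfolding F_series_eq using F_has_fps_expansion by (rule fps_expansion_unique_complex)
  then have "S_series = G"
    unfolding S_series_def by (rule the1_equality[OF S_series_unique_existence])
  then show ?thesis using G by simp
qed

lemma S_conv_radius_ge: "fps_conv_radius S_series \<ge> ereal \<sigma>"
  using S_cont_has_fps_expansion
proof (rule holomorphic_on_imp_fps_conv_radius_ge)
  show "S_cont holomorphic_on eball 0 (ereal \<sigma>)"
    using holomorphic_S_cont by (rule holomorphic_on_subset) (use norm_less_imp_\<Delta> in auto)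
qed

lemma eval_S: "norm y < \<sigma> \<Longrightarrow> eval_fps S_series y = S_cont y"
  using S_cont_has_fps_expansion
proof (rule has_fps_expansion_imp_eval_fps_eq)
  show "S_cont holomorphic_on ball 0 \<sigma>"
    using holomorphic_S_cont by (rule holomorphic_on_subset) (use norm_less_imp_\<Delta> in auto)
qed

section \<open>The singular expansion\<close>

text \<open>Keeps the segment from 1 to 1 - x off the branch cut, so that -Ln (1 - t x) / x is an
  antiderivative of the kernel on all of [0, 1].\<close>

lemma W_one_minus_notin_nonpos_Reals:
  assumes x: "x \<in> W" "x \<noteq> 1" and t: "0 \<le> t" "t \<le> 1"
  shows "1 - of_real t * x \<notin> \<real>\<^sub>\<le>\<^sub>0"
proof
  assume "1 - of_real t * x \<in> \<real>\<^sub>\<le>\<^sub>0"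
  then have re: "1 - t * Re x \<le> 0" and im: "t * Im x = 0" by (auto simp: complex_nonpos_Reals_iff)
  have t0: "0 < t" using re t by (cases "t = 0") auto
  then have "Im x = 0" using im by simp
  have "Re x \<ge> 1" using re t0 t by (smt (verit) mult_left_le_one_le mult_nonneg_nonneg mult_nonneg_nonpos)
  have "Re x \<noteq> 1" using x \<open>Im x = 0\<close> by (auto simp: complex_eq_iff)
  have "norm (x - 1) = Re (x - 1)" using \<open>Im x = 0\<close> \<open>Re x \<ge> 1\<close> by (simp add: cmod_def)
  then show False using x \<open>Re x \<ge> 1\<close> \<open>Re x \<noteq> 1\<close> by (simp add: W_def)
qed

lemma has_bochner_integral_kernel:
  assumes x: "x \<in> W" "x \<noteq> 1" "x \<noteq> 0"
  shows "has_bochner_integral lborel (\<lambda>t. indicator {0..1} t *\<^sub>R (1 / (1 - of_real t * x))) (- Ln (1 - x) / x)"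
proof -
  have "has_bochner_integral lborel (\<lambda>t. indicator {0..1} t *\<^sub>R (1 / (1 - of_real t * x)))
     (- Ln (1 - of_real 1 * x) / x - - Ln (1 - of_real 0 * x) / x)"
  proof (rule has_bochner_integral_FTC_Icc)
    fix t :: real assume t: "0 \<le> t" "t \<le> 1"
    note n = W_one_minus_notin_nonpos_Reals[OF x(1,2) t]
    have nz: "1 - of_real t * x \<noteq> 0" using n by auto
    have "((\<lambda>z. - Ln (1 - z * x) / x) has_field_derivative (1 / (1 - of_real t * x))) (at (of_real t))"
      using n nz x by (auto intro!: derivative_eq_intros simp: field_simps)
    from has_vector_derivative_real_field[OF this]
    show "((\<lambda>t. - Ln (1 - of_real t * x) / x) has_vector_derivative 1 / (1 - of_real t * x)) (at t within {0..1})"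
      by (rule has_vector_derivative_at_within)
  next
    show "continuous_on {0..1} (\<lambda>t. 1 / (1 - of_real t * x))"
    proof (intro continuous_intros ballI)
      fix t :: real assume "t \<in> {0..1}"
      then show "1 - of_real t * x \<noteq> 0" using W_one_minus_notin_nonpos_Reals[OF x(1,2), of t] by auto
    qed
  qed simp
  then show ?thesis by simp
qed

text \<open>The quotient \<open>t ^ 4 * dens t / (1 - t) ^ 4\<close> tends to 1/pi at 1; this
  integrates its difference quotient there. It enters the expansion of \<Phi> as minus the
  coefficient of (1 - x)^4.\<close>

definition J3 :: real where
  "J3 = (\<integral>t. indicator {0<..<1} t * ((1 / pi - t ^ 4 * dens t / (1 - t) ^ 4) / (1 - t)) \<partial>lborel)"

text \<open>Let m be that quotient, j = (1/pi - m) / (1 - t) and K the kernel. Then m K = K/pi - j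
  (1 - t) K and (1 - t) K = 1 - (1 - x) t K. The term K/pi integrates to the logarithm, -j to
  -\<open>J3\<close>, and the rest carries a factor 1 - x, with j bounded by 5/pi.\<close>

lemma singular_integral:
  assumes x: "x \<in> W" "x \<noteq> 1" "norm (x - 1) \<le> 1/2"
  shows "norm ((\<integral>t. of_real (t ^ 4 / (1 - t) ^ 4) / (1 - of_real t * x) \<partial>\<mu>)
     - (- (1 / of_real pi) * Ln (1 - x) - of_real J3)) \<le> 9 * norm (1 - x) * norm (Ln (1 - x))"
proof -
  define r where "r = norm (x - 1)"
  have r: "0 < r" "r \<le> 1/2" "r = norm (1 - x)" using x by (auto simp: r_def norm_minus_commute)
  have x0: "x \<noteq> 0" using x by auto
  have xge: "norm x \<ge> 1/2" using norm_triangle_ineq2[of 1 "1 - x"] r by simp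
  define j where "j t = (1 / pi - t ^ 4 * dens t / (1 - t) ^ 4) / (1 - t)" for t
  have [measurable]: "j \<in> borel_measurable borel" unfolding j_def[abs_def] by measurable
  have j: "0 \<le> j t" "j t \<le> 5 / pi" if t: "0 < t" "t < 1" for t
  proof -
    have "t ^ 4 * dens t / (1 - t) ^ 4 \<le> t ^ 4 * (1 / pi * (1 - t) ^ 4 / t ^ 4) / (1 - t) ^ 4"
      using t by (intro divide_right_mono mult_left_mono dens_bounds) auto
    also have "\<dots> = 1 / pi" using t by simp
    finally show "0 \<le> j t" using t by (simp add: j_def)
    have "1 / pi - 5 / pi * (1 - t) = t ^ 4 * (1 / pi * (1 - 5 * (1 - t)) * (1 - t) ^ 4 / t ^ 4) / (1 - t) ^ 4"
      using t by (simp add: field_simps)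
    also have "\<dots> \<le> t ^ 4 * dens t / (1 - t) ^ 4"
      using t by (intro divide_right_mono mult_left_mono dens_bounds) auto
    finally show "j t \<le> 5 / pi" using t by (simp add: j_def divide_le_eq)
  qed
  define K where "K t = 1 / (1 - of_real t * x)" for t
  have [measurable]: "K \<in> borel_measurable borel" unfolding K_def[abs_def] by measurable
  have Kint: "integrable lborel (\<lambda>t. indicator {0..1} t *\<^sub>R K t)"
    and Kval: "(\<integral>t. indicator {0..1} t *\<^sub>R K t \<partial>lborel) = - Ln (1 - x) / x"
    using has_bochner_integral_kernel[OF x(1,2) x0] unfolding K_def by (auto simp: has_bochner_integral_iff)
  \<comment> \<open>The kernel at the real point 1 - r, which has the same distance r from 1 as x.
    Its integral is explicit, and |K| is compared with it.\<close>
  define q where "q t = 1 / (1 - t * (1 - r))" for t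
  have "of_real (1 - r) \<in> W" by (rule cball_subset_W) (use r in \<open>simp del: of_real_diff\<close>)
  then have "has_bochner_integral lborel (\<lambda>t. indicator {0..1} t *\<^sub>R (1 / (1 - of_real t * complex_of_real (1 - r)))) (- Ln (1 - of_real (1 - r)) / of_real (1 - r))"
    using r by (intro has_bochner_integral_kernel) (auto simp del: of_real_diff)
  then have "has_bochner_integral lborel (\<lambda>t. Re (indicator {0..1} t *\<^sub>R (1 / (1 - of_real t * complex_of_real (1 - r))))) (Re (- Ln (1 - of_real (1 - r)) / of_real (1 - r)))"
    by (rule has_bochner_integral_bounded_linear[OF bounded_linear_Re])
  moreover have "Re (indicator {0..1} t *\<^sub>R (1 / (1 - of_real t * complex_of_real (1 - r)))) = indicator {0..1} t * q t" for t
  proof -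
    have "1 / (1 - of_real t * complex_of_real (1 - r)) = of_real (q t)" by (simp add: q_def)
    then show ?thesis by simp
  qed
  moreover have "Re (- Ln (1 - of_real (1 - r)) / of_real (1 - r)) = - ln r / (1 - r)"
  proof -
    have "- Ln (1 - of_real (1 - r)) / of_real (1 - r) = complex_of_real (- ln r / (1 - r))"
      using r by (simp add: Ln_of_real)
    then show ?thesis by (simp only: Re_complex_of_real)
  qed
  ultimately have qi: "has_bochner_integral lborel (\<lambda>t. indicator {0..1} t * q t) (- ln r / (1 - r))" by (simp only:)
  \<comment> \<open>The average of the two cone estimates: 2/5 ((1 - t) + t r) = 2/5 (1 - t (1 -
    r)).\<close>
  have Kq: "norm (K t) \<le> 5/2 * q t" if t: "0 \<le> t" "t \<le> 1" for t
  proof -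
    have "t * (1 - r) \<le> 1 * (1 - r)" using t r by (intro mult_right_mono) auto
    then have pos: "0 < 1 - t * (1 - r)" using r(1) by (simp add: algebra_simps)
    have "2/5 * (1 - t * (1 - r)) \<le> norm (1 - of_real t * x)"
      using W_kernel[OF x(1) t] by (simp add: r_def algebra_simps)
    then have "1 / norm (1 - of_real t * x) \<le> 1 / (2/5 * (1 - t * (1 - r)))"
      using pos by (intro divide_left_mono mult_pos_pos) (auto intro: less_le_trans[of 0 "2/5 * (1 - t * (1 - r))"])
    also have "\<dots> = 5/2 * (1 / (1 - t * (1 - r)))" by (simp only: divide_divide_eq_left[symmetric]) simp
    finally show ?thesis by (simp add: K_def q_def norm_divide)
  qed
  let ?j = "\<lambda>t. complex_of_real (indicator {0<..<1} t * j t)"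
  have ji: "integrable lborel ?j"
  proof (rule Bochner_Integration.integrable_bound)
    show "integrable lborel (\<lambda>t::real. indicator {0..1} t * (5 / pi))" by (intro integrable_mult_left integrable_real_indicator) auto
    show "AE t in lborel. norm (?j t) \<le> norm (indicator {0..1} t * (5 / pi))"
      using j by (auto simp: indicator_def)
  qed measurable
  let ?e = "\<lambda>t. (1 - x) * (?j t * (of_real t * K t))"
  have ebd: "norm (?e t) \<le> r * (5 / pi * 5/2) * (indicator {0..1} t * q t)" for t
  proof (cases "0 < t \<and> t < 1")
    case True
    have "norm (?e t) = r * (j t * (t * norm (K t)))" using True j[of t] by (simp add: norm_mult r)
    also have "\<dots> \<le> r * (5 / pi * (1 * (5/2 * q t)))"
      using True j[of t] Kq[of t] r by (intro mult_left_mono mult_mono) auto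
    finally show ?thesis using True by simp
  next
    case False
    then show ?thesis using r by (auto simp: indicator_def q_def)
  qed
  have ei: "integrable lborel ?e"
  proof (rule Bochner_Integration.integrable_bound)
    show "integrable lborel (\<lambda>t. r * (5 / pi * 5/2) * (indicator {0..1} t * q t))"
      using qi by (intro integrable_mult_right) (auto simp: has_bochner_integral_iff)
    show "AE t in lborel. norm (?e t) \<le> norm (r * (5 / pi * 5/2) * (indicator {0..1} t * q t))"
      by (rule AE_I2) (rule order_trans[OF ebd], simp only: real_norm_def abs_ge_self)
  qed measurable
  have "norm (\<integral>t. ?e t \<partial>lborel) \<le> (\<integral>t. r * (5 / pi * 5/2) * (indicator {0..1} t * q t) \<partial>lborel)"
  proof (rule order_trans[OF integral_norm_bound])
    show "(\<integral>t. norm (?e t) \<partial>lborel) \<le> (\<integral>t. r * (5 / pi * 5/2) * (indicator {0..1} t * q t) \<partial>lborel)"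
      using ei ebd qi by (intro integral_mono integrable_mult_right) (auto simp: has_bochner_integral_iff)
  qed
  also have "\<dots> = r * (5 / pi * 5/2) * (- ln r / (1 - r))"
    using qi by (simp only: integral_mult_right_zero has_bochner_integral_iff)
  \<comment> \<open>Uses pi \<ge> 3, 1 - r \<ge> 1/2, and that ln r is the real part of Ln (1 -
    x).\<close>
  also have "\<dots> \<le> r * (5 / 3 * 5/2) * (norm (Ln (1 - x)) / (1/2))"
  proof (intro mult_mono frac_le)
    have "\<bar>ln r\<bar> \<le> norm (Ln (1 - x))" using abs_Re_le_cmod[of "Ln (1 - x)"] x by (simp add: r)
    then show "- ln r \<le> norm (Ln (1 - x))" by simp
    show "3 \<le> pi" using pi_gt3 by simp
    show "0 \<le> - ln r / (1 - r)" using r by (intro divide_nonneg_nonneg) auto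
  qed (use r in auto)
  finally have E: "norm (\<integral>t. ?e t \<partial>lborel) \<le> 25/3 * r * norm (Ln (1 - x))" by simp
  have "(\<integral>t. of_real (t ^ 4 / (1 - t) ^ 4) / (1 - of_real t * x) \<partial>\<mu>)
     = (\<integral>t. dens t *\<^sub>R (of_real (t ^ 4 / (1 - t) ^ 4) * K t) \<partial>lborel)"
    unfolding \<mu>_def K_def by (subst integral_density) (auto simp: dens_nonneg)
  also have "\<dots> = (\<integral>t. (1 / of_real pi) * (indicator {0..1} t *\<^sub>R K t) - (?j t - ?e t) \<partial>lborel)"
  proof (rule integral_cong_AE)
    have "AE t in lborel. t \<noteq> (0::real)" "AE t in lborel. t \<noteq> (1::real)" by (rule AE_lborel_singleton)+
    then show "AE t in lborel. dens t *\<^sub>R (of_real (t ^ 4 / (1 - t) ^ 4) * K t)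
       = (1 / of_real pi) * (indicator {0..1} t *\<^sub>R K t) - (?j t - ?e t)"
    proof eventually_elim
      case (elim t)
      show ?case
      proof (cases "0 < t \<and> t < 1")
        case True
        define m where "m = complex_of_real (t ^ 4 * dens t / (1 - t) ^ 4)"
        define T where "T = complex_of_real t"
        have T1: "1 - T \<noteq> 0" using True by (auto simp: T_def)
        have nz: "1 - T * x \<noteq> 0" using W_kernel_nonzero[OF x(1)] True by (auto simp: T_def)
        have jj: "?j t = (1 / of_real pi - m) / (1 - T)" using True by (simp add: j_def m_def T_def)
        have "?j t - ?e t = ?j t * (1 - (1 - x) * T * K t)" by (simp add: T_def algebra_simps)
        also have "1 - (1 - x) * T * K t = (1 - T) * K t"
          using nz by (simp add: K_def flip: T_def) (simp add: divide_simps, simp add: algebra_simps)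
        finally have "?j t - ?e t = (1 / of_real pi - m) * K t" using T1 unfolding jj by simp
        moreover have "dens t *\<^sub>R (of_real (t ^ 4 / (1 - t) ^ 4) * K t) = m * K t"
          by (simp add: m_def scaleR_conv_of_real)
        ultimately show ?thesis using True by (simp add: algebra_simps)
      next
        case False
        then show ?thesis using elim by (auto simp: dens_def indicator_def)
      qed
    qed
  qed measurable
  also have "\<dots> = (\<integral>t. (1 / of_real pi) * (indicator {0..1} t *\<^sub>R K t) \<partial>lborel) - ((\<integral>t. ?j t \<partial>lborel) - (\<integral>t. ?e t \<partial>lborel))"
    using Kint ji ei by (simp only: Bochner_Integration.integral_diff integrable_mult_right Bochner_Integration.integrable_diff)
  also have "(\<integral>t. (1 / of_real pi) * (indicator {0..1} t *\<^sub>R K t) \<partial>lborel) = (1 / of_real pi) * (- Ln (1 - x) / x)"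
    by (simp only: integral_mult_right_zero Kval)
  also have "(\<integral>t. ?j t \<partial>lborel) = of_real J3"
    unfolding J3_def j_def by (rule integral_complex_of_real)
  finally have I: "(\<integral>t. of_real (t ^ 4 / (1 - t) ^ 4) / (1 - of_real t * x) \<partial>\<mu>)
     = (1 / of_real pi) * (- Ln (1 - x) / x) - (of_real J3 - (\<integral>t. ?e t \<partial>lborel))" .
  have "(1 / of_real pi) * (- Ln (1 - x) / x) - (of_real J3 - (\<integral>t. ?e t \<partial>lborel)) - (- (1 / of_real pi) * Ln (1 - x) - of_real J3)
     = (\<integral>t. ?e t \<partial>lborel) - (1 - x) * Ln (1 - x) / (of_real pi * x)"
    using x0 by (simp add: field_simps)
  \<comment> \<open>The second summand is the price of replacing 1/x by 1 in front of the logarithm;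
    25/3 + 2/3 = 9.\<close>
  also have "norm \<dots> \<le> 25/3 * r * norm (Ln (1 - x)) + r * norm (Ln (1 - x)) / (3 * (1/2))"
  proof (rule order_trans[OF norm_triangle_ineq4] , rule add_mono[OF E])
    show "norm ((1 - x) * Ln (1 - x) / (of_real pi * x)) \<le> r * norm (Ln (1 - x)) / (3 * (1/2))"
      unfolding norm_divide norm_mult r(3)[symmetric] norm_of_real
      using xge pi_gt3 r by (intro divide_left_mono mult_mono mult_nonneg_nonneg mult_pos_pos) auto
  qed
  also have "\<dots> = 9 * r * norm (Ln (1 - x))" by simp
  finally show ?thesis unfolding I r(3) .
qed

lemma Phi_expansion:
  obtains p2 p3 p4 :: complex where
    "\<And>x. x \<in> W \<Longrightarrow> x \<noteq> 1 \<Longrightarrow> norm (1 - x) \<le> 1/2 \<Longrightarrow>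
      norm (\<Phi> x - (of_real F\<^sub>0 + (- of_real J2) * (1 - x) + p2 * (1 - x)\<^sup>2 + p3 * (1 - x) ^ 3 + p4 * (1 - x) ^ 4
        + (- (1 / of_real pi)) * ((1 - x) ^ 4 * Ln (1 - x)))) \<le> 9 * norm (1 - x) ^ 5 * norm (Ln (1 - x))"
proof -
  define T where "T k = complex_of_real (\<integral>t. t ^ k / (1 - t) ^ Suc k \<partial>\<mu>)" for k
  have T0: "T 0 = of_real F\<^sub>0"
  proof -
    have "\<Phi> 1 = complex_of_real (\<integral>t. 1 / (1 - t) \<partial>\<mu>)"
      unfolding \<mu>.\<Phi>_def
      by (subst integral_of_real[symmetric]) (use \<mu>.integrable_pow_div[of 1 0] in auto)
    then show ?thesis by (simp add: T_def Phi_1)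
  qed
  have T1: "T 1 = of_real J2" by (simp add: T_def \<mu>.J2_def power2_eq_square)
  show ?thesis
  proof (rule that[of "T 2" "- T 3" "- of_real J3"])
    fix x assume x: "x \<in> W" "x \<noteq> 1" "norm (1 - x) \<le> 1/2"
    define I where "I = (\<integral>t. of_real (t ^ 4 / (1 - t) ^ 4) / (1 - of_real t * x) \<partial>\<mu>)"
    have "\<Phi> x = (\<Sum>k<4. T k * (x - 1) ^ k) + (x - 1) ^ 4 * I"
      unfolding T_def I_def by (rule \<mu>.Phi_taylor[OF x(1,2)])
    also have "\<dots> = of_real F\<^sub>0 + (- of_real J2) * (1 - x) + T 2 * (1 - x)\<^sup>2 + (- T 3) * (1 - x) ^ 3 + (1 - x) ^ 4 * I"
    proof -
      have "x - 1 = - (1 - x)" by simp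
      then have "(x - 1) ^ 2 = (1 - x)\<^sup>2" "(x - 1) ^ 3 = - ((1 - x) ^ 3)" "(x - 1) ^ 4 = (1 - x) ^ 4"
        by (metis power2_commute, metis power_minus_odd odd_numeral, metis power_minus_even even_numeral)
      moreover have "(\<Sum>k<4. f k) = f 0 + f 1 + f 2 + f 3" for f :: "nat \<Rightarrow> complex" by (simp add: eval_nat_numeral)
      ultimately show ?thesis using T1 by (simp add: T0 algebra_simps)
    qed
    finally have "\<Phi> x - (of_real F\<^sub>0 + (- of_real J2) * (1 - x) + T 2 * (1 - x)\<^sup>2 + (- T 3) * (1 - x) ^ 3 + (- of_real J3) * (1 - x) ^ 4
        + (- (1 / of_real pi)) * ((1 - x) ^ 4 * Ln (1 - x)))
      = (1 - x) ^ 4 * (I - (- (1 / of_real pi) * Ln (1 - x) - of_real J3))" by (simp add: algebra_simps)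
    also have "norm \<dots> \<le> norm (1 - x) ^ 4 * (9 * norm (1 - x) * norm (Ln (1 - x)))"
      unfolding norm_mult norm_power I_def using singular_integral[of x] x
      by (intro mult_left_mono) (auto simp: norm_minus_commute)
    also have "\<dots> = 9 * norm (1 - x) ^ 5 * norm (Ln (1 - x))" by (simp add: eval_nat_numeral)
    finally show "norm (\<Phi> x - (of_real F\<^sub>0 + (- of_real J2) * (1 - x) + T 2 * (1 - x)\<^sup>2 + (- T 3) * (1 - x) ^ 3 + (- of_real J3) * (1 - x) ^ 4
        + (- (1 / of_real pi)) * ((1 - x) ^ 4 * Ln (1 - x)))) \<le> 9 * norm (1 - x) ^ 5 * norm (Ln (1 - x))" .
  qed
qed

section \<open>Squaring and inverting expansions with a logarithmic term\<close>

lemma bigo_1_add: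
  fixes f h :: "'a \<Rightarrow> complex"
  shows "f \<in> O[K](\<lambda>_. 1) \<Longrightarrow> h \<in> O[K](\<lambda>_. 1) \<Longrightarrow> (\<lambda>y. f y + h y) \<in> O[K](\<lambda>_. 1)"
    and "f \<in> O[K](\<lambda>_. 1) \<Longrightarrow> h \<in> O[K](\<lambda>_. 1) \<Longrightarrow> (\<lambda>y. f y - h y) \<in> O[K](\<lambda>_. 1)"
  by (rule sum_in_bigo; assumption)+

lemma bigo_1_power:
  fixes f :: "'a \<Rightarrow> complex"
  assumes "f \<in> O[K](\<lambda>_. 1)" shows "(\<lambda>y. f y ^ n) \<in> O[K](\<lambda>_. 1)"
  using landau_o.big_power[OF assms, of n] by simp

lemma bigo_1_const: "(\<lambda>_. k) \<in> O[K](\<lambda>_. 1)" for k :: complex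
  by simp

lemmas bigo_1_intros = bigo_1_add landau_o.big.mult_in_1 bigo_1_const bigo_1_power

text \<open>Below, \<open>l\<close> plays the role of \<open>Log X\<close>, and expansions are taken modulo \<open>O(G)\<close>.\<close>
locale log_gauge =
  fixes K :: "'a filter" and X l :: "'a \<Rightarrow> complex"
  assumes X: "X \<in> O[K](\<lambda>_. 1)" and Xl: "(\<lambda>y. X y * l y) \<in> O[K](\<lambda>_. 1)"
begin

definition G :: "'a \<Rightarrow> complex" where
  "G y = X y ^ 5 * of_real (1 + norm (l y))"

lemma G_mult: "f \<in> O[K](G) \<Longrightarrow> h \<in> O[K](\<lambda>_. 1) \<Longrightarrow> (\<lambda>y. f y * h y) \<in> O[K](G)"
  for f h :: "'a \<Rightarrow> complex"
  using landau_o.big.mult[of f K G h "\<lambda>_. 1"] by simp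

lemma G_add:
  fixes f h :: "'a \<Rightarrow> complex"
  shows "f \<in> O[K](G) \<Longrightarrow> h \<in> O[K](G) \<Longrightarrow> (\<lambda>y. f y + h y) \<in> O[K](G)"
    and "f \<in> O[K](G) \<Longrightarrow> h \<in> O[K](G) \<Longrightarrow> (\<lambda>y. f y - h y) \<in> O[K](G)"
  by (rule sum_in_bigo; assumption)+

lemma norm_G: "norm (G y) = norm (X y) ^ 5 * (1 + norm (l y))"
  unfolding G_def norm_mult norm_power norm_of_real by simp

lemma X5_G: "(\<lambda>y. X y ^ 5) \<in> O[K](G)"
  by (intro bigoI[of _ 1] always_eventually allI) (simp add: norm_G norm_power mult_le_cancel_left1)

lemma X5l_G: "(\<lambda>y. X y ^ 5 * l y) \<in> O[K](G)"
  by (intro bigoI[of _ 1] always_eventually allI) (simp add: norm_G norm_mult norm_power mult_left_mono)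

lemma X_norm_l: "(\<lambda>y. X y * of_real (norm (l y))) \<in> O[K](\<lambda>_. 1)"
  by (rule landau_o.big_trans[OF _ Xl]) (intro bigoI[of _ 1] always_eventually allI, simp add: norm_mult)

lemma G_bigo_X2: "G \<in> O[K](\<lambda>y. X y ^ 2)"
proof -
  have "(\<lambda>y. X y ^ 2 * (X y ^ 3 + X y ^ 2 * (X y * of_real (norm (l y))))) \<in> O[K](\<lambda>y. X y ^ 2 * 1)"
    by (intro landau_o.big.mult landau_o.big_refl bigo_1_add landau_o.big.mult_in_1[of "\<lambda>y. X y ^ 2"] bigo_1_power X X_norm_l)
  moreover have "G = (\<lambda>y. X y ^ 2 * (X y ^ 3 + X y ^ 2 * (X y * of_real (norm (l y)))))"
    by (rule ext) (simp add: G_def algebra_simps eval_nat_numeral)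
  ultimately show ?thesis by simp
qed

lemma G_bigo_1: "f \<in> O[K](G) \<Longrightarrow> f \<in> O[K](\<lambda>_. 1)" for f :: "'a \<Rightarrow> complex"
  using landau_o.big_trans[OF _ landau_o.big_trans[OF G_bigo_X2 bigo_1_power[OF X]]] .

text \<open>A singular part becomes negligible when multiplied by X or by another singular part: X^5
  l is O(G), and spare powers of X absorb each further l because X l is bounded. The last claim
  prepares the multiplication of fourth powers by l.\<close>

lemma singular_part:
  fixes C :: complex and E :: "'a \<Rightarrow> complex"
  assumes E: "E \<in> O[K](G)"
  defines "w \<equiv> (\<lambda>y. C * (X y ^ 4 * l y) + E y)"
  shows "w \<in> O[K](\<lambda>_. 1)" "(\<lambda>y. X y * w y) \<in> O[K](G)" "(\<lambda>y. w y * w y) \<in> O[K](G)"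
    and "(\<lambda>y. w y * l y) \<in> O[K](\<lambda>_. 1)"
proof -
  define m n where "m y = X y * l y" and "n y = X y * of_real (norm (l y))" for y
  have mn: "m \<in> O[K](\<lambda>_. 1)" "n \<in> O[K](\<lambda>_. 1)"
    using Xl X_norm_l by (simp_all add: m_def[abs_def] n_def[abs_def])
  note B = bigo_1_intros X mn
  have "w = (\<lambda>y. C * (X y ^ 3 * m y) + E y)" by (rule ext) (simp add: w_def m_def eval_nat_numeral)
  then show w1: "w \<in> O[K](\<lambda>_. 1)" by (simp only:) (intro B G_bigo_1[OF E])
  have "(\<lambda>y. X y * w y) = (\<lambda>y. X y ^ 5 * l y * C + E y * X y)" by (rule ext) (simp add: w_def eval_nat_numeral algebra_simps)
  then show Xw: "(\<lambda>y. X y * w y) \<in> O[K](G)" by (simp only:) (intro G_add G_mult X5l_G E B)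
  have "(\<lambda>y. w y * w y) = (\<lambda>y. X y * w y * (C * (X y ^ 2 * m y)) + E y * w y)"
    by (rule ext) (simp add: w_def m_def eval_nat_numeral algebra_simps)
  then show "(\<lambda>y. w y * w y) \<in> O[K](G)" by (simp only:) (intro G_add G_mult Xw E B w1)
  define h where "h y = E y * l y" for y
  have h: "h \<in> O[K](\<lambda>_. 1)"
  proof -
    have "(\<lambda>y. E y * l y) \<in> O[K](\<lambda>y. G y * l y)" by (intro landau_o.big.mult E) simp
    also have "(\<lambda>y. G y * l y) = (\<lambda>y. X y ^ 4 * m y + X y ^ 3 * m y * n y)"
      by (rule ext) (simp add: G_def m_def n_def algebra_simps eval_nat_numeral)
    also have "\<dots> \<in> O[K](\<lambda>_. 1)" by (intro B)
    finally show ?thesis by (simp add: h_def[abs_def])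
  qed
  have "(\<lambda>y. w y * l y) = (\<lambda>y. C * (X y ^ 2 * m y ^ 2) + h y)"
    by (rule ext) (simp add: h_def m_def w_def eval_nat_numeral algebra_simps)
  then show "(\<lambda>y. w y * l y) \<in> O[K](\<lambda>_. 1)" by (simp only:) (intro B h)
qed

text \<open>Apart from polynomial terms, only the product of the constant term p0 with the singular
  part survives modulo O(G). Hence the logarithm enters with the factor -2 c / p0.\<close>

lemma expansion_square:
  assumes U: "(\<lambda>y. U y - (p0 + p1 * X y + p2 * X y ^ 2 + p3 * X y ^ 3 + p4 * X y ^ 4 + c * (X y ^ 4 * l y))) \<in> O[K](G)"
    and p0: "p0 \<noteq> 0"
  shows "\<exists>a2 a3 a4. (\<lambda>y. 1 - (1 - X y) * (U y / p0) ^ 2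
     - ((1 - 2 * p1 / p0) * X y + a2 * X y ^ 2 + a3 * X y ^ 3 + a4 * X y ^ 4 + (- 2 * c / p0) * (X y ^ 4 * l y))) \<in> O[K](G)"
proof -
  define E where "E y = U y - (p0 + p1 * X y + p2 * X y ^ 2 + p3 * X y ^ 3 + p4 * X y ^ 4 + c * (X y ^ 4 * l y))" for y
  have E: "E \<in> O[K](G)" using U by (simp add: E_def[abs_def])
  define w where "w = (\<lambda>y. c * (X y ^ 4 * l y) + E y)"
  have w: "w \<in> O[K](\<lambda>_. 1)" "(\<lambda>y. X y * w y) \<in> O[K](G)" "(\<lambda>y. w y * w y) \<in> O[K](G)" "(\<lambda>y. w y * l y) \<in> O[K](\<lambda>_. 1)"
    unfolding w_def by (rule singular_part[OF E])+
  note B = bigo_1_intros X w(1)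
  define r where "r y = p1 + p2 * X y + p3 * X y ^ 2 + p4 * X y ^ 3" for y
  define P where "P y = p0 + X y * r y" for y
  have r: "r \<in> O[K](\<lambda>_. 1)" unfolding r_def[abs_def] by (intro B)
  have P: "P \<in> O[K](\<lambda>_. 1)" unfolding P_def[abs_def] by (intro B r)
  have UP: "U y = P y + w y" for y
    by (simp add: w_def E_def P_def r_def eval_nat_numeral algebra_simps)
  \<comment> \<open>\<open>s2\<close>, \<open>s3\<close>, \<open>s4\<close> are the coefficients of
    (1 - X) P^2 in degrees 2 to 4, and \<open>v\<close> collects degrees 5 to 9.\<close>
  define s2 where "s2 = p1^2 + 2*p0*p2 - 2*p0*p1"
  define s3 where "s3 = 2*p0*p3 + 2*p1*p2 - (p1^2 + 2*p0*p2)"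
  define s4 where "s4 = 2*p0*p4 + 2*p1*p3 + p2^2 - (2*p0*p3 + 2*p1*p2)"
  define v where "v y = (2*(p1*p4 + p2*p3) - (2*p0*p4 + 2*p1*p3 + p2^2)) + (2*p2*p4 + p3^2 - 2*(p1*p4 + p2*p3)) * X y
     + (2*p3*p4 - (2*p2*p4 + p3^2)) * X y ^ 2 + (p4^2 - 2*p3*p4) * X y ^ 3 - p4^2 * X y ^ 4" for y
  have v: "v \<in> O[K](\<lambda>_. 1)" unfolding v_def[abs_def] by (intro B)
  have "(1 - X y) * U y ^ 2 - (p0^2 + (2*p0*p1 - p0^2) * X y + s2 * X y ^ 2 + s3 * X y ^ 3 + s4 * X y ^ 4 + 2*p0*c * (X y ^ 4 * l y))
      = X y ^ 5 * v y + E y * (2 * p0) + X y * w y * (2 * (r y - P y)) + w y * w y * (1 - X y)" for y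
  proof -
    have "c * (X y ^ 4 * l y) = w y - E y" by (simp add: w_def)
    then have "2*p0*c * (X y ^ 4 * l y) = 2 * p0 * (w y - E y)" by (metis mult.assoc)
    then show ?thesis unfolding UP P_def r_def s2_def s3_def s4_def v_def by algebra
  qed
  then have "(\<lambda>y. (1 - X y) * U y ^ 2 - (p0^2 + (2*p0*p1 - p0^2) * X y + s2 * X y ^ 2 + s3 * X y ^ 3 + s4 * X y ^ 4 + 2*p0*c * (X y ^ 4 * l y))) \<in> O[K](G)"
    by (simp only:) (intro G_add G_mult[OF X5_G] G_mult[OF E] G_mult[OF w(2)] G_mult[OF w(3)] B v r P)
  from G_mult[OF this bigo_1_const[of "- 1 / p0^2"]]
  have "(\<lambda>y. ((1 - X y) * U y ^ 2 - (p0^2 + (2*p0*p1 - p0^2) * X y + s2 * X y ^ 2 + s3 * X y ^ 3 + s4 * X y ^ 4 + 2*p0*c * (X y ^ 4 * l y))) * (- 1 / p0^2)) \<in> O[K](G)" .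
  also have "(\<lambda>y. ((1 - X y) * U y ^ 2 - (p0^2 + (2*p0*p1 - p0^2) * X y + s2 * X y ^ 2 + s3 * X y ^ 3 + s4 * X y ^ 4 + 2*p0*c * (X y ^ 4 * l y))) * (- 1 / p0^2))
     = (\<lambda>y. 1 - (1 - X y) * (U y / p0) ^ 2
     - ((1 - 2 * p1 / p0) * X y + (- s2 / p0^2) * X y ^ 2 + (- s3 / p0^2) * X y ^ 3 + (- s4 / p0^2) * X y ^ 4 + (- 2 * c / p0) * (X y ^ 4 * l y)))"
    using p0 by (intro ext) (simp add: field_simps power2_eq_square)
  finally show ?thesis by blast
qed

text \<open>
  Once \<open>Y, Y\<^sup>2, Y\<^sup>3, Y\<^sup>4\<close> are expanded in powers of \<open>X\<close>, the coefficients of the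
  expansion in powers of \<open>Y\<close> solve a triangular system.
\<close>
lemma singular_inversion:
  assumes U: "(\<lambda>y. U y - (p0 + p1 * X y + p2 * X y ^ 2 + p3 * X y ^ 3 + p4 * X y ^ 4 + c * (X y ^ 4 * l y))) \<in> O[K](G)"
    and Y: "(\<lambda>y. Y y - (a * X y + a2 * X y ^ 2 + a3 * X y ^ 3 + a4 * X y ^ 4 + C * (X y ^ 4 * l y))) \<in> O[K](G)"
    and a: "a \<noteq> 0"
  shows "\<exists>q2 q3 q4. (\<lambda>y. U y - (p0 + p1 / a * Y y + q2 * Y y ^ 2 + q3 * Y y ^ 3 + q4 * Y y ^ 4
            + (c - p1 * C / a) * (X y ^ 4 * l y))) \<in> O[K](G)"
    and "(\<lambda>y. X y ^ 4 * l y - (Y y / a) ^ 4 * l y) \<in> O[K](G)"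
proof -
  define E where "E y = Y y - (a * X y + a2 * X y ^ 2 + a3 * X y ^ 3 + a4 * X y ^ 4 + C * (X y ^ 4 * l y))" for y
  have E: "E \<in> O[K](G)" using Y by (simp add: E_def[abs_def])
  define w where "w = (\<lambda>y. C * (X y ^ 4 * l y) + E y)"
  have w: "w \<in> O[K](\<lambda>_. 1)" "(\<lambda>y. X y * w y) \<in> O[K](G)" "(\<lambda>y. w y * w y) \<in> O[K](G)" "(\<lambda>y. w y * l y) \<in> O[K](\<lambda>_. 1)"
    unfolding w_def by (rule singular_part[OF E])+
  note Xw = w(2) and ww = w(3)
  note B = bigo_1_intros X w(1)
  define d where "d y = a3 + a4 * X y" for y
  define b where "b y = a2 + X y * d y" for y
  have bd: "d \<in> O[K](\<lambda>_. 1)" "b \<in> O[K](\<lambda>_. 1)"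
    unfolding d_def[abs_def] b_def[abs_def] by (intro B)+
  note B = B bd
  have Yeq: "Y y = a * X y + X y ^ 2 * b y + w y" for y
    by (simp add: w_def E_def b_def d_def eval_nat_numeral algebra_simps)
  define t where "t y = a + X y * b y" for y
  have t1: "t \<in> O[K](\<lambda>_. 1)" unfolding t_def[abs_def] by (intro B)
  note B = B t1
  have Yt: "Y y = X y * t y + w y" for y by (simp add: Yeq t_def power2_eq_square algebra_simps)
  have Y2: "(\<lambda>y. Y y ^ 2 - (a^2 * X y ^ 2 + 2*a*a2 * X y ^ 3 + (2*a*a3 + a2^2) * X y ^ 4)) \<in> O[K](G)"
  proof -
    have "Y y ^ 2 - (a^2 * X y ^ 2 + 2*a*a2 * X y ^ 3 + (2*a*a3 + a2^2) * X y ^ 4)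
       = X y ^ 5 * (2*a*a4 + 2*a2*d y + X y * d y ^ 2) + X y * w y * (2 * t y) + w y * w y" for y
      unfolding Yt t_def b_def d_def by algebra
    then show ?thesis by (simp only:) (intro G_add G_mult[OF X5_G] G_mult[OF Xw] G_mult[OF ww] ww B)
  qed
  have Y3: "(\<lambda>y. Y y ^ 3 - (a^3 * X y ^ 3 + 3*a^2*a2 * X y ^ 4)) \<in> O[K](G)"
  proof -
    have "Y y ^ 3 - (a^3 * X y ^ 3 + 3*a^2*a2 * X y ^ 4)
       = X y ^ 5 * (3*a^2*d y + 3*a*b y ^ 2 + X y * b y ^ 3)
         + X y * w y * (3 * X y * t y ^ 2 + 3 * t y * w y) + w y * w y * w y" for y
      unfolding Yt t_def b_def d_def by algebra
    then show ?thesis by (simp only:) (intro G_add G_mult[OF X5_G] G_mult[OF Xw] G_mult[OF ww] ww B)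
  qed
  \<comment> \<open>The version with the factor l serves to replace X^4 l by (Y / a)^4 l. There the
    remainder is arranged so that each l is paired with X^5, X or w.\<close>
  have Y4: "(\<lambda>y. Y y ^ 4 - a^4 * X y ^ 4) \<in> O[K](G)"
    and Y4l: "(\<lambda>y. (Y y ^ 4 - a^4 * X y ^ 4) * l y) \<in> O[K](G)"
  proof -
    define v where "v y = 4*a^3*b y + 6*a^2*X y*b y ^ 2 + 4*a*X y ^ 2*b y ^ 3 + X y ^ 3 * b y ^ 4" for y
    have v: "v \<in> O[K](\<lambda>_. 1)" unfolding v_def[abs_def] by (intro B)
    define z where "z y = 4 * t y ^ 3 * X y ^ 2 + 6 * t y ^ 2 * X y * w y + 4 * t y * w y ^ 2" for y
    have eq: "Y y ^ 4 - a^4 * X y ^ 4 = X y ^ 5 * v y + X y * w y * z y + w y * w y * (w y * w y)" for y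
      unfolding Yt t_def v_def z_def by algebra
    have z: "z \<in> O[K](\<lambda>_. 1)" unfolding z_def[abs_def] by (intro B)
    show "(\<lambda>y. Y y ^ 4 - a^4 * X y ^ 4) \<in> O[K](G)"
      unfolding eq by (intro G_add G_mult[OF X5_G] G_mult[OF Xw] G_mult[OF ww] B v z)
    define m where "m y = X y * l y" for y
    have m: "m \<in> O[K](\<lambda>_. 1)" using Xl by (simp add: m_def[abs_def])
    define k where "k y = w y * l y" for y
    have k: "k \<in> O[K](\<lambda>_. 1)" using w(4) by (simp add: k_def[abs_def])
    have zl: "(\<lambda>y. z y * l y) \<in> O[K](\<lambda>_. 1)"
    proof -
      have "(\<lambda>y. z y * l y) = (\<lambda>y. 4 * t y ^ 3 * X y * m y + 6 * t y ^ 2 * X y * k y + 4 * t y * w y * k y)"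
        by (rule ext) (simp add: z_def m_def k_def power2_eq_square algebra_simps)
      then show ?thesis by (simp only:) (intro B m k)
    qed
    have "(\<lambda>y. w y * k y) \<in> O[K](\<lambda>_. 1)" by (intro B k)
    then have wwl: "(\<lambda>y. w y * (w y * l y)) \<in> O[K](\<lambda>_. 1)" by (simp add: k_def)
    have "(\<lambda>y. (Y y ^ 4 - a^4 * X y ^ 4) * l y) = (\<lambda>y. X y ^ 5 * l y * v y + X y * w y * (z y * l y) + w y * w y * (w y * (w y * l y)))"
      by (rule ext) (simp add: eq algebra_simps)
    then show "(\<lambda>y. (Y y ^ 4 - a^4 * X y ^ 4) * l y) \<in> O[K](G)"
      by (simp only:) (intro G_add G_mult[OF X5l_G v] G_mult[OF Xw zl] G_mult[OF ww wwl])
  qed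
  \<comment> \<open>Modulo O(G) the powers Y^2, Y^3, Y^4 contain no logarithm, so it is corrected
    only through \<open>q1 * Y y\<close>; this gives c - p1 C / a.\<close>
  define q1 where "q1 = p1 / a"
  define q2 where "q2 = (p2 - q1 * a2) / a^2"
  define q3 where "q3 = (p3 - q1 * a3 - q2 * (2*a*a2)) / a^3"
  define q4 where "q4 = (p4 - q1 * a4 - q2 * (2*a*a3 + a2^2) - q3 * (3*a^2*a2)) / a^4"
  have pq: "p1 = q1 * a" "p2 = q2 * a^2 + q1 * a2" "p3 = q3 * a^3 + q1 * a3 + q2 * (2*a*a2)"
    "p4 = q4 * a^4 + q1 * a4 + q2 * (2*a*a3 + a2^2) + q3 * (3*a^2*a2)" "p1 * C / a = q1 * C"
    using a by (simp_all add: q1_def q2_def q3_def q4_def)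
  have "(\<lambda>y. U y - (p0 + q1 * Y y + q2 * Y y ^ 2 + q3 * Y y ^ 3 + q4 * Y y ^ 4 + (c - p1 * C / a) * (X y ^ 4 * l y))) \<in> O[K](G)"
  proof -
    have "U y - (p0 + q1 * Y y + q2 * Y y ^ 2 + q3 * Y y ^ 3 + q4 * Y y ^ 4 + (c - p1 * C / a) * (X y ^ 4 * l y))
      = (U y - (p0 + p1 * X y + p2 * X y ^ 2 + p3 * X y ^ 3 + p4 * X y ^ 4 + c * (X y ^ 4 * l y)))
        - (E y * q1 + (Y y ^ 2 - (a^2 * X y ^ 2 + 2*a*a2 * X y ^ 3 + (2*a*a3 + a2^2) * X y ^ 4)) * q2
           + (Y y ^ 3 - (a^3 * X y ^ 3 + 3*a^2*a2 * X y ^ 4)) * q3 + (Y y ^ 4 - a^4 * X y ^ 4) * q4)" for y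
      unfolding pq(5) unfolding pq(1-4) E_def by algebra
    then show ?thesis by (simp only:) (intro G_add G_mult U E Y2 Y3 Y4 B)
  qed
  then show "\<exists>q2 q3 q4. (\<lambda>y. U y - (p0 + p1 / a * Y y + q2 * Y y ^ 2 + q3 * Y y ^ 3 + q4 * Y y ^ 4
            + (c - p1 * C / a) * (X y ^ 4 * l y))) \<in> O[K](G)"
    unfolding q1_def by blast
  have "(\<lambda>y. X y ^ 4 * l y - (Y y / a) ^ 4 * l y) = (\<lambda>y. ((Y y ^ 4 - a^4 * X y ^ 4) * l y) * (- 1 / a^4))"
    using a by (intro ext) (simp add: field_simps)
  then show "(\<lambda>y. X y ^ 4 * l y - (Y y / a) ^ 4 * l y) \<in> O[K](G)"
    by (simp only:) (intro G_mult Y4l B)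
qed

end

text \<open>A holomorphic H that is not identically zero is w^n k(w) with k(0) \<noteq> 0, so its
  quotient by s^4 ln s has the size of s^(n - 4) / |ln s|. This tends to infinity for n < 4 and to 0
  for n \<ge> 4, never to a finite nonzero limit.\<close>

lemma log_coefficient_not_analytic:
  fixes H :: "complex \<Rightarrow> complex"
  assumes H: "H holomorphic_on ball 0 d" "0 < d" and \<kappa>: "\<kappa> \<noteq> 0"
    and lim: "((\<lambda>s. H (of_real s) / of_real (s ^ 4 * ln s)) \<longlongrightarrow> \<kappa>) (at_right 0)"
  shows False
proof -
  have "\<exists>k n e. 0 < e \<and> k holomorphic_on ball 0 e \<and> (\<forall>w\<in>ball 0 e. H w = w ^ n * k w) \<and> k 0 \<noteq> 0"
  proof (cases "H 0 = 0")
    case True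
    have "\<not> H constant_on ball 0 d"
    proof
      assume "H constant_on ball 0 d"
      then have z: "H w = 0" if "w \<in> ball 0 d" for w
        using True H(2) that unfolding constant_on_def by (metis centre_in_ball)
      have "eventually (\<lambda>s::real. s \<in> {0<..<d}) (at_right 0)" using H(2) by (intro eventually_at_right_real)
      then have "eventually (\<lambda>s::real. H (of_real s) / of_real (s ^ 4 * ln s) = 0) (at_right 0)"
        by eventually_elim (simp add: z)
      then have "((\<lambda>s::real. H (of_real s) / of_real (s ^ 4 * ln s)) \<longlongrightarrow> 0) (at_right 0)"
        by (rule tendsto_eventually)
      then show False using tendsto_unique[OF _ lim] \<kappa> by simp
    qed
    then obtain k r n where "0 < r" "k holomorphic_on ball 0 r"
      "\<And>w. w \<in> ball 0 r \<Longrightarrow> H w = (w - 0) ^ n * k w" "\<And>w. w \<in> ball 0 r \<Longrightarrow> k w \<noteq> 0"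
      using holomorphic_factor_zero_nonconstant[OF H(1) open_ball connected_ball _ True] H(2) by (metis centre_in_ball)
    then show ?thesis by (intro exI[of _ k] exI[of _ n] exI[of _ r]) auto
  next
    case False
    then show ?thesis using H by (intro exI[of _ H] exI[of _ 0] exI[of _ d]) auto
  qed
  then obtain k n e where k: "0 < e" "k holomorphic_on ball 0 e" "\<And>w. w \<in> ball 0 e \<Longrightarrow> H w = w ^ n * k w" "k 0 \<noteq> 0"
    by blast
  have "isCont k 0" using k by (intro holomorphic_on_imp_continuous_on[THEN continuous_on_interior, of _ "ball 0 e"]) auto
  moreover have "((\<lambda>s::real. complex_of_real s) \<longlongrightarrow> of_real 0) (at_right 0)" by (intro tendsto_intros)
  ultimately have "((\<lambda>s::real. k (of_real s)) \<longlongrightarrow> k 0) (at_right 0)"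
    by (intro isCont_tendsto_compose[of 0 k]) auto
  then have "((\<lambda>s. norm (H (of_real s) / of_real (s ^ 4 * ln s) / k (of_real s))) \<longlongrightarrow> norm (\<kappa> / k 0)) (at_right 0)"
    using lim k(4) by (intro tendsto_intros)
  moreover have "eventually (\<lambda>s. norm (H (of_real s) / of_real (s ^ 4 * ln s) / k (of_real s)) = s ^ n / (s ^ 4 * \<bar>ln s\<bar>)) (at_right 0)"
  proof -
    have "eventually (\<lambda>s. k (of_real s) \<noteq> 0) (at_right (0::real))"
      using \<open>((\<lambda>s::real. k (of_real s)) \<longlongrightarrow> k 0) (at_right 0)\<close> k(4) by (rule tendsto_imp_eventually_ne)
    moreover have "eventually (\<lambda>s::real. s \<in> {0<..<e}) (at_right 0)" using k(1) by (intro eventually_at_right_real)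
    ultimately show ?thesis
    proof eventually_elim
      case (elim s)
      then have "norm (H (of_real s) / of_real (s ^ 4 * ln s) / k (of_real s)) = norm (complex_of_real s ^ n / of_real (s ^ 4 * ln s))"
        by (simp add: k(3))
      also have "\<dots> = s ^ n / (s ^ 4 * \<bar>ln s\<bar>)"
        using elim unfolding norm_divide norm_power norm_of_real by (simp add: abs_mult)
      finally show ?case .
    qed
  qed
  ultimately have lim2: "((\<lambda>s. s ^ n / (s ^ 4 * \<bar>ln s\<bar>)) \<longlongrightarrow> norm (\<kappa> / k 0)) (at_right 0)"
    by (rule Lim_transform_eventually)
  show False
  proof (cases "n < 4")
    case True
    have "filterlim (\<lambda>s::real. 1 / (s ^ 4 * \<bar>ln s\<bar>)) at_top (at_right 0)"
      "filterlim (\<lambda>s::real. s / (s ^ 4 * \<bar>ln s\<bar>)) at_top (at_right 0)"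
      "filterlim (\<lambda>s::real. s ^ 2 / (s ^ 4 * \<bar>ln s\<bar>)) at_top (at_right 0)"
      "filterlim (\<lambda>s::real. s ^ 3 / (s ^ 4 * \<bar>ln s\<bar>)) at_top (at_right 0)"
      by real_asymp+
    moreover have "n = 0 \<or> n = 1 \<or> n = 2 \<or> n = 3" using True by auto
    ultimately have "filterlim (\<lambda>s::real. s ^ n / (s ^ 4 * \<bar>ln s\<bar>)) at_top (at_right 0)" by auto
    then have "filterlim (\<lambda>s::real. s ^ n / (s ^ 4 * \<bar>ln s\<bar>)) at_infinity (at_right 0)"
      by (rule filterlim_at_top_imp_at_infinity)
    then show False using not_tendsto_and_filterlim_at_infinity[OF _ lim2] by simp
  next
    case False
    have "((\<lambda>s::real. s ^ n / (s ^ 4 * \<bar>ln s\<bar>)) \<longlongrightarrow> 0) (at_right 0)"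
    proof (rule Lim_null_comparison)
      show "((\<lambda>s::real. 1 / \<bar>ln s\<bar>) \<longlongrightarrow> 0) (at_right 0)" by real_asymp
      have "eventually (\<lambda>s::real. s \<in> {0<..<1}) (at_right 0)" by (intro eventually_at_right_real) auto
      then show "eventually (\<lambda>s::real. norm (s ^ n / (s ^ 4 * \<bar>ln s\<bar>)) \<le> 1 / \<bar>ln s\<bar>) (at_right 0)"
      proof eventually_elim
        case (elim s)
        have "s ^ n \<le> s ^ 4" using elim False by (intro power_decreasing) auto
        then have "s ^ n / s ^ 4 \<le> 1" using elim by simp
        then have le: "s ^ n / s ^ 4 / \<bar>ln s\<bar> \<le> 1 / \<bar>ln s\<bar>" by (intro divide_right_mono) auto
        have "\<bar>s\<bar> = s" using elim by simp
        then have "norm (s ^ n / (s ^ 4 * \<bar>ln s\<bar>)) = s ^ n / s ^ 4 / \<bar>ln s\<bar>"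
          by (simp only: real_norm_def abs_divide abs_mult abs_abs power_abs divide_divide_eq_left)
        with le show ?case by (simp only:)
      qed
    qed
    then have "norm (\<kappa> / k 0) = 0" using tendsto_unique[OF _ lim2] by simp
    then show False using \<kappa> k(4) by simp
  qed
qed

section \<open>The expansion of S at \<sigma> in the local coordinate Y\<close>

abbreviation (input) "Y y \<equiv> 1 - y / complex_of_real \<sigma>"
definition X :: "complex \<Rightarrow> complex" where "X y = 1 - Z (y / of_real \<sigma>)"
abbreviation (input) "K \<equiv> at (complex_of_real \<sigma>) within \<Delta>"

lemma \<Delta>_facts:
  assumes y: "y \<in> \<Delta>"
  shows "X y \<noteq> 0" "Y y \<noteq> 0" "norm (X y) \<le> 10 * norm (Y y)" "1 - X y \<in> W"
    and "Re (Y y) > - 1/10 * norm (Y y)" "Y y = 1 - (1 - X y) * (S_cont y / of_real F\<^sub>0)\<^sup>2" "S_cont y = \<Phi> (1 - X y)"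
proof -
  define \<eta> where "\<eta> = y / complex_of_real \<sigma>"
  have \<eta>: "\<eta> \<in> D" using y by (simp add: Delta_iff \<eta>_def)
  note Z = Z_in[OF \<eta>]
  have c: "Z \<eta> \<in> cOm" using Z Om_subset by auto
  show "X y \<noteq> 0" using Z by (auto simp: X_def Om_def \<eta>_def)
  show "Y y \<noteq> 0" using \<eta> by (auto simp: D_def \<eta>_def)
  show "norm (X y) \<le> 10 * norm (Y y)"
    using \<Psi>_minus_one_ge[OF c] unfolding \<Psi>_Z[OF \<eta>] by (simp add: X_def \<eta>_def norm_minus_commute)
  show "1 - X y \<in> W" using c by (simp add: X_def \<eta>_def cOm_def)
  show "Re (Y y) > - 1/10 * norm (Y y)" using \<eta> by (simp add: D_def \<eta>_def norm_minus_commute)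
  show S_cont: "S_cont y = \<Phi> (1 - X y)" by (simp add: S_cont_def X_def)
  have "(1 - X y) * (S_cont y / of_real F\<^sub>0)\<^sup>2 = \<Psi> (Z \<eta>)" unfolding S_cont by (simp add: \<Psi>_def X_def \<eta>_def)
  then show "Y y = 1 - (1 - X y) * (S_cont y / of_real F\<^sub>0)\<^sup>2" unfolding \<Psi>_Z[OF \<eta>] by (simp add: \<eta>_def)
qed

lemma eventually_K: "eventually (\<lambda>y. y \<in> \<Delta>) K"
  by (simp add: eventually_at_filter)

lemma Y_tendsto: "(Y \<longlongrightarrow> 0) K"
  using \<sigma>_pos by (auto intro!: tendsto_eq_intros)

lemma X_bigo_Y: "X \<in> O[K](Y)"
  using eventually_K \<Delta>_facts(3) by (intro bigoI[of _ 10]) (auto elim!: eventually_mono)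

lemma X_tendsto: "(X \<longlongrightarrow> 0) K"
proof (rule Lim_null_comparison)
  show "eventually (\<lambda>y. norm (X y) \<le> 10 * norm (Y y)) K"
    using eventually_K by eventually_elim (rule \<Delta>_facts(3))
  show "((\<lambda>y. 10 * norm (Y y)) \<longlongrightarrow> 0) K"
    using tendsto_mult_right_zero[OF tendsto_norm_zero[OF Y_tendsto]] by simp
qed

lemma eventually_norm_less: "(f \<longlongrightarrow> 0) K \<Longrightarrow> 0 < e \<Longrightarrow> eventually (\<lambda>y. norm (f y) < e) K" for f :: "complex \<Rightarrow> complex"
  using order_tendstoD(2)[OF tendsto_norm_zero] by blast

lemma bigo_tendsto_zero:
  fixes f h :: "'a \<Rightarrow> complex"
  assumes "f \<in> O[L](h)" "(h \<longlongrightarrow> 0) L" shows "(f \<longlongrightarrow> 0) L"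
proof -
  obtain c where c: "eventually (\<lambda>x. norm (f x) \<le> c * norm (h x)) L"
    using assms(1) by (auto elim!: landau_o.bigE)
  show ?thesis
    by (rule Lim_null_comparison[OF c tendsto_mult_right_zero[OF tendsto_norm_zero[OF assms(2)]]])
qed

lemma norm_mult_Ln_le:
  assumes "0 < norm z" "norm z \<le> 1" shows "norm z * norm (Ln z) \<le> 1 + pi"
proof -
  have "norm z * \<bar>ln (norm z)\<bar> \<le> 1"
  proof -
    have "ln (1 / norm z) \<le> 1 / norm z - 1" using assms by (intro ln_le_minus_one) auto
    then have "- ln (norm z) \<le> 1 / norm z - 1" using assms by (simp add: ln_div)
    then have "norm z * (- ln (norm z)) \<le> norm z * (1 / norm z - 1)" by (intro mult_left_mono) auto
    also have "\<dots> \<le> 1" using assms by (simp add: algebra_simps)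
    finally show ?thesis using assms by simp
  qed
  moreover have "norm (Ln z) \<le> \<bar>ln (norm z)\<bar> + pi"
    using cmod_le[of "Ln z"] assms mpi_less_Im_Ln[of z] Im_Ln_le_pi[of z] by (auto simp: Re_Ln)
  then have "norm z * norm (Ln z) \<le> norm z * \<bar>ln (norm z)\<bar> + norm z * pi"
    by (metis distrib_left mult_left_mono norm_ge_zero)
  moreover have "norm z * pi \<le> 1 * pi" using assms by (intro mult_right_mono) auto
  ultimately show ?thesis by linarith
qed

interpretation gauge: log_gauge K X "\<lambda>y. Ln (X y)"
proof
  show "X \<in> O[K](\<lambda>_. 1)"
    using eventually_norm_less[OF X_tendsto, of 1] by (intro bigoI[of _ 1]) (auto elim!: eventually_mono)
  show "(\<lambda>y. X y * Ln (X y)) \<in> O[K](\<lambda>_. 1)"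
  proof (rule bigoI)
    show "eventually (\<lambda>y. norm (X y * Ln (X y)) \<le> (1 + pi) * norm (1 :: complex)) K"
      using eventually_norm_less[OF X_tendsto zero_less_one] eventually_K
      by eventually_elim (use norm_mult_Ln_le \<Delta>_facts(1) in \<open>auto simp: norm_mult\<close>)
  qed
qed

abbreviation (input) R :: "complex \<Rightarrow> complex" where
  "R y \<equiv> Y y ^ 5 * of_real (1 + norm (Ln (Y y)))"

lemma A_pos: "1 \<le> A"
  using J2_nonneg F0_bounds by (simp add: A_eq)

text \<open>Here the constant A enters: squaring with p0 = \<open>F\<^sub>0\<close>, p1 = -J2, c =
  -1/pi gives the linear coefficient 1 + 2 J2 / \<open>F\<^sub>0\<close> = A and the logarithmic
  coefficient 2 / (pi \<open>F\<^sub>0\<close>).\<close>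

lemma Y_expansion:
  obtains p2 p3 p4 a2 a3 a4 where
    "(\<lambda>y. S_cont y - (of_real F\<^sub>0 + (- of_real J2) * X y + p2 * X y ^ 2 + p3 * X y ^ 3 + p4 * X y ^ 4
        + (- (1 / of_real pi)) * (X y ^ 4 * Ln (X y)))) \<in> O[K](gauge.G)"
    "(\<lambda>y. Y y - (of_real A * X y + a2 * X y ^ 2 + a3 * X y ^ 3 + a4 * X y ^ 4
        + (2 / (of_real pi * of_real F\<^sub>0)) * (X y ^ 4 * Ln (X y)))) \<in> O[K](gauge.G)"
proof -
  obtain p2 p3 p4 where p: "\<And>x. x \<in> W \<Longrightarrow> x \<noteq> 1 \<Longrightarrow> norm (1 - x) \<le> 1/2 \<Longrightarrow>
      norm (\<Phi> x - (of_real F\<^sub>0 + (- of_real J2) * (1 - x) + p2 * (1 - x)\<^sup>2 + p3 * (1 - x) ^ 3 + p4 * (1 - x) ^ 4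
        + (- (1 / of_real pi)) * ((1 - x) ^ 4 * Ln (1 - x)))) \<le> 9 * norm (1 - x) ^ 5 * norm (Ln (1 - x))"
    using Phi_expansion by blast
  have U: "(\<lambda>y. S_cont y - (of_real F\<^sub>0 + (- of_real J2) * X y + p2 * X y ^ 2 + p3 * X y ^ 3 + p4 * X y ^ 4
        + (- (1 / of_real pi)) * (X y ^ 4 * Ln (X y)))) \<in> O[K](gauge.G)"
  proof (rule bigoI[of _ 9])
    have "0 < (1/2 :: real)" by simp
    from eventually_norm_less[OF X_tendsto this] eventually_K
    show "eventually (\<lambda>y. norm (S_cont y - (of_real F\<^sub>0 + (- of_real J2) * X y + p2 * X y ^ 2 + p3 * X y ^ 3 + p4 * X y ^ 4
        + (- (1 / of_real pi)) * (X y ^ 4 * Ln (X y)))) \<le> 9 * norm (gauge.G y)) K"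
    proof eventually_elim
      case (elim y)
      have "norm (S_cont y - (of_real F\<^sub>0 + (- of_real J2) * X y + p2 * X y ^ 2 + p3 * X y ^ 3 + p4 * X y ^ 4
        + (- (1 / of_real pi)) * (X y ^ 4 * Ln (X y)))) \<le> 9 * norm (X y) ^ 5 * norm (Ln (X y))"
        using p[of "1 - X y"] \<Delta>_facts[OF elim(2)] elim(1) by simp
      also have "\<dots> \<le> 9 * norm (X y) ^ 5 * (1 + norm (Ln (X y)))" by (intro mult_left_mono) auto
      finally show ?case by (simp only: gauge.norm_G mult.assoc)
    qed
  qed
  have F0: "complex_of_real F\<^sub>0 \<noteq> 0" using F0_bounds by simp
  obtain a2 a3 a4 where "(\<lambda>y. 1 - (1 - X y) * (S_cont y / of_real F\<^sub>0) ^ 2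
     - ((1 - 2 * (- of_real J2) / of_real F\<^sub>0) * X y + a2 * X y ^ 2 + a3 * X y ^ 3 + a4 * X y ^ 4
       + (- 2 * (- (1 / of_real pi)) / of_real F\<^sub>0) * (X y ^ 4 * Ln (X y)))) \<in> O[K](gauge.G)"
    using gauge.expansion_square[OF U F0] by blast
  also have "?this \<longleftrightarrow> (\<lambda>y. Y y - (of_real A * X y + a2 * X y ^ 2 + a3 * X y ^ 3 + a4 * X y ^ 4
        + (2 / (of_real pi * of_real F\<^sub>0)) * (X y ^ 4 * Ln (X y)))) \<in> O[K](gauge.G)"
  proof (rule landau_o.big.in_cong)
    show "eventually (\<lambda>y. 1 - (1 - X y) * (S_cont y / of_real F\<^sub>0) ^ 2
     - ((1 - 2 * (- of_real J2) / of_real F\<^sub>0) * X y + a2 * X y ^ 2 + a3 * X y ^ 3 + a4 * X y ^ 4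
       + (- 2 * (- (1 / of_real pi)) / of_real F\<^sub>0) * (X y ^ 4 * Ln (X y)))
      = Y y - (of_real A * X y + a2 * X y ^ 2 + a3 * X y ^ 3 + a4 * X y ^ 4
        + (2 / (of_real pi * of_real F\<^sub>0)) * (X y ^ 4 * Ln (X y)))) K"
      using eventually_K
    proof eventually_elim
      case (elim y)
      have "1 - 2 * (- of_real J2) / of_real F\<^sub>0 = complex_of_real A" by (simp add: A_eq)
      moreover have "- 2 * (- (1 / of_real pi)) / of_real F\<^sub>0 = 2 / (of_real pi * complex_of_real F\<^sub>0)" by simp
      ultimately show ?case using \<Delta>_facts(6)[OF elim] by (simp only:)
    qed
  qed
  finally show ?thesis using that U by blast
qed

definition q :: "complex \<Rightarrow> complex" where "q y = of_real A * X y / Y y"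

lemma q_minus_one: "(\<lambda>y. q y - 1) \<in> O[K](Y)"
proof -
  obtain a2 a3 a4 C where Y: "(\<lambda>y. Y y - (of_real A * X y + a2 * X y ^ 2 + a3 * X y ^ 3 + a4 * X y ^ 4 + C * (X y ^ 4 * Ln (X y)))) \<in> O[K](gauge.G)"
    using Y_expansion by blast
  define m where "m y = X y * Ln (X y)" for y
  have m: "m \<in> O[K](\<lambda>_. 1)" using gauge.Xl by (simp add: m_def[abs_def])
  have "(\<lambda>y. X y ^ 2 * (a2 + a3 * X y + a4 * X y ^ 2 + C * (X y * m y))) \<in> O[K](\<lambda>y. X y ^ 2 * 1)"
    by (rule landau_o.big.mult) (simp, intro bigo_1_intros gauge.X m)
  then have "(\<lambda>y. X y ^ 2 * (a2 + a3 * X y + a4 * X y ^ 2 + C * (X y * m y))) \<in> O[K](\<lambda>y. X y ^ 2)" by simp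
  from sum_in_bigo(1)[OF landau_o.big_trans[OF Y gauge.G_bigo_X2] this]
  have "(\<lambda>y. Y y - of_real A * X y) \<in> O[K](\<lambda>y. X y ^ 2)"
    by (rule back_subst[of "\<lambda>f. f \<in> O[K](\<lambda>y. X y ^ 2)"]) (simp add: m_def fun_eq_iff eval_nat_numeral algebra_simps)
  also have "(\<lambda>y. X y ^ 2) \<in> O[K](\<lambda>y. Y y ^ 2)" by (rule landau_o.big_power[OF X_bigo_Y])
  finally obtain c where c: "eventually (\<lambda>y. norm (Y y - of_real A * X y) \<le> c * norm (Y y ^ 2)) K"
    by (auto elim!: landau_o.bigE)
  show ?thesis
  proof (rule bigoI)
    show "eventually (\<lambda>y. norm (q y - 1) \<le> c * norm (Y y)) K"
      using c eventually_K
    proof eventually_elim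
      case (elim y)
      define v where "v = Y y"
      have v: "v \<noteq> 0" using \<Delta>_facts(2)[OF elim(2)] by (simp add: v_def)
      have "q y = of_real A * X y / v" by (simp only: q_def v_def)
      then have "q y - 1 = - ((v - of_real A * X y) / v)" using v by (simp add: field_simps)
      then have "norm (q y - 1) = norm (v - of_real A * X y) / norm v" by (simp add: norm_divide)
      also have "\<dots> \<le> c * norm (v ^ 2) / norm v" using elim(1) by (intro divide_right_mono) (auto simp: v_def)
      also have "\<dots> = c * norm v" using v by (simp add: norm_power norm_mult power2_eq_square)
      finally show ?case by (simp only: v_def)
    qed
  qed
qed

text \<open>A X = Y q with q - 1 = O(Y). Inside \<Delta> the argument of Y stays below arccos(-1/10)
  = pi - \<delta>, and that of q is eventually below \<delta>, so the logarithm of the product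
  splits without a multiple of 2 pi i.\<close>

lemma Ln_X:
  "(\<lambda>y. Ln (X y) - (Ln (Y y) - of_real (ln A))) \<in> O[K](Y)"
proof -
  have q0: "((\<lambda>y. q y - 1) \<longlongrightarrow> 0) K"
    using q_minus_one Y_tendsto by (rule bigo_tendsto_zero)
  define \<delta> where "\<delta> = pi - arccos (- 1/10)"
  have \<delta>: "0 < \<delta>" using arccos_less_arccos[of "-1" "-1/10"] by (simp add: \<delta>_def)
  have "(\<lambda>y. Ln (X y) - (Ln (Y y) - of_real (ln A))) \<in> O[K](\<lambda>y. q y - 1)"
  proof (rule bigoI[of _ 2])
    have "0 < min (1/2) (\<delta> / 2)" using \<delta> by simp
    from eventually_norm_less[OF q0 this] eventually_K
    show "eventually (\<lambda>y. norm (Ln (X y) - (Ln (Y y) - of_real (ln A))) \<le> 2 * norm (q y - 1)) K"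
    proof eventually_elim
      case (elim y)
      note f = \<Delta>_facts[OF elim(2)]
      have A0: "0 < A" using A_pos by simp
      have qn: "q y \<noteq> 0" using f A0 by (simp add: q_def)
      have lq: "norm (Ln (q y)) \<le> 2 * norm (q y - 1)" using norm_Ln_le[of "q y - 1"] elim by simp
      then have im: "\<bar>Im (Ln (q y))\<bar> < \<delta>" using abs_Im_le_cmod[of "Ln (q y)"] elim by simp
      have "\<bar>Arg (Y y)\<bar> < arccos (- 1/10)"
      proof -
        have "cos \<bar>Arg (Y y)\<bar> > cos (arccos (- 1/10))"
          using f(2,5) by (simp add: cos_Arg pos_less_divide_eq)
        then show ?thesis using Arg_bounded[of "Y y"] arccos_bounded[of "-1/10"]
          by (subst (asm) cos_mono_less_eq) auto
      qed
      then have imY: "\<bar>Im (Ln (Y y))\<bar> < pi - \<delta>" using f(2) by (simp add: Arg_eq_Im_Ln \<delta>_def)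
      have "of_real A * X y = Y y * q y" using f by (simp add: q_def)
      then have "Ln (of_real A * X y) = Ln (Y y * q y)" by simp
      also have "\<dots> = Ln (Y y) + Ln (q y)" using Ln_times[OF f(2) qn] im imY by auto
      also have "Ln (of_real A * X y) = of_real (ln A) + Ln (X y)"
        using Ln_times_of_real[OF A0 f(1)] A0 by (simp add: Ln_of_real)
      finally show ?case using lq by (simp add: algebra_simps)
    qed
  qed
  then show ?thesis using q_minus_one by (rule landau_o.big_trans)
qed

text \<open>Errors measured in X become errors in Y: |X| \<le> 10 |Y| accounts for 10^5, and Ln X -
  Ln Y stays bounded.\<close>

lemma gauge_bigo_R: "gauge.G \<in> O[K](R)"
proof (rule bigoI)
  have t: "((\<lambda>y. Ln (X y) - (Ln (Y y) - of_real (ln A))) \<longlongrightarrow> 0) K" using Ln_X Y_tendsto by (rule bigo_tendsto_zero)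
  show "eventually (\<lambda>y. norm (gauge.G y) \<le> 10 ^ 5 * (2 + \<bar>ln A\<bar>) * norm (R y)) K"
    using eventually_norm_less[OF t zero_less_one] eventually_K
  proof eventually_elim
    case (elim y)
    have "norm (Ln (X y)) \<le> norm (Ln (X y) - (Ln (Y y) - of_real (ln A))) + (norm (Ln (Y y)) + \<bar>ln A\<bar>)"
      using norm_triangle_ineq[of "Ln (X y) - (Ln (Y y) - of_real (ln A))" "Ln (Y y) - of_real (ln A)"]
        norm_triangle_ineq4[of "Ln (Y y)" "of_real (ln A)"] by simp
    then have "1 + norm (Ln (X y)) \<le> (2 + \<bar>ln A\<bar>) + norm (Ln (Y y))" using elim by simp
    also have "\<dots> \<le> (2 + \<bar>ln A\<bar>) * (1 + norm (Ln (Y y)))" by (simp add: algebra_simps)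
    finally have "norm (X y) ^ 5 * (1 + norm (Ln (X y))) \<le> (10 * norm (Y y)) ^ 5 * ((2 + \<bar>ln A\<bar>) * (1 + norm (Ln (Y y))))"
      using \<Delta>_facts(3)[OF elim(2)] by (intro mult_mono power_mono) auto
    also have "\<dots> = 10 ^ 5 * (2 + \<bar>ln A\<bar>) * (norm (Y y) ^ 5 * (1 + norm (Ln (Y y))))" by (simp only: power_mult_distrib mult_ac)
    also have "norm (Y y) ^ 5 * (1 + norm (Ln (Y y))) = norm (R y)"
      unfolding norm_mult norm_power norm_of_real by simp
    finally show ?case by (simp only: gauge.norm_G)
  qed
qed

text \<open>The logarithm of \<Phi> itself and the one created by solving for X combine to c
  (\<open>F\<^sub>0\<close> A - 2 J2) / (\<open>F\<^sub>0\<close> A) = c / A, since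
  \<open>F\<^sub>0\<close> A = \<open>F\<^sub>0\<close> + 2 J2. Replacing X^4 by (Y / A)^4
  contributes the remaining A^-4.\<close>

lemma S_cont_expansion:
  obtains Q :: "complex poly" where "degree Q \<le> 4"
    "(\<lambda>y. S_cont y - (poly Q (Y y) - 1 / of_real (pi * A ^ 5) * Y y ^ 4 * Ln (Y y))) \<in> O[K](R)"
proof -
  define c where "c = - (1 / complex_of_real pi)"
  define p1 where "p1 = - complex_of_real J2"
  define C where "C = 2 / (of_real pi * complex_of_real F\<^sub>0)"
  define a where "a = complex_of_real A"
  have a0: "a \<noteq> 0" using A_pos by (simp add: a_def)
  obtain p2 p3 p4 a2 a3 a4 where
    U: "(\<lambda>y. S_cont y - (of_real F\<^sub>0 + p1 * X y + p2 * X y ^ 2 + p3 * X y ^ 3 + p4 * X y ^ 4 + c * (X y ^ 4 * Ln (X y)))) \<in> O[K](gauge.G)" and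
    Y: "(\<lambda>y. Y y - (a * X y + a2 * X y ^ 2 + a3 * X y ^ 3 + a4 * X y ^ 4 + C * (X y ^ 4 * Ln (X y)))) \<in> O[K](gauge.G)"
    by (rule Y_expansion[folded c_def p1_def C_def a_def])
  obtain q2 q3 q4 where q: "(\<lambda>y. S_cont y - (of_real F\<^sub>0 + p1 / a * Y y + q2 * Y y ^ 2 + q3 * Y y ^ 3 + q4 * Y y ^ 4
            + (c - p1 * C / a) * (X y ^ 4 * Ln (X y)))) \<in> O[K](gauge.G)"
    using gauge.singular_inversion(1)[OF U Y a0] by blast
  have L: "(\<lambda>y. X y ^ 4 * Ln (X y) - (Y y / a) ^ 4 * Ln (X y)) \<in> O[K](gauge.G)"
    by (rule gauge.singular_inversion(2)[OF U Y a0])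
  have F0: "F\<^sub>0 \<noteq> 0" using F0_bounds by simp
  have "c - p1 * C / a = c * ((F\<^sub>0 * A - 2 * J2) / (F\<^sub>0 * A))"
    using a0 F0 by (simp add: c_def p1_def C_def a_def field_simps)
  also have "F\<^sub>0 * A - 2 * J2 = F\<^sub>0" using F0 by (simp add: A_eq field_simps)
  finally have coeff: "c - p1 * C / a = c / a" using F0 by (simp add: a_def)
  \<comment> \<open>Passing from Ln X to Ln Y - ln A produces a multiple of Y^4, which is absorbed
    in the quartic coefficient.\<close>
  define q4' where "q4' = q4 - c / a ^ 5 * of_real (ln A)"
  define Q where "Q = [:of_real F\<^sub>0, p1 / a, q2, q3, q4':]"
  show ?thesis
  proof (rule that[of Q])
    show "degree Q \<le> 4" by (simp add: Q_def)
    have "(\<lambda>y. Y y ^ 4 * (Ln (X y) - (Ln (Y y) - of_real (ln A)))) \<in> O[K](\<lambda>y. Y y ^ 4 * Y y)"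
      by (rule landau_o.big.mult[OF landau_o.big_refl Ln_X])
    also have "(\<lambda>y. Y y ^ 4 * Y y) \<in> O[K](R)"
    proof (intro bigoI[of _ 1] always_eventually allI)
      fix y
      define v where "v = Y y"
      have "norm (v ^ 4 * v) = norm v ^ 5 * 1" by (simp add: norm_mult norm_power eval_nat_numeral)
      also have "\<dots> \<le> norm v ^ 5 * (1 + norm (Ln v))" by (intro mult_left_mono) auto
      also have "\<dots> = 1 * norm (v ^ 5 * of_real (1 + norm (Ln v)))"
        unfolding norm_mult norm_power norm_of_real by simp
      finally show "norm (Y y ^ 4 * Y y) \<le> 1 * norm (R y)" by (simp only: v_def)
    qed
    finally have E: "(\<lambda>y. Y y ^ 4 * (Ln (X y) - (Ln (Y y) - of_real (ln A)))) \<in> O[K](R)" .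
    have "(\<lambda>y. (S_cont y - (of_real F\<^sub>0 + p1 / a * Y y + q2 * Y y ^ 2 + q3 * Y y ^ 3 + q4 * Y y ^ 4
            + (c / a) * (X y ^ 4 * Ln (X y)))) + (c / a) * (X y ^ 4 * Ln (X y) - (Y y / a) ^ 4 * Ln (X y))
           + (c / a ^ 5) * (Y y ^ 4 * (Ln (X y) - (Ln (Y y) - of_real (ln A))))) \<in> O[K](R)"
      using landau_o.big_trans[OF q gauge_bigo_R] landau_o.big_trans[OF L gauge_bigo_R] E unfolding coeff
      by (intro sum_in_bigo(1) landau_o.big.cmult_in_iff[THEN iffD2] disjI2)
        (auto simp: c_def a0)
    also have "(\<lambda>y. (S_cont y - (of_real F\<^sub>0 + p1 / a * Y y + q2 * Y y ^ 2 + q3 * Y y ^ 3 + q4 * Y y ^ 4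
            + (c / a) * (X y ^ 4 * Ln (X y)))) + (c / a) * (X y ^ 4 * Ln (X y) - (Y y / a) ^ 4 * Ln (X y))
           + (c / a ^ 5) * (Y y ^ 4 * (Ln (X y) - (Ln (Y y) - of_real (ln A)))))
       = (\<lambda>y. S_cont y - (poly Q (Y y) - 1 / of_real (pi * A ^ 5) * Y y ^ 4 * Ln (Y y)))"
    proof
      fix y
      define v where "v = Y y"
      have "1 / of_real (pi * A ^ 5) = - (c / a ^ 5)" by (simp add: c_def a_def)
      moreover have "(c / a) * ((v / a) ^ 4 * Ln (X y)) = c / a ^ 5 * (v ^ 4 * Ln (X y))"
        by (simp add: power_divide eval_nat_numeral)
      moreover have "poly Q v = of_real F\<^sub>0 + p1 / a * v + q2 * v ^ 2 + q3 * v ^ 3 + q4 * v ^ 4 - c / a ^ 5 * (v ^ 4 * of_real (ln A))"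
        by (simp add: Q_def q4'_def eval_nat_numeral algebra_simps)
      ultimately show "(S_cont y - (of_real F\<^sub>0 + p1 / a * Y y + q2 * Y y ^ 2 + q3 * Y y ^ 3 + q4 * Y y ^ 4
            + (c / a) * (X y ^ 4 * Ln (X y)))) + (c / a) * (X y ^ 4 * Ln (X y) - (Y y / a) ^ 4 * Ln (X y))
           + (c / a ^ 5) * (Y y ^ 4 * (Ln (X y) - (Ln (Y y) - of_real (ln A))))
        = S_cont y - (poly Q (Y y) - 1 / of_real (pi * A ^ 5) * Y y ^ 4 * Ln (Y y))"
        unfolding v_def[symmetric] right_diff_distrib by (simp add: algebra_simps)
    qed
    finally show "(\<lambda>y. S_cont y - (poly Q (Y y) - 1 / of_real (pi * A ^ 5) * Y y ^ 4 * Ln (Y y))) \<in> O[K](R)" .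
  qed
qed

text \<open>Along the radius \<sigma> (1 - s) the continuation h agrees with S, so the analytic
  function poly Q - h is asymptotic to \<kappa> s^4 ln s with \<kappa> = 1 / (pi A^5) \<noteq> 0,
  which \<open>log_coefficient_not_analytic\<close> forbids.\<close>

lemma no_continuation_at_\<sigma>:
  assumes r: "0 < r" and h: "h holomorphic_on ball (of_real \<sigma>) r"
    and agree: "\<And>y. y \<in> ball (of_real \<sigma>) r \<Longrightarrow> norm y < \<sigma> \<Longrightarrow> h y = S_cont y"
  shows False
proof -
  obtain Q where Q: "(\<lambda>y. S_cont y - (poly Q (Y y) - 1 / of_real (pi * A ^ 5) * Y y ^ 4 * Ln (Y y))) \<in> O[K](R)"
    using S_cont_expansion by blast
  define \<kappa> where "\<kappa> = 1 / complex_of_real (pi * A ^ 5)"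
  have \<kappa>: "\<kappa> \<noteq> 0" using A_pos by (simp add: \<kappa>_def)
  define \<gamma> where "\<gamma> s = complex_of_real \<sigma> * (1 - of_real s)" for s
  have Y\<gamma>: "Y (\<gamma> s) = of_real s" for s using \<sigma>_pos by (simp add: \<gamma>_def)
  have small: "eventually (\<lambda>s::real. s \<in> {0<..<min 1 (r / \<sigma>)}) (at_right 0)"
    using r \<sigma>_pos by (intro eventually_at_right_real) auto
  have norm\<gamma>: "norm (\<gamma> s) < \<sigma>" "\<gamma> s \<in> ball (of_real \<sigma>) r" "\<gamma> s \<noteq> of_real \<sigma>" if "s \<in> {0<..<min 1 (r / \<sigma>)}" for s
  proof -
    have "\<gamma> s = of_real (\<sigma> * (1 - s))" "of_real \<sigma> - \<gamma> s = of_real (\<sigma> * s)" by (simp_all add: \<gamma>_def algebra_simps)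
    then have n: "norm (\<gamma> s) = \<sigma> * (1 - s)" "norm (of_real \<sigma> - \<gamma> s) = \<sigma> * s"
      using that \<sigma>_pos by (simp_all only: norm_of_real) (auto simp: abs_mult)
    show "norm (\<gamma> s) < \<sigma>" using n that \<sigma>_pos by (simp add: mult_less_cancel_left1)
    show "\<gamma> s \<in> ball (of_real \<sigma>) r" using n that \<sigma>_pos by (simp add: dist_norm pos_less_divide_eq mult.commute)
    show "\<gamma> s \<noteq> of_real \<sigma>" using n that \<sigma>_pos by auto
  qed
  have "filterlim \<gamma> K (at_right 0)"
    unfolding filterlim_at
  proof
    show "eventually (\<lambda>s. \<gamma> s \<in> \<Delta> \<and> \<gamma> s \<noteq> of_real \<sigma>) (at_right 0)"
      using small by eventually_elim (use norm\<gamma> norm_less_imp_\<Delta> in blast)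
    show "(\<gamma> \<longlongrightarrow> of_real \<sigma>) (at_right 0)" unfolding \<gamma>_def by (auto intro!: tendsto_eq_intros)
  qed
  from landau_o.big.compose[OF Q this]
  have O: "(\<lambda>s. S_cont (\<gamma> s) - (poly Q (of_real s) - \<kappa> * of_real s ^ 4 * Ln (of_real s))) \<in> O[at_right 0](\<lambda>s. complex_of_real s ^ 5 * of_real (1 + norm (Ln (complex_of_real s))))"
    by (simp only: Y\<gamma> \<kappa>_def)
  define H where "H w = poly Q w - h (of_real \<sigma> * (1 - w))" for w
  have "(\<lambda>w. h (of_real \<sigma> * (1 - w))) holomorphic_on ball 0 (r / \<sigma>)"
  proof -
    have "(h \<circ> (\<lambda>w. of_real \<sigma> * (1 - w))) holomorphic_on ball 0 (r / \<sigma>)"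
    proof (rule holomorphic_on_compose_gen[OF _ h])
      show "(\<lambda>w. complex_of_real \<sigma> * (1 - w)) ` ball 0 (r / \<sigma>) \<subseteq> ball (of_real \<sigma>) r"
        using \<sigma>_pos by (auto simp: dist_norm algebra_simps norm_mult field_simps)
    qed (intro holomorphic_intros)
    then show ?thesis by (simp add: comp_def)
  qed
  then have H: "H holomorphic_on ball 0 (r / \<sigma>)" unfolding H_def by (intro holomorphic_intros)
  have "((\<lambda>s. H (of_real s) / of_real (s ^ 4 * ln s) - \<kappa>) \<longlongrightarrow> 0) (at_right 0)"
  proof (rule bigo_tendsto_zero)
    have "(\<lambda>s::real. complex_of_real s ^ 5 * of_real (1 + norm (Ln (complex_of_real s)))) \<in> O[at_right 0](\<lambda>s. of_real (s ^ 5 * (1 + \<bar>ln s\<bar>)))"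
    proof (rule bigoI[of _ 1])
      show "eventually (\<lambda>s. norm (complex_of_real s ^ 5 * of_real (1 + norm (Ln (complex_of_real s)))) \<le> 1 * norm (complex_of_real (s ^ 5 * (1 + \<bar>ln s\<bar>)))) (at_right 0)"
        using small
      proof eventually_elim
        case (elim s)
        then have "norm (Ln (complex_of_real s)) = \<bar>ln s\<bar>" by (simp add: Ln_of_real)
        then show ?case by (simp only: of_real_mult of_real_power mult_1 order_refl)
      qed
    qed
    from landau_o.big_trans[OF O this]
    have "(\<lambda>s. S_cont (\<gamma> s) - (poly Q (of_real s) - \<kappa> * of_real s ^ 4 * Ln (of_real s))) \<in> O[at_right 0](\<lambda>s. complex_of_real (s ^ 5 * (1 + \<bar>ln s\<bar>)))" .
    then have quot: "(\<lambda>s. (S_cont (\<gamma> s) - (poly Q (of_real s) - \<kappa> * of_real s ^ 4 * Ln (of_real s))) / (- complex_of_real (s ^ 4 * ln s)))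
      \<in> O[at_right 0](\<lambda>s. complex_of_real (s ^ 5 * (1 + \<bar>ln s\<bar>)) / complex_of_real (s ^ 4 * ln s))"
      using small by (intro landau_o.big.divide) (auto elim!: eventually_mono)
    have ev: "eventually (\<lambda>s. (S_cont (\<gamma> s) - (poly Q (of_real s) - \<kappa> * of_real s ^ 4 * Ln (of_real s))) / (- complex_of_real (s ^ 4 * ln s))
        = H (of_real s) / of_real (s ^ 4 * ln s) - \<kappa>) (at_right 0)"
      using small
    proof eventually_elim
      case (elim s)
      define d where "d = complex_of_real (s ^ 4 * ln s)"
      have d: "d \<noteq> 0" using elim by (simp add: d_def)
      have "h (\<gamma> s) = S_cont (\<gamma> s)" using agree norm\<gamma>[OF elim] by blast
      then have e1: "H (of_real s) = poly Q (of_real s) - S_cont (\<gamma> s)" by (simp add: H_def \<gamma>_def)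
      have e2: "\<kappa> * of_real s ^ 4 * Ln (of_real s) = \<kappa> * d" using elim by (simp add: Ln_of_real d_def)
      show ?case unfolding e1 e2 d_def[symmetric] using d by (simp add: field_simps)
    qed
    show "(\<lambda>s. H (of_real s) / of_real (s ^ 4 * ln s) - \<kappa>) \<in> O[at_right 0](\<lambda>s. complex_of_real (s ^ 5 * (1 + \<bar>ln s\<bar>)) / complex_of_real (s ^ 4 * ln s))"
      by (rule landau_o.big.in_cong[OF ev, THEN iffD1, OF quot])
    have "((\<lambda>s::real. s ^ 5 * (1 + \<bar>ln s\<bar>) / (s ^ 4 * ln s)) \<longlongrightarrow> 0) (at_right 0)" by real_asymp
    from tendsto_of_real[OF this, where 'a = complex]
    show "((\<lambda>s. complex_of_real (s ^ 5 * (1 + \<bar>ln s\<bar>)) / complex_of_real (s ^ 4 * ln s)) \<longlongrightarrow> 0) (at_right 0)"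
      by simp
  qed
  then have "((\<lambda>s. H (of_real s) / of_real (s ^ 4 * ln s)) \<longlongrightarrow> \<kappa>) (at_right 0)" by (rule LIM_zero_cancel)
  then show False using log_coefficient_not_analytic[OF H _ \<kappa>] r \<sigma>_pos by simp
qed

section \<open>Radius of convergence, uniqueness and the boundary singularity\<close>

lemma S_conv_radius: "fps_conv_radius S_series = ereal \<sigma>"
proof (rule antisym)
  show "fps_conv_radius S_series \<le> ereal \<sigma>"
  proof (rule ccontr)
    assume "\<not> ?thesis"
    then obtain t where t: "ereal \<sigma> < ereal t" "ereal t < fps_conv_radius S_series"
      using ereal_dense2 by (metis linorder_not_le)
    \<comment> \<open>Were the radius larger than \<sigma>, the sum of the series itself would be a
      continuation to a neighbourhood of \<sigma>.\<close>
    have "eval_fps S_series holomorphic_on ball (of_real \<sigma>) (t - \<sigma>)"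
    proof (rule holomorphic_on_subset[OF holomorphic_on_eval_fps])
      show "ball (complex_of_real \<sigma>) (t - \<sigma>) \<subseteq> eball 0 (fps_conv_radius S_series)"
      proof
        fix y assume "y \<in> ball (complex_of_real \<sigma>) (t - \<sigma>)"
        then have "norm y < t"
          using norm_triangle_ineq2[of y "of_real \<sigma>"] \<sigma>_pos by (simp add: dist_norm norm_minus_commute)
        then have "ereal (norm y) < ereal t" by simp
        also note t(2)
        finally show "y \<in> eball 0 (fps_conv_radius S_series)" by (simp add: in_eball_iff)
      qed
    qed simp
    then show False using no_continuation_at_\<sigma>[of "t - \<sigma>" "eval_fps S_series"] t(1) eval_S by auto
  qed
qed (rule S_conv_radius_ge)

lemma continuation_S_cont: "holomorphic_continuation S_series \<Delta> S_cont"
  unfolding holomorphic_continuation_def S_conv_radius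
  using \<sigma>_pos holomorphic_S_cont norm_less_imp_\<Delta> eval_S by (auto simp: in_eball_iff)

text \<open>Any two continuations agree on the disk of radius \<sigma>, and \<Delta> is connected
  because \<open>D\<close> is star-shaped about 0.\<close>

lemma continuation_unique:
  assumes h: "holomorphic_continuation S_series \<Delta> h" and y: "y \<in> \<Delta>"
  shows "h y = S_cont y"
proof (rule analytic_continuation_open[of "ball 0 \<sigma>" \<Delta> h S_cont])
  show "h holomorphic_on \<Delta>" using h by (simp add: holomorphic_continuation_def)
  show "h z = S_cont z" if "z \<in> ball 0 \<sigma>" for z
  proof -
    have "z \<in> eball 0 (ereal \<sigma>)" using that by (simp add: in_eball_iff)
    then show ?thesis using h continuation_S_cont unfolding holomorphic_continuation_def S_conv_radius by metis
  qed
qed (use \<sigma>_pos open_\<Delta> connected_\<Delta> holomorphic_S_cont y norm_less_imp_\<Delta> in auto)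

lemma boundary_singularities_S: "boundary_singularities S_series = {of_real \<sigma>}"
proof (intro equalityI subsetI)
  fix w assume w: "w \<in> boundary_singularities S_series"
  show "w \<in> {of_real \<sigma>}"
  proof (rule ccontr)
    assume "w \<notin> {of_real \<sigma>}"
    moreover have "norm w = \<sigma>" using w by (simp add: boundary_singularities_def S_conv_radius)
    ultimately have "w \<in> \<Delta>" using ball_subset_\<Delta>[of w] by simp
    then obtain r where r: "0 < r" "ball w r \<subseteq> \<Delta>" using open_\<Delta> open_contains_ball by blast
    then have "S_cont holomorphic_on ball w r" using holomorphic_S_cont holomorphic_on_subset by blast
    then show False using w r eval_S
      by (auto simp: boundary_singularities_def S_conv_radius in_eball_iff)
  qed
next
  fix w assume "w \<in> {complex_of_real \<sigma>}"
  then have w: "w = of_real \<sigma>" by simp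
  have "\<not> (\<exists>r>0. \<exists>h. h holomorphic_on ball w r \<and> (\<forall>y\<in>ball w r \<inter> eball 0 (ereal \<sigma>). h y = eval_fps S_series y))"
  proof
    assume "\<exists>r>0. \<exists>h. h holomorphic_on ball w r \<and> (\<forall>y\<in>ball w r \<inter> eball 0 (ereal \<sigma>). h y = eval_fps S_series y)"
    then obtain r h where "0 < r" "h holomorphic_on ball (of_real \<sigma>) r"
      "\<And>y. y \<in> ball (of_real \<sigma>) r \<Longrightarrow> norm y < \<sigma> \<Longrightarrow> h y = eval_fps S_series y"
      unfolding w by (auto simp: in_eball_iff)
    then show False using no_continuation_at_\<sigma>[of r h] eval_S by simp
  qed
  then show "w \<in> boundary_singularities S_series"
    using \<sigma>_pos by (simp add: boundary_singularities_def S_conv_radius w)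
qed

theorem theorem2p2:
  shows "(\<exists>\<epsilon> \<phi> :: real. 0 < \<epsilon> \<and> 0 < \<phi> \<and> \<phi> < pi / 2 \<and>
           (\<exists>g. holomorphic_continuation S_series (Delta \<sigma> \<epsilon> \<phi>) g \<and>
                (\<forall>h. holomorphic_continuation S_series (Delta \<sigma> \<epsilon> \<phi>) h \<longrightarrow>
                     (\<forall>y\<in>Delta \<sigma> \<epsilon> \<phi>. h y = g y)) \<and>
                (\<exists>Q\<^sub>4 :: complex poly. degree Q\<^sub>4 \<le> 4 \<and>
                  (\<forall>\<epsilon>' \<phi>' :: real. 0 < \<epsilon>' \<and> \<epsilon>' < \<epsilon> \<and> \<phi> < \<phi>' \<and> \<phi>' < pi / 2 \<longrightarrow>
                    (\<lambda>y. g y - (poly Q\<^sub>4 (1 - y / of_real \<sigma>)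
                              - 1 / of_real (pi * A ^ 5) * (1 - y / of_real \<sigma>) ^ 4
                                  * Ln (1 - y / of_real \<sigma>)))
                    \<in> O[at (of_real \<sigma>) within Delta_sector \<sigma> \<epsilon>' \<phi>'](\<lambda>y. (1 - y / of_real \<sigma>) ^ 5
                              * of_real (1 + norm (Ln (1 - y / of_real \<sigma>))))))))
         \<and> boundary_singularities S_series = {of_real \<sigma>}"
proof (rule conjI[OF _ boundary_singularities_S])
  obtain Q where Q: "degree Q \<le> 4"
    "(\<lambda>y. S_cont y - (poly Q (Y y) - 1 / of_real (pi * A ^ 5) * Y y ^ 4 * Ln (Y y))) \<in> O[K](R)"
    using S_cont_expansion by blast
  have sector: "(\<lambda>y. S_cont y - (poly Q (Y y) - 1 / of_real (pi * A ^ 5) * Y y ^ 4 * Ln (Y y)))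
      \<in> O[at (of_real \<sigma>) within Delta_sector \<sigma> \<epsilon>' \<phi>'](R)"
    if "0 < \<epsilon>' \<and> \<epsilon>' < \<sigma> / 50 \<and> arccos (1/10) < \<phi>' \<and> \<phi>' < pi / 2" for \<epsilon>' \<phi>'
  proof -
    \<comment> \<open>The estimate is available along \<Delta> itself and passes to the sector
      because the filter there is finer.\<close>
    have "Delta_sector \<sigma> \<epsilon>' \<phi>' \<subseteq> \<Delta>"
    proof
      fix y assume y: "y \<in> Delta_sector \<sigma> \<epsilon>' \<phi>'"
      have "norm y \<le> \<sigma> + norm (y - of_real \<sigma>)"
        using norm_triangle_ineq[of "of_real \<sigma>" "y - of_real \<sigma>"] \<sigma>_pos by simp
      then show "y \<in> \<Delta>" using y that by (auto simp: Delta_sector_def Delta_def)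
    qed
    then have "at (of_real \<sigma>) within Delta_sector \<sigma> \<epsilon>' \<phi>' \<le> K" by (rule at_le)
    then show ?thesis using Q(2) by (rule landau_o.big.filter_mono)
  qed
  have "0 < arccos (1/10)" "arccos (1/10) < pi / 2"
    using arccos_less_arccos[of "1/10" 1] arccos_less_arccos[of 0 "1/10"] by (simp_all add: arccos_0)
  then show "\<exists>\<epsilon> \<phi> :: real. 0 < \<epsilon> \<and> 0 < \<phi> \<and> \<phi> < pi / 2 \<and>
           (\<exists>g. holomorphic_continuation S_series (Delta \<sigma> \<epsilon> \<phi>) g \<and>
                (\<forall>h. holomorphic_continuation S_series (Delta \<sigma> \<epsilon> \<phi>) h \<longrightarrow>
                     (\<forall>y\<in>Delta \<sigma> \<epsilon> \<phi>. h y = g y)) \<and>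
                (\<exists>Q\<^sub>4 :: complex poly. degree Q\<^sub>4 \<le> 4 \<and>
                  (\<forall>\<epsilon>' \<phi>' :: real. 0 < \<epsilon>' \<and> \<epsilon>' < \<epsilon> \<and> \<phi> < \<phi>' \<and> \<phi>' < pi / 2 \<longrightarrow>
                    (\<lambda>y. g y - (poly Q\<^sub>4 (1 - y / of_real \<sigma>)
                              - 1 / of_real (pi * A ^ 5) * (1 - y / of_real \<sigma>) ^ 4
                                  * Ln (1 - y / of_real \<sigma>)))
                    \<in> O[at (of_real \<sigma>) within Delta_sector \<sigma> \<epsilon>' \<phi>'](\<lambda>y. (1 - y / of_real \<sigma>) ^ 5
                              * of_real (1 + norm (Ln (1 - y / of_real \<sigma>)))))))"
    by (intro exI[of _ "\<sigma> / 50"] exI[of _ "arccos (1/10)"] exI[of _ S_cont] exI[of _ Q] conjI allI impI ballI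
        continuation_S_cont continuation_unique Q(1) sector) (use \<sigma>_pos in simp_all)
qed

end
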